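(* Consider the stochastic LTI system, data-collection controller, trajectory library and Kalman-filter quantities described in the context, assume all standing assumptions listed there hold, and suppose in addition that $(A,Q^{1/2})$ is stabilizable. Let $\Sigma\succ0$ and $P_1^-\succ0$ be arbitrary $n\times n$ matrices. Then there exists a constant $0<\rho<1$ such that $$\lim_{T_{ini}\to\infty}\|\eta_f(\Sigma)-\eta_f(P_1^-)\|\rho^{-T_{ini}}=0,\quad \lim_{T_{ini}\to\infty}\|O_f\hat\psi^-_{T_{ini}+1}(P_1^-)\|\rho^{-T_{ini}}=0,\quad \lim_{T_{ini}\to\infty}\|\mathcal Y_f(\Sigma)-\mathcal Y_f(P_1^-)\|\rho^{-T_{ini}}=0,$$ where $\eta_f,\hat\psi^-_{T_{ini}+1},\mathcal Y_f$ are the Kalman-filter quantities (which depend on $T_{ini}$) defined in the context.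
   Context: System: $x_{t+1}=Ax_t+Bu_t+w_t$, $y_t=Cx_t+v_t$, with $x_t\in\mathbb R^n$, $u_t\in\mathbb R^m$, $y_t\in\mathbb R^p$, $(A,B,C)$ a minimal realization, $w_t$ i.i.d. $\mathcal N(0,Q)$ with $Q\succeq0$, $v_t$ i.i.d. $\mathcal N(0,R)$ with $R\succ0$, mutually independent and independent of initial states. Fix $T\ge1$; $T_{ini}\ge1$ is the initial-horizon length. Standing assumptions: (i) data-collection controller: library inputs generated by a stabilizing controller $\phi_{t+1}=A_{\mathrm{ctrl}}\phi_t+B_{\mathrm{ctrl}}y_t$, $u_t=C_{\mathrm{ctrl}}\phi_t+\nu_t$, minimal, $\nu_t$ i.i.d. $\mathcal N(0,R_{\mathrm{ctrl}})$, $R_{\mathrm{ctrl}}\succ0$, $\phi_t$ recorded, $\phi_1\sim\mathcal N(0,\Sigma_\phi)$, $\Sigma_\phi\succ0$; (ii) persistency of excitation of the library input data (a single library trajectory of length $K\ge(m+1)(T_{ini}+T+n)-1$ whose block Hankel input matrix with $T_{ini}+T+n$ block rows has full row rank); (iii) the initial state of the current online trajectory is Gaussian; for a multi-trajectory library the initial states are i.i.d. $\mathcal N(0,\check\Sigma)$ with $\check\Sigma\succ0$ and $\check\Sigma-\check\Sigma_{x\phi}\Sigma_\phi^\dagger\check\Sigma_{x\phi}^\top\succ0$, $\check\Sigma_{x\phi}=\mathbb E(\check x_1\check\phi_1^\top)$; for a single-trajectory library the initial state is Gaussian. Kalman-filter quantities: for $P\succeq0$, $\mu\in\mathbb R^n$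 and data $u_{ini}=\mathrm{col}(u_1,\dots,u_{T_{ini}})$, $y_{ini}=\mathrm{col}(y_1,\dots,y_{T_{ini}})$, run $\hat x_1^-=\mu$, $P_1^-=P$, and for $t=1,\dots,T_{ini}$: $K_t=P_t^-C^\top(CP_t^-C^\top+R)^{-1}$, $\hat x_t=\hat x_t^-+K_t(y_t-C\hat x_t^-)$, $P_t=(I-K_tC)P_t^-$, $\hat x_{t+1}^-=A\hat x_t+Bu_t$, $P_{t+1}^-=AP_tA^\top+Q$. Then $P^-_{T_{ini}+1}=:P^-_{T_{ini}+1}(P)$ depends only on $P$, and $\hat x^-_{T_{ini}+1}=\hat\theta^-_{T_{ini}+1}(P)\mathrm{col}(u_{ini},y_{ini})+\hat\psi^-_{T_{ini}+1}(P)\mu$ for matrices depending only on $P$ and $(A,B,C,Q,R)$. Let $O_f=\mathrm{col}(C,CA,\dots,CA^{T-1})$, $G_f$ the $T\times T$ block lower-triangular matrix with $(i,j)$ block $CA^{i-j-1}$ for $i>j$ and $0$ otherwise, $H_f=G_f(I_T\otimes B)$, $Q_f=I_T\otimes Q$, $R_f=I_T\otimes R$, $\eta_f(P)=[O_f\hat\theta^-_{T_{ini}+1}(P)\ \ H_f]$, $\mathcal Y_f(P)=O_fP^-_{T_{ini}+1}(P)O_f^\top+G_fQ_fG_f^\top+R_f$. *)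

theory Defs
  imports "Jordan_Normal_Form.Spectral_Radius"
begin

definition sym_mat :: "real mat \<Rightarrow> bool" where
  "sym_mat M \<longleftrightarrow> dim_row M = dim_col M \<and> transpose_mat M = M"

definition psd_mat :: "real mat \<Rightarrow> bool" where
  "psd_mat M \<longleftrightarrow> sym_mat M \<and>
     (\<forall>x \<in> carrier_vec (dim_row M). x \<bullet> (M *\<^sub>v x) \<ge> 0)"

definition pd_mat :: "real mat \<Rightarrow> bool" where
  "pd_mat M \<longleftrightarrow> sym_mat M \<and>
     (\<forall>x \<in> carrier_vec (dim_row M). x \<noteq> 0\<^sub>v (dim_row M) \<longrightarrow> x \<bullet> (M *\<^sub>v x) > 0)"

definition mat_inv :: "real mat \<Rightarrow> real mat" where
  "mat_inv M = (THE N. N \<in> carrier_mat (dim_row M) (dim_row M) \<and>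
       M * N = 1\<^sub>m (dim_row M) \<and> N * M = 1\<^sub>m (dim_row M))"

definition mat_sqrt :: "real mat \<Rightarrow> real mat" where
  "mat_sqrt M = (THE S. S \<in> carrier_mat (dim_row M) (dim_row M) \<and> psd_mat S \<and> S * S = M)"

definition vnorm :: "real vec \<Rightarrow> real" where
  "vnorm v = sqrt (v \<bullet> v)"

definition mnorm :: "real mat \<Rightarrow> real" where
  "mnorm M = Sup {vnorm (M *\<^sub>v v) | v. v \<in> carrier_vec (dim_col M) \<and> vnorm v \<le> 1}"

definition schur_stable :: "real mat \<Rightarrow> bool" where
  "schur_stable M \<longleftrightarrow> spectral_radius (map_mat complex_of_real M) < 1"

definition stabilizable :: "real mat \<Rightarrow> real mat \<Rightarrow> bool" where
  "stabilizable A G \<longleftrightarrow>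
     (\<exists>K \<in> carrier_mat (dim_col G) (dim_row A). schur_stable (A + G * K))"

text \<open>Controllability / observability: the controllability matrix [B AB ... A^(n-1)B] has
  full row rank (trivial left kernel), resp. the observability matrix has full column rank.\<close>
definition controllable :: "nat \<Rightarrow> real mat \<Rightarrow> real mat \<Rightarrow> bool" where
  "controllable n A B \<longleftrightarrow>
     (\<forall>v \<in> carrier_vec n. (\<forall>k<n. transpose_mat (A ^\<^sub>m k * B) *\<^sub>v v = 0\<^sub>v (dim_col B))
         \<longrightarrow> v = 0\<^sub>v n)"

definition observable :: "nat \<Rightarrow> real mat \<Rightarrow> real mat \<Rightarrow> bool" where
  "observable n A C \<longleftrightarrow>
     (\<forall>v \<in> carrier_vec n. (\<forall>k<n. (C * A ^\<^sub>m k) *\<^sub>v v = 0\<^sub>v (dim_row C)) \<longrightarrow> v = 0\<^sub>v n)"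

definition minimal_realization :: "nat \<Rightarrow> real mat \<Rightarrow> real mat \<Rightarrow> real mat \<Rightarrow> bool" where
  "minimal_realization n A B C \<longleftrightarrow> controllable n A B \<and> observable n A C"

definition kf_gain :: "real mat \<Rightarrow> real mat \<Rightarrow> real mat \<Rightarrow> real mat" where
  "kf_gain C R Pm = Pm * transpose_mat C * mat_inv (C * Pm * transpose_mat C + R)"

text \<open>kf_prior A C Q R P t = P^-_{t+1} (so index 0 is P^-_1 = P).\<close>
fun kf_prior :: "real mat \<Rightarrow> real mat \<Rightarrow> real mat \<Rightarrow> real mat \<Rightarrow> real mat \<Rightarrow> nat \<Rightarrow> real mat" where
  "kf_prior A C Q R P 0 = P"
| "kf_prior A C Q R P (Suc t) =
     (let Pm = kf_prior A C Q R P t; K = kf_gain C R Pm;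
          Pt = (1\<^sub>m (dim_row A) - K * C) * Pm
      in A * Pt * transpose_mat A + Q)"

text \<open>kf_xpred ... mu us ys t = hat x^-_{t+1}; us t, ys t are u_{t+1}, y_{t+1} (0-indexed data).\<close>
fun kf_xpred :: "real mat \<Rightarrow> real mat \<Rightarrow> real mat \<Rightarrow> real mat \<Rightarrow> real mat \<Rightarrow> real mat \<Rightarrow>
    real vec \<Rightarrow> (nat \<Rightarrow> real vec) \<Rightarrow> (nat \<Rightarrow> real vec) \<Rightarrow> nat \<Rightarrow> real vec" where
  "kf_xpred A B C Q R P mu us ys 0 = mu"
| "kf_xpred A B C Q R P mu us ys (Suc t) =
     (let xm = kf_xpred A B C Q R P mu us ys t;
          K = kf_gain C R (kf_prior A C Q R P t);
          xh = xm + K *\<^sub>v (ys t - C *\<^sub>v xm)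
      in A *\<^sub>v xh + B *\<^sub>v us t)"

definition stack_data :: "nat \<Rightarrow> nat \<Rightarrow> nat \<Rightarrow> (nat \<Rightarrow> real vec) \<Rightarrow> (nat \<Rightarrow> real vec) \<Rightarrow> real vec" where
  "stack_data m p T us ys = vec (T * m + T * p)
     (\<lambda>i. if i < T * m then us (i div m) $ (i mod m)
          else ys ((i - T * m) div p) $ ((i - T * m) mod p))"

definition kf_coeffs :: "nat \<Rightarrow> nat \<Rightarrow> nat \<Rightarrow> real mat \<Rightarrow> real mat \<Rightarrow> real mat \<Rightarrow> real mat \<Rightarrow>
    real mat \<Rightarrow> real mat \<Rightarrow> nat \<Rightarrow> real mat \<times> real mat" where
  "kf_coeffs n m p A B C Q R P Tini = (THE (Th, Ps).
      Th \<in> carrier_mat n (Tini * m + Tini * p) \<and> Ps \<in> carrier_mat n n \<and>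
      (\<forall>mu us ys. mu \<in> carrier_vec n \<longrightarrow> (\<forall>i<Tini. us i \<in> carrier_vec m) \<longrightarrow>
         (\<forall>i<Tini. ys i \<in> carrier_vec p) \<longrightarrow>
         kf_xpred A B C Q R P mu us ys Tini = Th *\<^sub>v stack_data m p Tini us ys + Ps *\<^sub>v mu))"

definition kf_theta where "kf_theta n m p A B C Q R P Tini = fst (kf_coeffs n m p A B C Q R P Tini)"
definition kf_psi where "kf_psi n m p A B C Q R P Tini = snd (kf_coeffs n m p A B C Q R P Tini)"

definition O_f :: "nat \<Rightarrow> nat \<Rightarrow> nat \<Rightarrow> real mat \<Rightarrow> real mat \<Rightarrow> real mat" where
  "O_f n p T A C = mat (T * p) n (\<lambda>(i, j). (C * A ^\<^sub>m (i div p)) $$ (i mod p, j))"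

definition G_f :: "nat \<Rightarrow> nat \<Rightarrow> nat \<Rightarrow> real mat \<Rightarrow> real mat \<Rightarrow> real mat" where
  "G_f n p T A C = mat (T * p) (T * n) (\<lambda>(i, j).
     if i div p > j div n then (C * A ^\<^sub>m (i div p - j div n - 1)) $$ (i mod p, j mod n) else 0)"

definition kron_eye :: "nat \<Rightarrow> real mat \<Rightarrow> real mat" where
  "kron_eye T M = mat (T * dim_row M) (T * dim_col M) (\<lambda>(i, j).
     if i div dim_row M = j div dim_col M then M $$ (i mod dim_row M, j mod dim_col M) else 0)"

definition hcat :: "real mat \<Rightarrow> real mat \<Rightarrow> real mat" where
  "hcat M N = mat (dim_row M) (dim_col M + dim_col N) (\<lambda>(i, j).
     if j < dim_col M then M $$ (i, j) else N $$ (i, j - dim_col M))"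

definition H_f :: "nat \<Rightarrow> nat \<Rightarrow> nat \<Rightarrow> real mat \<Rightarrow> real mat \<Rightarrow> real mat \<Rightarrow> real mat" where
  "H_f n p T A B C = G_f n p T A C * kron_eye T B"

definition eta_f :: "nat \<Rightarrow> nat \<Rightarrow> nat \<Rightarrow> nat \<Rightarrow> real mat \<Rightarrow> real mat \<Rightarrow> real mat \<Rightarrow> real mat \<Rightarrow>
    real mat \<Rightarrow> nat \<Rightarrow> real mat \<Rightarrow> real mat" where
  "eta_f n m p T A B C Q R Tini P =
     hcat (O_f n p T A C * kf_theta n m p A B C Q R P Tini) (H_f n p T A B C)"

definition Y_f :: "nat \<Rightarrow> nat \<Rightarrow> nat \<Rightarrow> real mat \<Rightarrow> real mat \<Rightarrow> real mat \<Rightarrow> real mat \<Rightarrow>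
    nat \<Rightarrow> real mat \<Rightarrow> real mat" where
  "Y_f n p T A C Q R Tini P =
     O_f n p T A C * kf_prior A C Q R P Tini * transpose_mat (O_f n p T A C)
     + G_f n p T A C * kron_eye T Q * transpose_mat (G_f n p T A C) + kron_eye T R"

end

theory Submission
  imports Defs "HOL-Analysis.L2_Norm"
begin

text \<open>
  Write \<open>P\<^sub>t\<close> for the prior covariances started at \<open>X\<close> and \<open>F\<^sub>t = A (1 - K\<^sub>t C)\<close> for the closed loop. The
  quadratic form \<open>z\<^sup>T P\<^sub>t z\<close> is the value function of a linear-quadratic problem for the dual system, and one
  step of the Riccati recursion completes a square. Observability bounds \<open>P\<^sub>t\<close> uniformly in \<open>t\<close>.
  Along the adjoint closed loop \<open>z\<^sup>T P\<^sub>t z\<close> decreases by \<open>z\<^sup>T Q z\<close> plus a term controlling the gain; adding a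
  small multiple of a norm adapted to the Schur stable matrix \<open>(A + Q\<^sup>1\<^sup>/\<^sup>2 L)\<^sup>T\<close>, with \<open>L\<close> from stabilizability, gives a
  strict Lyapunov function, so the products of the \<open>F\<^sub>t\<close> decay exponentially. No solution of the algebraic
  Riccati equation is needed: the difference of two covariance sequences is transported by
  \<open>D \<mapsto> F\<^sub>t D F'\<^sub>t\<^sup>T\<close>, so it decays at the squared rate, hence so do the differences of the gains, and
  the two predictors differ by an exponentially stable recursion with an exponentially small input.
\<close>

section \<open>Vectors and bounded matrices\<close>

text \<open>The closed loops vary with time, so eigenvalues of the individual
  \<open>F\<^sub>t\<close> say nothing about their products; a Lyapunov function along the whole
  sequence is needed. The form of \<open>P\<^sub>t\<close> alone cannot serve: for singular
  \<open>Q\<close> its decrease misses directions, and for singular \<open>A\<close> and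
  \<open>Q\<close> the form itself can degenerate. The adapted norm repairs both, and its weight
  \<open>1 / \<beta>\<close> is so small that the error it picks up is paid by the decrease of the
  Riccati form. The data coefficient has more columns the longer the initial horizon, so entrywise
  estimates would grow with it. Instead each data block is bounded by the norm of the whole data
  vector and the contributions are summed geometrically. The squared rate of the gain difference
  matters there: a single rate, convolved with the decay of the closed loop, would leave a factor
  equal to the horizon. Inverse, square root and coefficient matrices are definite descriptions, so
  nothing can be computed with them before existence and uniqueness are proved. The square root
  comes from a monotone iteration, with no spectral theorem.\<close>

lemma mult_mat_vec_assoc_dim:
  "dim_col A = dim_row B \<Longrightarrow> dim_col B = dim_vec v \<Longrightarrow> (A * B) *\<^sub>v v = A *\<^sub>v (B *\<^sub>v v)"
  for A B :: "real mat"
  by (rule assoc_mult_mat_vec[of _ "dim_row A" "dim_row B" _ "dim_col B"]) (auto intro: carrier_matI carrier_vecI)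

lemma mult_mat_vec_add_dim:
  "dim_vec v = dim_col A \<Longrightarrow> dim_vec w = dim_col A \<Longrightarrow> A *\<^sub>v (v + w) = A *\<^sub>v v + A *\<^sub>v w"
  for A :: "real mat"
  by (rule mult_add_distrib_mat_vec[of _ "dim_row A" "dim_col A"]) (auto intro: carrier_matI carrier_vecI)

lemma mult_mat_vec_diff_dim:
  "dim_vec v = dim_col A \<Longrightarrow> dim_vec w = dim_col A \<Longrightarrow> A *\<^sub>v (v - w) = A *\<^sub>v v - A *\<^sub>v w"
  for A :: "real mat"
  by (rule mult_minus_distrib_mat_vec[of _ "dim_row A" "dim_col A"]) (auto intro: carrier_matI carrier_vecI)

lemma mult_mat_vec_smult_dim:
  "dim_vec v = dim_col A \<Longrightarrow> A *\<^sub>v (c \<cdot>\<^sub>v v) = c \<cdot>\<^sub>v (A *\<^sub>v v)"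
  for A :: "real mat"
  by (rule mult_mat_vec[of _ "dim_row A" "dim_col A"]) (auto intro: carrier_matI carrier_vecI)

lemma add_mat_mult_vec_dim:
  "dim_row A = dim_row B \<Longrightarrow> dim_col A = dim_col B \<Longrightarrow> dim_vec v = dim_col B \<Longrightarrow>
    (A + B) *\<^sub>v v = A *\<^sub>v v + B *\<^sub>v v"
  for A B :: "real mat"
  by (rule add_mult_distrib_mat_vec[of _ "dim_row B" "dim_col B"]) (auto intro: carrier_matI carrier_vecI)

lemma minus_mat_mult_vec_dim:
  "dim_row A = dim_row B \<Longrightarrow> dim_col A = dim_col B \<Longrightarrow> dim_vec v = dim_col B \<Longrightarrow>
    (A - B) *\<^sub>v v = A *\<^sub>v v - B *\<^sub>v v"
  for A B :: "real mat"
  by (rule minus_mult_distrib_mat_vec[of _ "dim_row B" "dim_col B"]) (auto intro: carrier_matI carrier_vecI)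

lemma smult_mat_mult_vec_dim:
  "dim_vec v = dim_col A \<Longrightarrow> (c \<cdot>\<^sub>m A) *\<^sub>v v = c \<cdot>\<^sub>v (A *\<^sub>v v)"
  for A :: "real mat"
  by (intro eq_vecI) auto

lemma one_mult_mat_vec_dim: "dim_vec v = n \<Longrightarrow> 1\<^sub>m n *\<^sub>v v = v"
  for v :: "real vec"
  by (rule one_mult_mat_vec) (auto intro: carrier_vecI)

lemma mult_mat_zero_vec: "A *\<^sub>v 0\<^sub>v k = 0\<^sub>v (dim_row A)" if "k = dim_col A"
  for A :: "real mat"
  using that by (intro eq_vecI) auto

lemma zero_mat_mult_vec_dim: "dim_vec v = k \<Longrightarrow> 0\<^sub>m j k *\<^sub>v v = 0\<^sub>v j"
  for v :: "real vec"
  by (intro eq_vecI) (auto simp: scalar_prod_def)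

text \<open>Carrier premises mention dimensions that do not occur in the conclusion. As equations
  between dimensions the side conditions can be discharged by simp without guessing.\<close>

lemmas mat_vec_simps = mult_mat_vec_assoc_dim mult_mat_vec_add_dim mult_mat_vec_diff_dim
  mult_mat_vec_smult_dim add_mat_mult_vec_dim minus_mat_mult_vec_dim smult_mat_mult_vec_dim
  one_mult_mat_vec_dim mult_mat_zero_vec zero_mat_mult_vec_dim

lemma sprod_add_left:
  "dim_vec u = dim_vec w \<Longrightarrow> dim_vec v = dim_vec w \<Longrightarrow> (u + v) \<bullet> w = u \<bullet> w + v \<bullet> w"
  for u v w :: "real vec"
  by (rule add_scalar_prod_distrib[of _ "dim_vec w"]) (auto intro: carrier_vecI)

lemma sprod_add_right:
  "dim_vec u = dim_vec w \<Longrightarrow> dim_vec v = dim_vec w \<Longrightarrow> w \<bullet> (u + v) = w \<bullet> u + w \<bullet> v"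
  for u v w :: "real vec"
  by (rule scalar_prod_add_distrib[of _ "dim_vec w"]) (auto intro: carrier_vecI)

lemma sprod_diff_left:
  "dim_vec u = dim_vec w \<Longrightarrow> dim_vec v = dim_vec w \<Longrightarrow> (u - v) \<bullet> w = u \<bullet> w - v \<bullet> w"
  for u v w :: "real vec"
  by (rule minus_scalar_prod_distrib[of _ "dim_vec w"]) (auto intro: carrier_vecI)

lemma sprod_diff_right:
  "dim_vec u = dim_vec w \<Longrightarrow> dim_vec v = dim_vec w \<Longrightarrow> w \<bullet> (u - v) = w \<bullet> u - w \<bullet> v"
  for u v w :: "real vec"
  by (rule scalar_prod_minus_distrib[of _ "dim_vec w"]) (auto intro: carrier_vecI)

lemmas sprod_simps = sprod_add_left sprod_add_right sprod_diff_left sprod_diff_right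
  scalar_prod_smult_left scalar_prod_smult_right

lemma sprod_comm: "dim_vec u = dim_vec v \<Longrightarrow> u \<bullet> v = v \<bullet> u"
  for u v :: "real vec"
  by (rule comm_scalar_prod[of _ "dim_vec v"]) (auto intro: carrier_vecI)

lemma sprod_adjoint:
  "dim_vec x = dim_row M \<Longrightarrow> dim_vec y = dim_col M \<Longrightarrow> x \<bullet> (M *\<^sub>v y) = (M\<^sup>T *\<^sub>v x) \<bullet> y"
  for M :: "real mat"
  by (rule transpose_vec_mult_scalar[symmetric, of _ "dim_row M" "dim_col M"]) (auto intro: carrier_matI carrier_vecI)

lemma transpose_mult_dim: "dim_col A = dim_row B \<Longrightarrow> (A * B)\<^sup>T = B\<^sup>T * A\<^sup>T"
  for A B :: "real mat"
  by (rule transpose_mult[of _ "dim_row A" "dim_row B" _ "dim_col B"]) auto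

lemma transpose_minus_dim:
  "dim_row A = dim_row B \<Longrightarrow> dim_col A = dim_col B \<Longrightarrow> (A - B)\<^sup>T = A\<^sup>T - B\<^sup>T"
  for A B :: "real mat"
  by (intro eq_matI) auto

lemma transpose_add_dim:
  "dim_row A = dim_row B \<Longrightarrow> dim_col A = dim_col B \<Longrightarrow> (A + B)\<^sup>T = A\<^sup>T + B\<^sup>T"
  for A B :: "real mat"
  by (intro eq_matI) auto

lemma mat_eqI_vec:
  fixes A B :: "real mat"
  assumes "dim_row A = dim_row B" "dim_col A = dim_col B"
    and eq: "\<And>v. dim_vec v = dim_col B \<Longrightarrow> A *\<^sub>v v = B *\<^sub>v v"
  shows "A = B"
proof (rule eq_matI)
  fix i j assume ij: "i < dim_row B" "j < dim_col B"
  from eq[of "unit_vec (dim_col B) j"] have "(A *\<^sub>v unit_vec (dim_col B) j) $ i = (B *\<^sub>v unit_vec (dim_col B) j) $ i"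
    by simp
  then show "A $$ (i, j) = B $$ (i, j)" using ij assms(1,2) by simp
qed (use assms in auto)

lemma vec_eq_zero_if_sprod_self: "x \<bullet> x = 0 \<Longrightarrow> x = 0\<^sub>v (dim_vec x)"
  for x :: "real vec"
proof (rule eq_vecI)
  fix i assume x: "x \<bullet> x = 0" and "i < dim_vec (0\<^sub>v (dim_vec x) :: real vec)"
  then have i: "i \<in> {0..<dim_vec x}" by simp
  have "\<forall>i\<in>{0..<dim_vec x}. x $ i * x $ i = 0"
    using x unfolding scalar_prod_def by (subst (asm) sum_nonneg_eq_0_iff) auto
  then show "x $ i = 0\<^sub>v (dim_vec x) $ i" using i by simp
qed simp

lemma sprod_self_nonneg: "0 \<le> x \<bullet> x"
  for x :: "real vec"
  by (auto simp: scalar_prod_def intro: sum_nonneg)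

section \<open>Euclidean norm and operator bounds\<close>

lemma vnorm_L2_set: "vnorm v = L2_set (($) v) {0..<dim_vec v}"
  by (simp add: vnorm_def L2_set_def scalar_prod_def power2_eq_square)

lemma vnorm_nonneg [simp]: "0 \<le> vnorm v"
  by (simp add: vnorm_def sprod_self_nonneg)

lemma vnorm_power2: "(vnorm v)\<^sup>2 = v \<bullet> v"
  by (simp add: vnorm_def sprod_self_nonneg)

lemma vnorm_zero [simp]: "vnorm (0\<^sub>v n) = 0"
  by (simp add: vnorm_def)

lemma vnorm_triangle: "dim_vec u = dim_vec v \<Longrightarrow> vnorm (u + v) \<le> vnorm u + vnorm v"
  using L2_set_triangle_ineq[of "($) u" "($) v" "{0..<dim_vec v}"]
  by (simp add: vnorm_L2_set L2_set_def)

lemma vnorm_uminus: "vnorm (- v) = vnorm v"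
  by (simp add: vnorm_def)

lemma vnorm_triangle_diff:
  assumes "dim_vec u = dim_vec v" shows "vnorm (u - v) \<le> vnorm u + vnorm v"
proof -
  have "u - v = u + - v" using assms by (intro eq_vecI) simp_all
  then show ?thesis using vnorm_triangle[of u "- v"] assms by (simp add: vnorm_uminus)
qed

lemma vnorm_smult: "vnorm (c \<cdot>\<^sub>v v) = \<bar>c\<bar> * vnorm v"
  by (simp add: vnorm_def real_sqrt_mult flip: mult.assoc)

lemma vnorm_cauchy_schwarz:
  assumes "dim_vec u = dim_vec v" shows "\<bar>u \<bullet> v\<bar> \<le> vnorm u * vnorm v"
proof -
  have "\<bar>u \<bullet> v\<bar> \<le> (\<Sum>i = 0..<dim_vec v. \<bar>u $ i\<bar> * \<bar>v $ i\<bar>)"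
    unfolding scalar_prod_def by (rule order_trans[OF sum_abs]) (simp add: abs_mult)
  also have "\<dots> \<le> vnorm u * vnorm v"
    unfolding vnorm_L2_set assms by (rule L2_set_mult_ineq)
  finally show ?thesis .
qed

lemma vnorm_le_if_power2_le: "v \<bullet> v \<le> c\<^sup>2 \<Longrightarrow> 0 \<le> c \<Longrightarrow> vnorm v \<le> c"
  by (metis power2_le_imp_le vnorm_power2)

text \<open>Upper bounds on the operator norm compose through this predicate without any supremum;
  \<open>mnorm\<close> enters only at the end. The clause \<open>0 \<le> c\<close> has content for
  matrices without columns, where the inequality alone admits every \<open>c\<close>.\<close>

definition op_bound :: "real mat \<Rightarrow> real \<Rightarrow> bool" where
  "op_bound M c \<longleftrightarrow> 0 \<le> c \<and> (\<forall>v. dim_vec v = dim_col M \<longrightarrow> vnorm (M *\<^sub>v v) \<le> c * vnorm v)"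

lemma op_boundI:
  "0 \<le> c \<Longrightarrow> (\<And>v. dim_vec v = dim_col M \<Longrightarrow> vnorm (M *\<^sub>v v) \<le> c * vnorm v) \<Longrightarrow> op_bound M c"
  by (simp add: op_bound_def)

lemma op_boundD: "op_bound M c \<Longrightarrow> dim_vec v = dim_col M \<Longrightarrow> vnorm (M *\<^sub>v v) \<le> c * vnorm v"
  by (simp add: op_bound_def)

lemma op_bound_nonneg: "op_bound M c \<Longrightarrow> 0 \<le> c"
  by (simp add: op_bound_def)

lemma op_bound_mono: "op_bound M c \<Longrightarrow> c \<le> d \<Longrightarrow> op_bound M d"
  unfolding op_bound_def by (meson mult_right_mono order_trans vnorm_nonneg)

lemma op_bound_one: "op_bound (1\<^sub>m n) 1"
  by (rule op_boundI) (simp_all add: one_mult_mat_vec_dim)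

lemma op_bound_mult:
  assumes M: "op_bound M c" and N: "op_bound N d" and dim: "dim_col M = dim_row N"
  shows "op_bound (M * N) (c * d)"
proof (rule op_boundI)
  show "0 \<le> c * d" using M N by (simp add: op_bound_def)
  fix v :: "real vec" assume v: "dim_vec v = dim_col (M * N)"
  have "vnorm (M *\<^sub>v (N *\<^sub>v v)) \<le> c * vnorm (N *\<^sub>v v)" using dim by (intro op_boundD[OF M]) simp
  also have "\<dots> \<le> c * (d * vnorm v)"
    using v by (intro mult_left_mono op_boundD[OF N] op_bound_nonneg[OF M]) simp
  finally show "vnorm ((M * N) *\<^sub>v v) \<le> c * d * vnorm v"
    using v dim by (simp add: mult_mat_vec_assoc_dim mult.assoc)
qed

lemma op_bound_diff:
  assumes M: "op_bound M c" and N: "op_bound N d" and dim: "dim_row M = dim_row N" "dim_col M = dim_col N"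
  shows "op_bound (M - N) (c + d)"
proof (rule op_boundI)
  show "0 \<le> c + d" using M N by (simp add: op_bound_def)
  fix v :: "real vec" assume v: "dim_vec v = dim_col (M - N)"
  then have "vnorm ((M - N) *\<^sub>v v) \<le> vnorm (M *\<^sub>v v) + vnorm (N *\<^sub>v v)"
    using dim by (simp add: mat_vec_simps vnorm_triangle_diff)
  also have "\<dots> \<le> c * vnorm v + d * vnorm v"
    using v dim by (intro add_mono op_boundD[OF M] op_boundD[OF N]) auto
  finally show "vnorm ((M - N) *\<^sub>v v) \<le> (c + d) * vnorm v" by (simp add: distrib_right)
qed

text \<open>Testing on \<open>w = M\<^sup>T *\<^sub>v v\<close> gives
  \<open>w \<bullet> w = v \<bullet> (M *\<^sub>v w)\<close>, which is at most \<open>c\<close>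
  times the norms of \<open>v\<close> and \<open>w\<close>; one norm of \<open>w\<close>
  cancels.\<close>

lemma op_bound_transpose:
  assumes M: "op_bound M c" shows "op_bound M\<^sup>T c"
proof (rule op_boundI)
  show "0 \<le> c" using M by (simp add: op_bound_def)
  fix v :: "real vec" assume v: "dim_vec v = dim_col M\<^sup>T"
  let ?w = "M\<^sup>T *\<^sub>v v"
  have "(vnorm ?w)\<^sup>2 = v \<bullet> (M *\<^sub>v ?w)" using v by (simp add: vnorm_power2 sprod_adjoint)
  also have "\<dots> \<le> vnorm v * vnorm (M *\<^sub>v ?w)"
    using vnorm_cauchy_schwarz[of v "M *\<^sub>v ?w"] v by simp
  also have "\<dots> \<le> vnorm v * (c * vnorm ?w)" by (intro mult_left_mono op_boundD[OF M]) auto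
  finally have "vnorm ?w * vnorm ?w \<le> (c * vnorm v) * vnorm ?w"
    by (simp add: power2_eq_square mult_ac)
  then show "vnorm ?w \<le> c * vnorm v"
    using \<open>0 \<le> c\<close> vnorm_nonneg[of ?w] vnorm_nonneg[of v]
    by (cases "vnorm ?w = 0") (auto simp: mult_le_cancel_right)
qed

lemma vnorm_le_entries:
  assumes "\<And>i. i < dim_vec v \<Longrightarrow> \<bar>v $ i\<bar> \<le> b"
  shows "vnorm v \<le> real (dim_vec v) * b"
proof -
  have "vnorm v \<le> (\<Sum>i = 0..<dim_vec v. \<bar>v $ i\<bar>)" unfolding vnorm_L2_set by (rule L2_set_le_sum_abs)
  also have "\<dots> \<le> (\<Sum>i = 0..<dim_vec v. b)" using assms by (intro sum_mono) auto
  finally show ?thesis by simp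
qed

lemma entry_le_vnorm: "i < dim_vec v \<Longrightarrow> \<bar>v $ i\<bar> \<le> vnorm v"
  using member_le_L2_set[of "{0..<dim_vec v}" i "\<lambda>i. \<bar>v $ i\<bar>"]
  by (simp add: vnorm_L2_set L2_set_def)

text \<open>The dimension factors are crude, but only finiteness and, for powers of a fixed matrix,
  the rate inherited from \<open>b\<close> matter.\<close>

lemma op_bound_entries:
  assumes b: "\<And>i j. i < dim_row M \<Longrightarrow> j < dim_col M \<Longrightarrow> \<bar>M $$ (i, j)\<bar> \<le> b" and "0 \<le> b"
  shows "op_bound M (real (dim_row M) * (real (dim_col M) * b))"
proof (rule op_boundI)
  fix v :: "real vec" assume v: "dim_vec v = dim_col M"
  have "\<bar>(M *\<^sub>v v) $ i\<bar> \<le> real (dim_col M) * (b * vnorm v)" if i: "i < dim_row M" for i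
  proof -
    have "\<bar>(M *\<^sub>v v) $ i\<bar> \<le> (\<Sum>j = 0..<dim_col M. \<bar>M $$ (i, j)\<bar> * \<bar>v $ j\<bar>)"
      using i v by (simp add: scalar_prod_def) (rule order_trans[OF sum_abs], simp add: abs_mult)
    also have "\<dots> \<le> (\<Sum>j = 0..<dim_col M. b * vnorm v)"
      using i v b \<open>0 \<le> b\<close> by (intro sum_mono mult_mono entry_le_vnorm) auto
    finally show ?thesis by simp
  qed
  then show "vnorm (M *\<^sub>v v) \<le> real (dim_row M) * (real (dim_col M) * b) * vnorm v"
    using vnorm_le_entries[of "M *\<^sub>v v" "real (dim_col M) * (b * vnorm v)"] by (simp add: mult_ac)
qed (use \<open>0 \<le> b\<close> in auto)

lemma op_bound_exists: "\<exists>c. op_bound M c"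
proof
  show "op_bound M (real (dim_row M) * (real (dim_col M) *
      (\<Sum>i<dim_row M. \<Sum>j<dim_col M. \<bar>M $$ (i, j)\<bar>)))"
  proof (rule op_bound_entries)
    fix i j assume "i < dim_row M" "j < dim_col M"
    then have "\<bar>M $$ (i, j)\<bar> \<le> (\<Sum>j<dim_col M. \<bar>M $$ (i, j)\<bar>)"
      by (intro member_le_sum[of j _ "\<lambda>j. \<bar>M $$ (i, j)\<bar>"]) auto
    also have "\<dots> \<le> (\<Sum>i<dim_row M. \<Sum>j<dim_col M. \<bar>M $$ (i, j)\<bar>)"
      using \<open>i < dim_row M\<close>
      by (intro member_le_sum[of i _ "\<lambda>i. \<Sum>j<dim_col M. \<bar>M $$ (i, j)\<bar>"]) (auto intro: sum_nonneg)
    finally show "\<bar>M $$ (i, j)\<bar> \<le> (\<Sum>i<dim_row M. \<Sum>j<dim_col M. \<bar>M $$ (i, j)\<bar>)" .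
  qed (auto intro: sum_nonneg)
qed

lemma op_bound_uniform_finite: "\<exists>c. \<forall>j<k. op_bound (M j) c" for k :: nat
proof -
  obtain c where c: "\<And>j. op_bound (M j) (c j)"
    using choice[of "\<lambda>j c. op_bound (M j) c"] op_bound_exists by blast
  have "op_bound (M j) (sum c {..<k})" if "j < k" for j
    by (rule op_bound_mono[OF c]) (use that c op_bound_nonneg in \<open>auto intro!: member_le_sum\<close>)
  then show ?thesis by blast
qed

section \<open>From operator bounds to \<open>mnorm\<close>\<close>

lemma mnorm_le:
  assumes M: "op_bound M c" shows "mnorm M \<le> c"
  unfolding mnorm_def
proof (rule cSup_least)
  have "vnorm (M *\<^sub>v 0\<^sub>v (dim_col M)) \<in> {vnorm (M *\<^sub>v v) | v. v \<in> carrier_vec (dim_col M) \<and> vnorm v \<le> 1}"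
    by (intro CollectI exI conjI) auto
  then show "{vnorm (M *\<^sub>v v) | v. v \<in> carrier_vec (dim_col M) \<and> vnorm v \<le> 1} \<noteq> {}" by blast
  fix x assume "x \<in> {vnorm (M *\<^sub>v v) | v. v \<in> carrier_vec (dim_col M) \<and> vnorm v \<le> 1}"
  then obtain v where v: "x = vnorm (M *\<^sub>v v)" "dim_vec v = dim_col M" "vnorm v \<le> 1" by auto
  have "x \<le> c * vnorm v" using v op_boundD[OF M] by simp
  also have "\<dots> \<le> c" using v(3) op_bound_nonneg[OF M] by (simp add: mult_left_le)
  finally show "x \<le> c" .
qed

lemma mnorm_nonneg: "0 \<le> mnorm M"
proof -
  obtain c where c: "op_bound M c" using op_bound_exists by blast
  let ?S = "{vnorm (M *\<^sub>v v) | v. v \<in> carrier_vec (dim_col M) \<and> vnorm v \<le> 1}"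
  have "vnorm (M *\<^sub>v 0\<^sub>v (dim_col M)) \<le> Sup ?S"
  proof (rule cSup_upper)
    show "vnorm (M *\<^sub>v 0\<^sub>v (dim_col M)) \<in> ?S" by (intro CollectI exI conjI) auto
    show "bdd_above ?S"
    proof (rule bdd_aboveI)
      fix x assume "x \<in> ?S"
      then obtain v where v: "x = vnorm (M *\<^sub>v v)" "dim_vec v = dim_col M" "vnorm v \<le> 1" by auto
      have "x \<le> c * vnorm v" using v op_boundD[OF c] by simp
      also have "\<dots> \<le> c" using v(3) op_bound_nonneg[OF c] by (simp add: mult_left_le)
      finally show "x \<le> c" .
    qed
  qed
  then show ?thesis using vnorm_nonneg order_trans unfolding mnorm_def by blast
qed

lemma mult_mat_assoc_dim: "dim_col A = dim_row B \<Longrightarrow> dim_col B = dim_row C \<Longrightarrow> A * B * C = A * (B * C)"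
  for A B C :: "real mat"
  by (rule assoc_mult_mat[of _ "dim_row A" "dim_row B" _ "dim_row C" _ "dim_col C"]) auto

section \<open>Positive semidefinite matrices\<close>

lemma psd_mat_dim: "psd_mat M \<Longrightarrow> dim_col M = dim_row M"
  by (simp add: psd_mat_def sym_mat_def)

lemma psd_mat_transpose: "psd_mat M \<Longrightarrow> M\<^sup>T = M"
  by (simp add: psd_mat_def sym_mat_def)

lemma psd_mat_nonneg: "psd_mat M \<Longrightarrow> dim_vec x = dim_row M \<Longrightarrow> 0 \<le> x \<bullet> (M *\<^sub>v x)"
  by (auto simp: psd_mat_def intro: carrier_vecI)

lemma psd_matI:
  assumes "dim_col M = dim_row M" "M\<^sup>T = M" "\<And>x. dim_vec x = dim_row M \<Longrightarrow> 0 \<le> x \<bullet> (M *\<^sub>v x)"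
  shows "psd_mat M"
  using assms by (auto simp: psd_mat_def sym_mat_def)

lemma pd_mat_pos:
  "pd_mat M \<Longrightarrow> dim_vec x = dim_row M \<Longrightarrow> x \<noteq> 0\<^sub>v (dim_row M) \<Longrightarrow> 0 < x \<bullet> (M *\<^sub>v x)"
  by (auto simp: pd_mat_def intro: carrier_vecI)

lemma pd_matI:
  assumes "dim_col M = dim_row M" "M\<^sup>T = M"
    "\<And>x. dim_vec x = dim_row M \<Longrightarrow> x \<noteq> 0\<^sub>v (dim_row M) \<Longrightarrow> 0 < x \<bullet> (M *\<^sub>v x)"
  shows "pd_mat M"
  using assms by (auto simp: pd_mat_def sym_mat_def)

lemma pd_imp_psd: assumes "pd_mat M" shows "psd_mat M"
proof (rule psd_matI)
  show d: "dim_col M = dim_row M" "M\<^sup>T = M" using assms by (simp_all add: pd_mat_def sym_mat_def)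
  fix x :: "real vec" assume "dim_vec x = dim_row M"
  then show "0 \<le> x \<bullet> (M *\<^sub>v x)"
    using pd_mat_pos[OF assms, of x] d by (cases "x = 0\<^sub>v (dim_row M)") (auto simp: mult_mat_zero_vec)
qed

lemma sym_form_commute:
  "M\<^sup>T = M \<Longrightarrow> dim_vec x = dim_row M \<Longrightarrow> dim_vec y = dim_row M \<Longrightarrow> x \<bullet> (M *\<^sub>v y) = y \<bullet> (M *\<^sub>v x)"
  for M :: "real mat"
  by (metis dim_mult_mat_vec index_transpose_mat(2) sprod_adjoint sprod_comm)

text \<open>The form at \<open>x + t y\<close> is a nonnegative quadratic in \<open>t\<close>, so
  its discriminant is not positive. As the form may be degenerate, a vanishing leading coefficient
  is a case of its own.\<close>

lemma psd_cauchy_schwarz: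
  assumes M: "psd_mat M" and x: "dim_vec x = dim_row M" and y: "dim_vec y = dim_row M"
  shows "(x \<bullet> (M *\<^sub>v y))\<^sup>2 \<le> (x \<bullet> (M *\<^sub>v x)) * (y \<bullet> (M *\<^sub>v y))"
proof -
  define a b c where "a = x \<bullet> (M *\<^sub>v x)" and "b = x \<bullet> (M *\<^sub>v y)" and "c = y \<bullet> (M *\<^sub>v y)"
  note dim = psd_mat_dim[OF M]
  have sym: "y \<bullet> (M *\<^sub>v x) = b"
    unfolding b_def using x y by (rule sym_form_commute[OF psd_mat_transpose[OF M], symmetric])
  have quad: "0 \<le> a + 2 * t * b + t\<^sup>2 * c" for t
  proof -
    have "0 \<le> (x + t \<cdot>\<^sub>v y) \<bullet> (M *\<^sub>v (x + t \<cdot>\<^sub>v y))"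
      using x y by (intro psd_mat_nonneg[OF M]) simp
    also have "\<dots> = a + 2 * t * b + t\<^sup>2 * c"
      using x y dim sym
      by (simp add: mat_vec_simps sprod_simps a_def b_def c_def power2_eq_square algebra_simps)
    finally show ?thesis .
  qed
  have "b\<^sup>2 \<le> a * c"
  proof (cases "c = 0")
    case True
    have "b = 0"
    proof (rule ccontr)
      assume "b \<noteq> 0"
      \<comment> \<open>For \<open>c = 0\<close> the quadratic is affine in \<open>t\<close>, and at
        this \<open>t\<close> it takes the value -1.\<close>
      then show False using quad[of "- (a + 1) / (2 * b)"] True by (simp add: field_simps)
    qed
    then show ?thesis using True by simp
  next
    case False
    then have c: "c > 0" using psd_mat_nonneg[OF M y] by (simp add: c_def)
    have "0 \<le> c * (a + 2 * (- b / c) * b + (- b / c)\<^sup>2 * c)"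
      using c quad[of "- b / c"] by (intro mult_nonneg_nonneg) simp_all
    also have "\<dots> = a * c - b\<^sup>2" using c by (simp add: field_simps power2_eq_square)
    finally show ?thesis by simp
  qed
  then show ?thesis by (simp add: a_def b_def c_def)
qed

text \<open>Definiteness excludes kernel vectors, so an inverse exists. Its uniqueness resolves the
  description in \<open>mat_inv\<close> and also yields symmetry, because the transposed inverse
  inverts \<open>M\<close> as well.\<close>

lemma mat_inv_pd:
  assumes M: "pd_mat M"
  shows "dim_row (mat_inv M) = dim_row M" "dim_col (mat_inv M) = dim_row M"
    "M * mat_inv M = 1\<^sub>m (dim_row M)" "mat_inv M * M = 1\<^sub>m (dim_row M)"
    "(mat_inv M)\<^sup>T = mat_inv M"
proof -
  let ?n = "dim_row M"
  have d: "dim_col M = ?n" and sym: "M\<^sup>T = M" using M by (simp_all add: pd_mat_def sym_mat_def)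
  have Mc: "M \<in> carrier_mat ?n ?n" using d by auto
  have "det M \<noteq> 0"
  proof
    assume "det M = 0"
    then obtain v where v: "v \<in> carrier_vec ?n" "v \<noteq> 0\<^sub>v ?n" "M *\<^sub>v v = 0\<^sub>v ?n"
      using det_0_iff_vec_prod_zero_field[OF Mc] by blast
    with pd_mat_pos[OF M, of v] show False by auto
  qed
  from det_non_zero_imp_unit[OF Mc this, of "()"]
  obtain N where N: "N \<in> carrier_mat ?n ?n" "M * N = 1\<^sub>m ?n" "N * M = 1\<^sub>m ?n"
    by (auto simp: Units_def ring_mat_def)
  have uniq: "N' = N" if "N' \<in> carrier_mat ?n ?n \<and> M * N' = 1\<^sub>m ?n \<and> N' * M = 1\<^sub>m ?n" for N'
  proof -
    have N': "N' \<in> carrier_mat ?n ?n" "N' * M = 1\<^sub>m ?n" using that by blast+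
    have "N' = N' * (M * N)" unfolding N(2) by (rule right_mult_one_mat[OF N'(1), symmetric])
    also have "\<dots> = (N' * M) * N" by (rule assoc_mult_mat[OF N'(1) Mc N(1), symmetric])
    also have "\<dots> = N" unfolding N'(2) by (rule left_mult_one_mat[OF N(1)])
    finally show ?thesis .
  qed
  have inv: "mat_inv M = N"
    unfolding mat_inv_def using N by (intro the_equality uniq) blast+
  show "dim_row (mat_inv M) = ?n" "dim_col (mat_inv M) = ?n"
    "M * mat_inv M = 1\<^sub>m ?n" "mat_inv M * M = 1\<^sub>m ?n"
    using N carrier_matD[OF N(1)] unfolding inv by simp_all
  have "N\<^sup>T * M = 1\<^sub>m ?n" "M * N\<^sup>T = 1\<^sub>m ?n"
    using arg_cong[OF N(2), of transpose_mat] arg_cong[OF N(3), of transpose_mat] N(1) d sym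
    by (simp_all add: transpose_mult_dim)
  then have "N\<^sup>T = N" using N(1) by (intro uniq) simp
  then show "(mat_inv M)\<^sup>T = mat_inv M" unfolding inv .
qed

text \<open>Neither eigenvalues nor compactness are used: Cauchy-Schwarz for the form of
  \<open>M\<close> at \<open>x\<close> and \<open>mat_inv M *\<^sub>v x\<close> bounds
  \<open>(x \<bullet> x)\<^sup>2\<close> by \<open>x \<bullet> (M *\<^sub>v x)\<close> times
  \<open>d * (x \<bullet> x)\<close>. The constant is \<open>1 / (d + 1)\<close> because
  \<open>d\<close> may be 0.\<close>

lemma pd_lower_bound:
  assumes M: "pd_mat M"
  obtains r where "r > 0" "\<And>x. dim_vec x = dim_row M \<Longrightarrow> r * (x \<bullet> x) \<le> x \<bullet> (M *\<^sub>v x)"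
proof -
  note P = pd_imp_psd[OF M] and inv = mat_inv_pd[OF M]
  let ?N = "mat_inv M"
  obtain d where d: "op_bound ?N d" using op_bound_exists by blast
  have d0: "0 \<le> d" using op_bound_nonneg[OF d] .
  have "1 / (d + 1) * (x \<bullet> x) \<le> x \<bullet> (M *\<^sub>v x)" if x: "dim_vec x = dim_row M" for x
  proof (cases "x \<bullet> x = 0")
    case True
    then show ?thesis using psd_mat_nonneg[OF P x] by simp
  next
    case False
    then have pos: "x \<bullet> x > 0" using sprod_self_nonneg[of x] by simp
    have MN: "M *\<^sub>v (?N *\<^sub>v x) = x"
      using x inv psd_mat_dim[OF P] by (simp flip: mult_mat_vec_assoc_dim add: one_mult_mat_vec_dim)
    have "(x \<bullet> x)\<^sup>2 \<le> (x \<bullet> (M *\<^sub>v x)) * ((?N *\<^sub>v x) \<bullet> x)"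
      using psd_cauchy_schwarz[OF P x, of "?N *\<^sub>v x"] MN inv by simp
    also have "\<dots> \<le> (x \<bullet> (M *\<^sub>v x)) * (d * (x \<bullet> x))"
    proof (rule mult_left_mono[OF _ psd_mat_nonneg[OF P x]])
      have "(?N *\<^sub>v x) \<bullet> x \<le> vnorm (?N *\<^sub>v x) * vnorm x"
        using vnorm_cauchy_schwarz[of "?N *\<^sub>v x" x] x inv by simp
      also have "\<dots> \<le> (d * vnorm x) * vnorm x"
        using x inv by (intro mult_right_mono op_boundD[OF d]) auto
      finally show "(?N *\<^sub>v x) \<bullet> x \<le> d * (x \<bullet> x)"
        by (simp add: mult.assoc flip: power2_eq_square vnorm_power2)
    qed
    finally have "(x \<bullet> x) * (x \<bullet> x) \<le> (d * (x \<bullet> (M *\<^sub>v x))) * (x \<bullet> x)"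
      by (simp add: power2_eq_square mult_ac)
    then have "x \<bullet> x \<le> d * (x \<bullet> (M *\<^sub>v x))" using pos by simp
    also have "\<dots> \<le> (d + 1) * (x \<bullet> (M *\<^sub>v x))"
      using psd_mat_nonneg[OF P x] by (intro mult_right_mono) auto
    finally show ?thesis using d0 by (simp add: field_simps)
  qed
  then show ?thesis using d0 by (intro that[of "1 / (d + 1)"]) auto
qed

lemma psd_congruence:
  assumes X: "psd_mat X" and d: "dim_col C = dim_row X"
  shows "psd_mat (C * X * C\<^sup>T)"
proof (rule psd_matI)
  show "(C * X * C\<^sup>T)\<^sup>T = C * X * C\<^sup>T"
    using d psd_mat_dim[OF X] psd_mat_transpose[OF X]
    by (simp add: transpose_mult_dim mult_mat_assoc_dim)
  fix x :: "real vec" assume "dim_vec x = dim_row (C * X * C\<^sup>T)"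
  then have x: "dim_vec x = dim_row C" by simp
  have "x \<bullet> ((C * X * C\<^sup>T) *\<^sub>v x) = (C\<^sup>T *\<^sub>v x) \<bullet> (X *\<^sub>v (C\<^sup>T *\<^sub>v x))"
    using x d psd_mat_dim[OF X] by (simp add: mat_vec_simps sprod_adjoint[of x C])
  then show "0 \<le> x \<bullet> ((C * X * C\<^sup>T) *\<^sub>v x)"
    using psd_mat_nonneg[OF X, of "C\<^sup>T *\<^sub>v x"] d by simp
qed simp

lemma psd_add:
  assumes "psd_mat X" "psd_mat Y" "dim_row X = dim_row Y"
  shows "psd_mat (X + Y)"
  using assms psd_mat_dim[OF assms(1)] psd_mat_dim[OF assms(2)]
    psd_mat_transpose[OF assms(1)] psd_mat_transpose[OF assms(2)]
  by (intro psd_matI) (auto simp: transpose_add_dim mat_vec_simps sprod_simps intro!: add_nonneg_nonneg psd_mat_nonneg)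

lemma psd_add_pd:
  assumes "psd_mat X" "pd_mat Y" "dim_row X = dim_row Y"
  shows "pd_mat (X + Y)"
  using assms psd_mat_dim[OF assms(1)] psd_mat_dim[OF pd_imp_psd[OF assms(2)]]
    psd_mat_transpose[OF assms(1)] psd_mat_transpose[OF pd_imp_psd[OF assms(2)]]
  by (intro pd_matI) (auto simp: transpose_add_dim mat_vec_simps sprod_simps
      intro!: add_nonneg_pos psd_mat_nonneg pd_mat_pos)

lemma sprod_zero_vec: "dim_vec x = n \<Longrightarrow> x \<bullet> 0\<^sub>v n = 0" "dim_vec x = n \<Longrightarrow> 0\<^sub>v n \<bullet> x = 0"
  for x :: "real vec"
  by (simp_all add: scalar_prod_def)

lemma unit_vec_form:
  fixes M :: "real mat"
  assumes "dim_row M = n" "dim_col M = k" "i < n" "j < k"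
  shows "unit_vec n i \<bullet> (M *\<^sub>v unit_vec k j) = M $$ (i, j)"
proof -
  have "unit_vec n i \<bullet> (M *\<^sub>v unit_vec k j) = (M *\<^sub>v unit_vec k j) $ i"
    by (rule scalar_prod_left_unit[OF _ assms(3)]) (rule carrier_vecI, simp add: assms)
  also have "\<dots> = M $$ (i, j)" using assms by simp
  finally show ?thesis .
qed

section \<open>The positive semidefinite square root\<close>

text \<open>The diagonal is nonnegative with sum 0, hence zero; Cauchy-Schwarz against unit vectors
  then annihilates every entry of \<open>M *\<^sub>v v\<close>.\<close>

lemma psd_trace_zero:
  assumes M: "psd_mat M" and tr: "(\<Sum>i<dim_row M. M $$ (i, i)) = 0"
  shows "M = 0\<^sub>m (dim_row M) (dim_row M)"
proof (rule mat_eqI_vec)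
  let ?n = "dim_row M"
  note dim = psd_mat_dim[OF M]
  have diag: "unit_vec ?n i \<bullet> (M *\<^sub>v unit_vec ?n i) = M $$ (i, i)" if "i < ?n" for i
    using that dim by (intro unit_vec_form) simp_all
  have ge: "0 \<le> M $$ (i, i)" if "i < ?n" for i
    using psd_mat_nonneg[OF M, of "unit_vec ?n i"] diag[OF that] by simp
  have z: "M $$ (i, i) = 0" if "i < ?n" for i
    using tr that ge by (subst (asm) sum_nonneg_eq_0_iff) auto
  fix v :: "real vec" assume "dim_vec v = dim_col (0\<^sub>m ?n ?n :: real mat)"
  then have v: "dim_vec v = ?n" by simp
  show "M *\<^sub>v v = 0\<^sub>m ?n ?n *\<^sub>v v"
  proof (rule eq_vecI)
    fix i assume "i < dim_vec (0\<^sub>m ?n ?n *\<^sub>v v)"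
    then have i: "i < ?n" by simp
    have "(unit_vec ?n i \<bullet> (M *\<^sub>v v))\<^sup>2 \<le> (unit_vec ?n i \<bullet> (M *\<^sub>v unit_vec ?n i)) * (v \<bullet> (M *\<^sub>v v))"
      by (rule psd_cauchy_schwarz[OF M]) (simp_all add: v)
    then have "unit_vec ?n i \<bullet> (M *\<^sub>v v) = 0" unfolding diag[OF i] z[OF i] by simp
    moreover have "unit_vec ?n i \<bullet> (M *\<^sub>v v) = (M *\<^sub>v v) $ i"
      by (rule scalar_prod_left_unit[OF _ i]) (rule carrier_vecI, simp)
    ultimately show "(M *\<^sub>v v) $ i = (0\<^sub>m ?n ?n *\<^sub>v v) $ i" using i v by (simp add: zero_mat_mult_vec_dim)
  qed simp
qed (use psd_mat_dim[OF M] in simp_all)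

lemma trace_mult_commute:
  fixes A B :: "real mat"
  assumes "dim_row A = n" "dim_col A = n" "dim_row B = n" "dim_col B = n"
  shows "(\<Sum>i<n. (A * B) $$ (i, i)) = (\<Sum>i<n. (B * A) $$ (i, i))"
proof -
  have "(\<Sum>i<n. (A * B) $$ (i, i)) = (\<Sum>i<n. \<Sum>j<n. A $$ (i, j) * B $$ (j, i))"
    using assms by (simp add: scalar_prod_def atLeast0LessThan)
  also have "\<dots> = (\<Sum>j<n. \<Sum>i<n. A $$ (i, j) * B $$ (j, i))" by (rule sum.swap)
  also have "\<dots> = (\<Sum>i<n. (B * A) $$ (i, i))"
    using assms by (simp add: scalar_prod_def atLeast0LessThan mult.commute)
  finally show ?thesis .
qed

text \<open>With \<open>D = S - T\<close> the equation \<open>S\<^sup>2 = T\<^sup>2\<close> reads \<open>S D + D T = 0\<close>; multiplying by \<open>D\<close> and taking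
  traces shows that the positive semidefinite matrices \<open>D S D\<close> and \<open>D T D\<close> vanish, so \<open>D\<^sup>3 = 0\<close>.\<close>

lemma psd_sqrt_unique:
  assumes S: "psd_mat S" and T: "psd_mat T" and dim: "dim_row S = dim_row T" and eq: "S * S = T * T"
  shows "S = T"
proof -
  define n where "n = dim_row T"
  define D where "D = S - T"
  have dims [simp]: "dim_row S = n" "dim_col S = n" "dim_row T = n" "dim_col T = n"
    "dim_row D = n" "dim_col D = n"
    using dim psd_mat_dim[OF S] psd_mat_dim[OF T] by (simp_all add: n_def D_def)
  have symD: "D\<^sup>T = D"
    by (simp add: D_def transpose_minus_dim psd_mat_transpose[OF S] psd_mat_transpose[OF T])
  have SSTT: "S *\<^sub>v (S *\<^sub>v v) = T *\<^sub>v (T *\<^sub>v v)" if "dim_vec v = n" for v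
    using arg_cong[OF eq, of "\<lambda>M. M *\<^sub>v v"] that by (simp add: mat_vec_simps)
  have SD: "S *\<^sub>v (D *\<^sub>v v) = - (D *\<^sub>v (T *\<^sub>v v))" if "dim_vec v = n" for v
    unfolding D_def using that SSTT[OF that] by (intro eq_vecI) (simp_all add: mat_vec_simps)
  have psd: "psd_mat (D * S * D)" "psd_mat (D * T * D)"
    using psd_congruence[OF S, of D] psd_congruence[OF T, of D] symD by simp_all
  have DSD: "D * S * D = - (D * (D * T))"
  proof (rule mat_eqI_vec)
    fix v :: "real vec" assume "dim_vec v = dim_col (- (D * (D * T)))"
    then have v: "dim_vec v = n" by simp
    have "(D * S * D) *\<^sub>v v = D *\<^sub>v (- (D *\<^sub>v (T *\<^sub>v v)))" using v by (simp add: mat_vec_simps SD)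
    also have "\<dots> = (-1) \<cdot>\<^sub>v (D *\<^sub>v (D *\<^sub>v (T *\<^sub>v v)))"
      using v mult_mat_vec_smult_dim[of "D *\<^sub>v (T *\<^sub>v v)" D "-1"]
      by (simp add: uminus_vec_def smult_vec_def)
    also have "\<dots> = - (D * (D * T)) *\<^sub>v v"
      using v by (subst uminus_mult_mat_vec) (simp_all add: mat_vec_simps uminus_vec_def smult_vec_def)
    finally show "(D * S * D) *\<^sub>v v = - (D * (D * T)) *\<^sub>v v" .
  qed simp_all
  \<comment> \<open>By cyclicity \<open>D * (D * T)\<close> has the trace of
    \<open>D * T * D\<close>, so two nonnegative traces are negatives of each other.\<close>
  have "(\<Sum>i<n. (D * S * D) $$ (i, i)) = - (\<Sum>i<n. (D * T * D) $$ (i, i))"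
    unfolding DSD using trace_mult_commute[of D n "D * T"] by (simp add: sum_negf)
  moreover have tr: "0 \<le> (\<Sum>i<n. M $$ (i, i))" if "psd_mat M" "dim_row M = n" for M
  proof (rule sum_nonneg)
    fix i assume "i \<in> {..<n}"
    then show "0 \<le> M $$ (i, i)"
      using psd_mat_nonneg[OF that(1), of "unit_vec n i"] psd_mat_dim[OF that(1)] that(2)
        unit_vec_form[of M n n i i] by simp
  qed
  ultimately have "(\<Sum>i<n. (D * S * D) $$ (i, i)) = 0" "(\<Sum>i<n. (D * T * D) $$ (i, i)) = 0"
    using tr[OF psd(1)] tr[OF psd(2)] by simp_all
  then have zero: "D * S * D = 0\<^sub>m n n" "D * T * D = 0\<^sub>m n n"
    using psd_trace_zero[OF psd(1)] psd_trace_zero[OF psd(2)] by simp_all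
  have "D *\<^sub>v v = 0\<^sub>v n" if v: "dim_vec v = n" for v
  proof -
    have "D *\<^sub>v (S *\<^sub>v (D *\<^sub>v v)) = 0\<^sub>v n" "D *\<^sub>v (T *\<^sub>v (D *\<^sub>v v)) = 0\<^sub>v n"
      using arg_cong[OF zero(1), of "\<lambda>M. M *\<^sub>v v"] arg_cong[OF zero(2), of "\<lambda>M. M *\<^sub>v v"] v
      by (simp_all add: mat_vec_simps)
    moreover have "D *\<^sub>v (D *\<^sub>v (D *\<^sub>v v)) = D *\<^sub>v (S *\<^sub>v (D *\<^sub>v v)) - D *\<^sub>v (T *\<^sub>v (D *\<^sub>v v))"
      by (subst (2) D_def) (simp add: mat_vec_simps)
    ultimately have D3: "D *\<^sub>v (D *\<^sub>v (D *\<^sub>v v)) = 0\<^sub>v n" by simp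
    \<comment> \<open>Symmetry of \<open>D\<close> turns the squared norm of
      \<open>D *\<^sub>v w\<close> into a product with \<open>D\<close> applied twice. Used twice,
      this lowers the vanishing third power to \<open>D\<close> itself.\<close>
    have step: "D *\<^sub>v w = 0\<^sub>v n" if "D *\<^sub>v (D *\<^sub>v w) = 0\<^sub>v n" "dim_vec w = n" for w
    proof -
      have "(D *\<^sub>v w) \<bullet> (D *\<^sub>v w) = w \<bullet> (D *\<^sub>v (D *\<^sub>v w))"
        using that(2) symD by (simp add: sprod_adjoint)
      then have "(D *\<^sub>v w) \<bullet> (D *\<^sub>v w) = 0" using that by (simp add: sprod_zero_vec)
      then show ?thesis using vec_eq_zero_if_sprod_self[of "D *\<^sub>v w"] by simp
    qed
    show ?thesis using step[of v] step[of "D *\<^sub>v v"] D3 v by simp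
  qed
  note Dv = this
  show "S = T"
  proof (rule mat_eqI_vec)
    fix v :: "real vec" assume "dim_vec v = dim_col T"
    then have "dim_vec v = n" by simp
    from Dv[OF this] have "S *\<^sub>v v - T *\<^sub>v v = 0\<^sub>v n" using \<open>dim_vec v = n\<close> by (simp add: D_def mat_vec_simps)
    then have *: "(S *\<^sub>v v - T *\<^sub>v v) $ i = 0" if "i < n" for i using that by simp
    show "S *\<^sub>v v = T *\<^sub>v v"
    proof (rule eq_vecI)
      fix i assume "i < dim_vec (T *\<^sub>v v)"
      then show "(S *\<^sub>v v) $ i = (T *\<^sub>v v) $ i" using *[of i] by simp
    qed simp
  qed simp_all
qed

section \<open>Powers and nonnegative polynomials of a positive semidefinite matrix\<close>

lemma pow_mat_add:
  fixes A :: "real mat"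
  assumes A: "dim_row A = n" "dim_col A = n"
  shows "A ^\<^sub>m (i + j) = A ^\<^sub>m i * A ^\<^sub>m j"
proof (induction j)
  case 0
  have "A ^\<^sub>m i \<in> carrier_mat n n" using A by auto
  then show ?case using A by simp
next
  case (Suc j)
  then show ?case using A by (simp add: mult_mat_assoc_dim)
qed

lemma transpose_smult_sym: "M\<^sup>T = M \<Longrightarrow> (c \<cdot>\<^sub>m M)\<^sup>T = c \<cdot>\<^sub>m M"
  for M :: "real mat"
proof -
  assume M: "M\<^sup>T = M"
  have "(c \<cdot>\<^sub>m M)\<^sup>T = c \<cdot>\<^sub>m M\<^sup>T" by (intro eq_matI) simp_all
  then show ?thesis unfolding M .
qed

text \<open>Splitting off one factor on each side exhibits \<open>E ^\<^sub>m j\<close> as a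
  congruence of \<open>E ^\<^sub>m (j - 2)\<close>, so the induction descends by two and needs the
  base cases 0 and 1.\<close>

lemma psd_pow_mat:
  assumes E: "psd_mat E" shows "psd_mat (E ^\<^sub>m j)"
proof -
  define n where "n = dim_row E"
  have dim [simp]: "dim_row E = n" "dim_col E = n" using psd_mat_dim[OF E] by (simp_all add: n_def)
  have E1: "E ^\<^sub>m 1 = E" by (simp add: left_mult_one_mat[of _ n n] carrier_matI)
  show ?thesis
  proof (induction j rule: less_induct)
    case (less j)
    consider "j = 0" | "j = 1" | "j = 1 + (j - 2) + 1" by linarith
    then show ?case
    proof cases
      case 1
      then show ?thesis by (intro psd_matI) (simp_all add: one_mult_mat_vec_dim sprod_self_nonneg)
    next
      case 2
      then show ?thesis using E E1 by simp
    next
      case 3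
      have "E ^\<^sub>m j = E * E ^\<^sub>m (j - 2) * E"
        using pow_mat_add[of E n "1 + (j - 2)" 1] pow_mat_add[of E n 1 "j - 2"] dim E1 3 by metis
      then show ?thesis
        using psd_congruence[OF less[of "j - 2"], of E] psd_mat_transpose[OF E] 3 by simp
    qed
  qed
qed

text \<open>Products of positive semidefinite matrices are in general not even symmetric.
  Polynomials with nonnegative coefficients in one \<open>E\<close> are closed under products and
  stay positive semidefinite, which is all the functional calculus that the square root
  needs.\<close>

inductive_set pos_poly :: "nat \<Rightarrow> real mat \<Rightarrow> real mat set" for n E where
  zero: "0\<^sub>m n n \<in> pos_poly n E"
| power: "E ^\<^sub>m j \<in> pos_poly n E"
| add: "M \<in> pos_poly n E \<Longrightarrow> N \<in> pos_poly n E \<Longrightarrow> M + N \<in> pos_poly n E"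
| smult: "0 \<le> c \<Longrightarrow> M \<in> pos_poly n E \<Longrightarrow> c \<cdot>\<^sub>m M \<in> pos_poly n E"

lemma pos_poly_carrier:
  assumes "E \<in> carrier_mat n n" shows "M \<in> pos_poly n E \<Longrightarrow> M \<in> carrier_mat n n"
  by (induction rule: pos_poly.induct) (use assms in auto)

lemma pos_poly_psd:
  assumes E: "psd_mat E" and n: "dim_row E = n"
  shows "M \<in> pos_poly n E \<Longrightarrow> psd_mat M"
proof (induction rule: pos_poly.induct)
  case zero
  show ?case by (intro psd_matI) (simp_all add: zero_mat_mult_vec_dim sprod_zero_vec)
next
  case (power j)
  show ?case by (rule psd_pow_mat[OF E])
next
  case (add M N)
  have "E \<in> carrier_mat n n" using n psd_mat_dim[OF E] by (intro carrier_matI) simp_all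
  from pos_poly_carrier[OF this add(1)] pos_poly_carrier[OF this add(2)] add
  show ?case by (intro psd_add) auto
next
  case (smult c M)
  show ?case
  proof (rule psd_matI)
    show "(c \<cdot>\<^sub>m M)\<^sup>T = c \<cdot>\<^sub>m M" by (rule transpose_smult_sym[OF psd_mat_transpose[OF smult(3)]])
  next
    fix x :: "real vec" assume "dim_vec x = dim_row (c \<cdot>\<^sub>m M)"
    then show "0 \<le> x \<bullet> ((c \<cdot>\<^sub>m M) *\<^sub>v x)"
      using smult psd_mat_nonneg[OF smult(3), of x] psd_mat_dim[OF smult(3)]
      by (simp add: mat_vec_simps)
  qed (use psd_mat_dim[OF smult(3)] in simp)
qed

lemma pos_poly_mult:
  assumes E: "E \<in> carrier_mat n n" and N: "N \<in> pos_poly n E"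
  shows "M \<in> pos_poly n E \<Longrightarrow> M * N \<in> pos_poly n E"
proof (induction rule: pos_poly.induct)
  case zero
  show ?case using pos_poly_carrier[OF E N] pos_poly.zero by simp
next
  case (power j)
  show ?case using N
  proof (induction rule: pos_poly.induct)
    case zero
    have "E ^\<^sub>m j * 0\<^sub>m n n = 0\<^sub>m n n" using E by (intro right_mult_zero_mat) simp
    then show ?case using pos_poly.zero by simp
  next
    case (power k)
    show ?case using pow_mat_add[of E n j k] E pos_poly.power[of E "j + k" n] by auto
  next
    case (add M N)
    have "E ^\<^sub>m j * (M + N) = E ^\<^sub>m j * M + E ^\<^sub>m j * N"
      by (rule mult_add_distrib_mat[OF pow_carrier_mat[OF E] pos_poly_carrier[OF E add(1)] pos_poly_carrier[OF E add(2)]])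
    then show ?case using add pos_poly.add by metis
  next
    case (smult c M)
    have "E ^\<^sub>m j * (c \<cdot>\<^sub>m M) = c \<cdot>\<^sub>m (E ^\<^sub>m j * M)"
      by (rule mult_smult_distrib[OF pow_carrier_mat[OF E] pos_poly_carrier[OF E smult(2)]])
    then show ?case using smult pos_poly.smult by metis
  qed
next
  case (add M M')
  have "(M + M') * N = M * N + M' * N"
    by (rule add_mult_distrib_mat[OF pos_poly_carrier[OF E add(1)] pos_poly_carrier[OF E add(2)] pos_poly_carrier[OF E N]])
  then show ?case using add pos_poly.add by metis
next
  case (smult c M)
  have "(c \<cdot>\<^sub>m M) * N = c \<cdot>\<^sub>m (M * N)"
    by (rule mult_smult_assoc_mat[OF pos_poly_carrier[OF E smult(2)] pos_poly_carrier[OF E N]])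
  then show ?case using smult pos_poly.smult by metis
qed

text \<open>Cauchy-Schwarz for the form of \<open>Y\<close> at \<open>x\<close> and
  \<open>y = Y *\<^sub>v x\<close> bounds \<open>(y \<bullet> y)\<^sup>2\<close>; the hypothesis
  bounds the second factor by \<open>y \<bullet> y\<close>, which then cancels.\<close>

lemma psd_contraction_power2_le:
  assumes Y: "psd_mat Y" and x: "dim_vec x = dim_row Y"
    and le: "\<And>x. dim_vec x = dim_row Y \<Longrightarrow> x \<bullet> (Y *\<^sub>v x) \<le> x \<bullet> x"
  shows "(Y *\<^sub>v x) \<bullet> (Y *\<^sub>v x) \<le> x \<bullet> (Y *\<^sub>v x)"
proof -
  let ?y = "Y *\<^sub>v x"
  have "(?y \<bullet> ?y)\<^sup>2 = (x \<bullet> (Y *\<^sub>v ?y))\<^sup>2"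
    using x psd_mat_dim[OF Y] psd_mat_transpose[OF Y] by (simp add: sprod_adjoint)
  also have "\<dots> \<le> (x \<bullet> ?y) * (?y \<bullet> (Y *\<^sub>v ?y))" by (rule psd_cauchy_schwarz[OF Y x]) simp
  also have "\<dots> \<le> (x \<bullet> ?y) * (?y \<bullet> ?y)"
    by (intro mult_left_mono le psd_mat_nonneg[OF Y x]) simp
  finally have "(?y \<bullet> ?y) * (?y \<bullet> ?y) \<le> (x \<bullet> ?y) * (?y \<bullet> ?y)" by (simp add: power2_eq_square)
  then show ?thesis
    using sprod_self_nonneg[of ?y] psd_mat_nonneg[OF Y x] by (cases "?y \<bullet> ?y = 0") auto
qed

fun sqrt_iter :: "nat \<Rightarrow> real mat \<Rightarrow> nat \<Rightarrow> real mat" where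
  "sqrt_iter n E 0 = 0\<^sub>m n n"
| "sqrt_iter n E (Suc k) = (1/2) \<cdot>\<^sub>m (E + sqrt_iter n E k * sqrt_iter n E k)"

text \<open>For \<open>0 \<le> E \<le> 1\<close> the iterates increase to the solution \<open>Y\<close> of \<open>2 Y = E + Y\<^sup>2\<close>, and then
  \<open>(1 - Y)\<^sup>2 = 1 - E\<close>. All increments are nonnegative polynomials in \<open>E\<close>, which gives monotonicity.\<close>

lemma sqrt_one_minus_exists:
  assumes E: "psd_mat E" and n: "dim_row E = n"
    and le1: "\<And>x. dim_vec x = n \<Longrightarrow> x \<bullet> (E *\<^sub>v x) \<le> x \<bullet> x"
  shows "\<exists>S. psd_mat S \<and> dim_row S = n \<and> S * S = 1\<^sub>m n - E"
proof -
  let ?Y = "sqrt_iter n E"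
  have Ec: "E \<in> carrier_mat n n" using n psd_mat_dim[OF E] by (intro carrier_matI) simp_all
  have poly: "?Y k \<in> pos_poly n E" for k
  proof (induction k)
    case (Suc k)
    have "E ^\<^sub>m 1 \<in> pos_poly n E" by (rule pos_poly.power)
    moreover have "E ^\<^sub>m 1 = E" using Ec by simp
    ultimately have "E \<in> pos_poly n E" by simp
    then show ?case using pos_poly_mult[OF Ec Suc Suc] by (auto intro!: pos_poly.smult pos_poly.add)
  qed (simp add: pos_poly.zero)
  have Yc [simp]: "?Y k \<in> carrier_mat n n" for k using pos_poly_carrier[OF Ec poly] .
  have Yd [simp]: "dim_row (?Y k) = n" "dim_col (?Y k) = n" for k using carrier_matD[OF Yc] by blast+
  have Ypsd: "psd_mat (?Y k)" for k using pos_poly_psd[OF E n poly] .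
  have incr: "\<exists>D\<in>pos_poly n E. ?Y (Suc k) = ?Y k + D" for k
  proof (induction k)
    case 0
    show ?case using poly[of 1] by (intro bexI[of _ "?Y 1"]) (use Ec in auto)
  next
    case (Suc k)
    then obtain D where D: "D \<in> pos_poly n E" "?Y (Suc k) = ?Y k + D" by blast
    have Dc: "D \<in> carrier_mat n n" using pos_poly_carrier[OF Ec D(1)] .
    \<comment> \<open>By the recursion the next increment is half the growth of the square, again a
      nonnegative polynomial because \<open>?Y k\<close> and \<open>D\<close> are.\<close>
    let ?D = "(1/2) \<cdot>\<^sub>m (?Y k * D + (D * ?Y k + D * D))"
    have sq: "(?Y k + D) * (?Y k + D) = ?Y k * ?Y k + (?Y k * D + (D * ?Y k + D * D))"
    proof -
      have "(?Y k + D) * (?Y k + D) = ?Y k * (?Y k + D) + D * (?Y k + D)"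
        using Dc by (intro add_mult_distrib_mat) auto
      also have "?Y k * (?Y k + D) = ?Y k * ?Y k + ?Y k * D" using Dc by (intro mult_add_distrib_mat) auto
      also have "D * (?Y k + D) = D * ?Y k + D * D" using Dc by (intro mult_add_distrib_mat) auto
      finally show ?thesis using Dc by (intro eq_matI) simp_all
    qed
    have "?Y (Suc (Suc k)) = (1/2) \<cdot>\<^sub>m (E + (?Y k + D) * (?Y k + D))"
      using D(2) by (metis sqrt_iter.simps(2))
    also have "\<dots> = ?Y (Suc k) + ?D"
      unfolding sq using Dc Ec by (intro eq_matI) (simp_all add: algebra_simps add_divide_distrib)
    finally show ?case
      using pos_poly_mult[OF Ec D(1) poly] pos_poly_mult[OF Ec D(1) D(1)] pos_poly_mult[OF Ec poly D(1)]
      by (metis pos_poly.add pos_poly.smult D(1) poly pos_poly_mult[OF Ec] zero_le_divide_1_iff zero_le_numeral)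
  qed
  have mono: "x \<bullet> (?Y k *\<^sub>v x) \<le> x \<bullet> (?Y (Suc k) *\<^sub>v x)" if x: "dim_vec x = n" for x k
  proof -
    obtain D where D: "D \<in> pos_poly n E" "?Y (Suc k) = ?Y k + D" using incr by blast
    have Dd: "dim_row D = n" "dim_col D = n" using pos_poly_carrier[OF Ec D(1)] by auto
    then show ?thesis
      unfolding D(2) using x psd_mat_nonneg[OF pos_poly_psd[OF E n D(1)], of x]
      by (simp add: mat_vec_simps sprod_simps)
  qed
  \<comment> \<open>An iterate averages \<open>E\<close> and the square of its predecessor. Both lie
    below the identity, the square because a positive semidefinite contraction dominates its own
    square.\<close>
  have Yle: "x \<bullet> (?Y k *\<^sub>v x) \<le> x \<bullet> x" if "dim_vec x = n" for x k
    using that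
  proof (induction k arbitrary: x)
    case 0
    then show ?case by (simp add: zero_mat_mult_vec_dim sprod_zero_vec sprod_self_nonneg)
  next
    case (Suc k)
    have "x \<bullet> (?Y (Suc k) *\<^sub>v x) = (x \<bullet> (E *\<^sub>v x) + x \<bullet> (?Y k *\<^sub>v (?Y k *\<^sub>v x))) / 2"
      using Suc.prems Ec by (simp add: mat_vec_simps sprod_simps)
    also have "x \<bullet> (?Y k *\<^sub>v (?Y k *\<^sub>v x)) = (?Y k *\<^sub>v x) \<bullet> (?Y k *\<^sub>v x)"
      using Suc.prems psd_mat_transpose[OF Ypsd] by (simp add: sprod_adjoint)
    also have "\<dots> \<le> x \<bullet> (?Y k *\<^sub>v x)"
      by (rule psd_contraction_power2_le[OF Ypsd]) (use Suc in simp_all)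
    also have "\<dots> \<le> x \<bullet> x" using Suc by simp
    finally show ?case using le1[OF Suc.prems] by simp
  qed
  have conv_form: "convergent (\<lambda>k. x \<bullet> (?Y k *\<^sub>v x))" if x: "dim_vec x = n" for x
  proof (rule Bseq_monoseq_convergent)
    have "\<bar>x \<bullet> (?Y k *\<^sub>v x)\<bar> \<le> x \<bullet> x" for k
      using Yle[OF x] psd_mat_nonneg[OF Ypsd, of x] x by (simp add: abs_of_nonneg)
    then show "Bseq (\<lambda>k. x \<bullet> (?Y k *\<^sub>v x))" by (intro BseqI') auto
    show "monoseq (\<lambda>k. x \<bullet> (?Y k *\<^sub>v x))" using mono[OF x] by (intro mono_SucI1) blast
  qed
  have "convergent (\<lambda>k. ?Y k $$ (i, j))" if ij: "i < n" "j < n" for i j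
  proof -
    let ?e = "unit_vec n :: nat \<Rightarrow> real vec"
    have entry: "?e i \<bullet> (?Y k *\<^sub>v ?e j) = ?Y k $$ (i, j)" if "i < n" "j < n" for k i j
      using that by (intro unit_vec_form) simp_all
    have sym: "?Y k $$ (j, i) = ?Y k $$ (i, j)" for k
      using psd_mat_transpose[OF Ypsd[of k]] ij Yd by (metis index_transpose_mat(1))
    \<comment> \<open>Polarization: monotone convergence is available only for quadratic forms, and
      it passes to entries through the symmetry of the iterates.\<close>
    have "?Y k $$ (i, j) = ((?e i + ?e j) \<bullet> (?Y k *\<^sub>v (?e i + ?e j)) - ?e i \<bullet> (?Y k *\<^sub>v ?e i)
        - ?e j \<bullet> (?Y k *\<^sub>v ?e j)) / 2" for k
      using ij sym[of k] by (simp add: mult_mat_vec_add_dim sprod_simps entry)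
    moreover have "convergent (\<lambda>k. ((?e i + ?e j) \<bullet> (?Y k *\<^sub>v (?e i + ?e j)) - ?e i \<bullet> (?Y k *\<^sub>v ?e i)
        - ?e j \<bullet> (?Y k *\<^sub>v ?e j)) / 2)"
      unfolding divide_inverse using conv_form
      by (intro convergent_mult convergent_diff convergent_const) auto
    ultimately show ?thesis by presburger
  qed
  then obtain L where L: "\<And>i j. i < n \<Longrightarrow> j < n \<Longrightarrow> (\<lambda>k. ?Y k $$ (i, j)) \<longlonglongrightarrow> L i j"
    unfolding convergent_def by metis
  define Z where "Z k = 1\<^sub>m n - ?Y k" for k
  define S where "S = mat n n (\<lambda>(i, j). 1\<^sub>m n $$ (i, j) - L i j)"
  have Zd [simp]: "dim_row (Z k) = n" "dim_col (Z k) = n" for k by (simp_all add: Z_def)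
  have Sd [simp]: "dim_row S = n" "dim_col S = n" by (simp_all add: S_def)
  have ZS: "(\<lambda>k. Z k $$ (i, j)) \<longlonglongrightarrow> S $$ (i, j)" if "i < n" "j < n" for i j
    using that L[OF that] by (auto simp: Z_def S_def intro!: tendsto_intros)
  have "S * S = 1\<^sub>m n - E"
  proof (rule eq_matI)
    fix i j assume "i < dim_row (1\<^sub>m n - E)" "j < dim_col (1\<^sub>m n - E)"
    then have ij: "i < n" "j < n" using Ec by auto
    have prod: "(A * B) $$ (i, j) = (\<Sum>l = 0..<n. A $$ (i, l) * B $$ (l, j))"
      if "dim_row A = n" "dim_col A = n" "dim_row B = n" "dim_col B = n" for A B :: "real mat"
      using that ij by (simp add: scalar_prod_def)
    have "(\<lambda>k. \<Sum>l = 0..<n. Z k $$ (i, l) * Z k $$ (l, j)) \<longlonglongrightarrow> (\<Sum>l = 0..<n. S $$ (i, l) * S $$ (l, j))"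
      using ij by (intro tendsto_sum tendsto_mult ZS) simp_all
    moreover have "(Z k * Z k) $$ (i, j) = (\<Sum>l = 0..<n. Z k $$ (i, l) * Z k $$ (l, j))" for k
      by (rule prod) simp_all
    moreover have "(S * S) $$ (i, j) = (\<Sum>l = 0..<n. S $$ (i, l) * S $$ (l, j))"
      by (rule prod) simp_all
    ultimately have "(\<lambda>k. (Z k * Z k) $$ (i, j)) \<longlonglongrightarrow> (S * S) $$ (i, j)" by presburger
    \<comment> \<open>The recursion replaces the square of \<open>?Y k\<close> by
      \<open>2 ?Y (Suc k) - E\<close>, so the expression is affine in entries with known limits and
      the two limits of \<open>?Y\<close> cancel.\<close>
    moreover have "(Z k * Z k) $$ (i, j) = 1\<^sub>m n $$ (i, j) - 2 * ?Y k $$ (i, j) + 2 * ?Y (Suc k) $$ (i, j) - E $$ (i, j)" for k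
    proof -
      have "Z k * Z k = (1\<^sub>m n - ?Y k) - (?Y k - ?Y k * ?Y k)"
      proof -
        have "Z k * Z k = 1\<^sub>m n * (1\<^sub>m n - ?Y k) - ?Y k * (1\<^sub>m n - ?Y k)"
          unfolding Z_def by (intro minus_mult_distrib_mat) auto
        also have "1\<^sub>m n * (1\<^sub>m n - ?Y k) = 1\<^sub>m n - ?Y k" by (intro left_mult_one_mat) auto
        also have "?Y k * (1\<^sub>m n - ?Y k) = ?Y k * 1\<^sub>m n - ?Y k * ?Y k" by (intro mult_minus_distrib_mat) auto
        also have "?Y k * 1\<^sub>m n = ?Y k" by (intro right_mult_one_mat) auto
        finally show ?thesis .
      qed
      then show ?thesis using ij Ec by (simp add: field_simps)
    qed
    moreover have "(\<lambda>k. 1\<^sub>m n $$ (i, j) - 2 * ?Y k $$ (i, j) + 2 * ?Y (Suc k) $$ (i, j) - E $$ (i, j))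
        \<longlonglongrightarrow> 1\<^sub>m n $$ (i, j) - 2 * L i j + 2 * L i j - E $$ (i, j)"
      by (intro tendsto_intros L ij LIMSEQ_Suc[OF L[OF ij]])
    ultimately have "(S * S) $$ (i, j) = 1\<^sub>m n $$ (i, j) - 2 * L i j + 2 * L i j - E $$ (i, j)"
      using LIMSEQ_unique by simp
    then show "(S * S) $$ (i, j) = (1\<^sub>m n - E) $$ (i, j)" using ij Ec by simp
  qed (use Ec in auto)
  moreover have "psd_mat S"
  proof (rule psd_matI)
    show "S\<^sup>T = S"
    proof (rule eq_matI)
      fix i j assume "i < dim_row S" "j < dim_col S"
      then have ij: "i < n" "j < n" by simp_all
      have "?Y k $$ (j, i) = ?Y k $$ (i, j)" for k
        using psd_mat_transpose[OF Ypsd[of k]] ij Yd by (metis index_transpose_mat(1))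
      then have "L j i = L i j" using L[OF ij] L[OF ij(2,1)] LIMSEQ_unique by simp
      then show "S\<^sup>T $$ (i, j) = S $$ (i, j)" using ij by (simp add: S_def)
    qed simp_all
  next
    fix x :: "real vec" assume "dim_vec x = dim_row S"
    then have x: "dim_vec x = n" by simp
    have "x \<bullet> (Z k *\<^sub>v x) \<ge> 0" for k
      using Yle[OF x, of k] x by (simp add: Z_def mat_vec_simps sprod_simps)
    moreover have "(\<lambda>k. x \<bullet> (Z k *\<^sub>v x)) \<longlonglongrightarrow> x \<bullet> (S *\<^sub>v x)"
    proof -
      have form: "x \<bullet> (A *\<^sub>v x) = (\<Sum>i = 0..<n. x $ i * (\<Sum>j = 0..<n. A $$ (i, j) * x $ j))"
        if "dim_row A = n" "dim_col A = n" for A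
        using that x by (simp add: scalar_prod_def)
      show ?thesis by (simp add: form, intro tendsto_sum tendsto_mult tendsto_const ZS) auto
    qed
    ultimately show "0 \<le> x \<bullet> (S *\<^sub>v x)" by (intro LIMSEQ_le_const) auto
  qed simp
  ultimately show ?thesis by (intro exI[of _ S]) simp
qed

text \<open>Scaling puts \<open>Q / c\<close> between 0 and the identity. With
  \<open>E = 1 - Q / c\<close> the iteration yields a root of \<open>Q / c\<close>, rescaled by
  \<open>sqrt c\<close>; taking \<open>c = d + 1\<close> keeps it positive.\<close>

lemma psd_sqrt_exists:
  assumes Q: "psd_mat Q"
  shows "\<exists>S. psd_mat S \<and> dim_row S = dim_row Q \<and> S * S = Q"
proof -
  let ?n = "dim_row Q"
  note dim [simp] = psd_mat_dim[OF Q]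
  obtain d where d: "op_bound Q d" using op_bound_exists by blast
  define c where "c = d + 1"
  have c: "c > 0" using op_bound_nonneg[OF d] by (simp add: c_def)
  define E where "E = 1\<^sub>m ?n - (1 / c) \<cdot>\<^sub>m Q"
  have Ed [simp]: "dim_row E = ?n" "dim_col E = ?n" by (simp_all add: E_def)
  have form: "x \<bullet> (E *\<^sub>v x) = x \<bullet> x - (x \<bullet> (Q *\<^sub>v x)) / c" if "dim_vec x = ?n" for x
    using that by (simp add: E_def mat_vec_simps sprod_simps)
  have le: "x \<bullet> (Q *\<^sub>v x) \<le> c * (x \<bullet> x)" if x: "dim_vec x = ?n" for x
  proof -
    have "x \<bullet> (Q *\<^sub>v x) \<le> vnorm x * vnorm (Q *\<^sub>v x)" using vnorm_cauchy_schwarz[of x "Q *\<^sub>v x"] x by simp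
    also have "\<dots> \<le> vnorm x * (d * vnorm x)" using x by (intro mult_left_mono op_boundD[OF d]) auto
    also have "\<dots> = d * (x \<bullet> x)" by (simp add: power2_eq_square flip: vnorm_power2)
    also have "\<dots> \<le> c * (x \<bullet> x)" by (intro mult_right_mono) (simp_all add: c_def sprod_self_nonneg)
    finally show ?thesis .
  qed
  have "psd_mat E"
  proof (rule psd_matI)
    show "E\<^sup>T = E"
    proof (rule eq_matI)
      fix i j assume "i < dim_row E" "j < dim_col E"
      moreover have "Q $$ (j, i) = Q $$ (i, j)" if "i < ?n" "j < ?n"
        using psd_mat_transpose[OF Q] that dim by (metis index_transpose_mat(1))
      ultimately show "E\<^sup>T $$ (i, j) = E $$ (i, j)" by (simp add: E_def)
    qed simp_all
    show "0 \<le> x \<bullet> (E *\<^sub>v x)" if "dim_vec x = dim_row E" for x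
    proof -
      have x: "dim_vec x = ?n" using that by simp
      have "(x \<bullet> (Q *\<^sub>v x)) / c \<le> x \<bullet> x" using le[OF x] c by (simp add: divide_le_eq mult.commute)
      then show ?thesis using form[OF x] by simp
    qed
  qed simp
  moreover have "x \<bullet> (E *\<^sub>v x) \<le> x \<bullet> x" if "dim_vec x = ?n" for x
    using form[OF that] psd_mat_nonneg[OF Q that] c by simp
  ultimately obtain S where S: "psd_mat S" "dim_row S = ?n" "S * S = 1\<^sub>m ?n - E"
    using sqrt_one_minus_exists[of E ?n] by auto
  have Sd [simp]: "dim_row S = ?n" "dim_col S = ?n" using S psd_mat_dim[OF S(1)] by simp_all
  let ?S = "sqrt c \<cdot>\<^sub>m S"
  have "psd_mat ?S"
  proof (rule psd_matI)
    show "?S\<^sup>T = ?S"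
      by (rule transpose_smult_sym[OF psd_mat_transpose[OF S(1)]])
    show "0 \<le> x \<bullet> (?S *\<^sub>v x)" if "dim_vec x = dim_row ?S" for x
      using that psd_mat_nonneg[OF S(1), of x] c by (simp add: mat_vec_simps)
  qed simp
  moreover have "?S * ?S = Q"
  proof -
    have "?S * ?S = c \<cdot>\<^sub>m (S * S)"
      using c by (intro mat_eqI_vec) (simp_all add: mat_vec_simps smult_smult_assoc)
    also have "\<dots> = Q" unfolding S(3) using c by (intro eq_matI) (simp_all add: E_def)
    finally show ?thesis .
  qed
  ultimately show ?thesis by (intro exI[of _ ?S]) simp
qed

lemma mat_sqrt_psd:
  assumes Q: "psd_mat Q"
  shows "psd_mat (mat_sqrt Q)" "dim_row (mat_sqrt Q) = dim_row Q" "dim_col (mat_sqrt Q) = dim_row Q"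
    "mat_sqrt Q * mat_sqrt Q = Q"
proof -
  obtain S where S: "psd_mat S" "dim_row S = dim_row Q" "S * S = Q" using psd_sqrt_exists[OF Q] by blast
  have "mat_sqrt Q = S"
    unfolding mat_sqrt_def
  proof (rule the_equality)
    show "S \<in> carrier_mat (dim_row Q) (dim_row Q) \<and> psd_mat S \<and> S * S = Q"
      using S psd_mat_dim[OF S(1)] by (intro conjI carrier_matI) simp_all
    show "S' = S" if "S' \<in> carrier_mat (dim_row Q) (dim_row Q) \<and> psd_mat S' \<and> S' * S' = Q" for S'
      
      by (rule psd_sqrt_unique) (use that S in auto)
  qed
  then show "psd_mat (mat_sqrt Q)" "dim_row (mat_sqrt Q) = dim_row Q" "dim_col (mat_sqrt Q) = dim_row Q"
    "mat_sqrt Q * mat_sqrt Q = Q"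
    using S psd_mat_dim[OF S(1)] by simp_all
qed

section \<open>Schur stability\<close>

lemma pow_mat_smult:
  fixes A :: "real mat"
  assumes A: "A \<in> carrier_mat n n"
  shows "(c \<cdot>\<^sub>m A) ^\<^sub>m k = (c ^ k) \<cdot>\<^sub>m (A ^\<^sub>m k)"
proof (induction k)
  case 0
  show ?case by (intro eq_matI) simp_all
next
  case (Suc k)
  have cA: "c \<cdot>\<^sub>m A \<in> carrier_mat n n" using A by simp
  have "(c \<cdot>\<^sub>m A) ^\<^sub>m Suc k = ((c ^ k) \<cdot>\<^sub>m (A ^\<^sub>m k)) * (c \<cdot>\<^sub>m A)" by (simp add: Suc)
  also have "\<dots> = (c ^ k) \<cdot>\<^sub>m (A ^\<^sub>m k * (c \<cdot>\<^sub>m A))"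
    by (rule mult_smult_assoc_mat[OF pow_carrier_mat[OF A] cA])
  also have "A ^\<^sub>m k * (c \<cdot>\<^sub>m A) = c \<cdot>\<^sub>m (A ^\<^sub>m k * A)"
    by (rule mult_smult_distrib[OF pow_carrier_mat[OF A] A])
  finally show ?case by (intro eq_matI) simp_all
qed

lemma pow_mat_transpose:
  fixes A :: "real mat"
  assumes A: "A \<in> carrier_mat n n"
  shows "(A\<^sup>T) ^\<^sub>m k = (A ^\<^sub>m k)\<^sup>T"
proof (induction k)
  case 0
  show ?case using A by simp
next
  case (Suc k)
  have A1: "A ^\<^sub>m 1 = A" using A by simp
  have "A ^\<^sub>m Suc k = A * A ^\<^sub>m k" using pow_mat_add[of A n 1 k] A A1 by simp
  moreover have "(A * A ^\<^sub>m k)\<^sup>T = (A ^\<^sub>m k)\<^sup>T * A\<^sup>T" by (rule transpose_mult_dim) (use A in auto)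
  ultimately show ?case using Suc by simp
qed

text \<open>Spectral radius below 1 gives bounded powers. Applied to \<open>A / r\<close>, with
  \<open>r\<close> strictly between the spectral radius of \<open>A\<close> and 1, boundedness
  becomes geometric decay at rate \<open>r\<close>.\<close>

lemma schur_stable_power_bound:
  assumes A: "A \<in> carrier_mat n n" and stable: "schur_stable A"
  obtains c r where "0 < r" "r < 1" "0 \<le> c" "\<And>k. op_bound (A ^\<^sub>m k) (c * r ^ k)"
\<comment> \<open>Without dimensions the spectrum is empty and its maximum says nothing, but all
  vectors have norm 0 and any rate works.\<close>
proof (cases "n = 0")
  case True
  have "op_bound (A ^\<^sub>m k) (1 * (1/2) ^ k)" for k
  proof (rule op_boundI)
    fix v :: "real vec" assume "dim_vec v = dim_col (A ^\<^sub>m k)"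
    have "dim_vec (A ^\<^sub>m k *\<^sub>v v) = 0" using A True by simp
    then have "vnorm (A ^\<^sub>m k *\<^sub>v v) = 0" by (simp add: vnorm_def scalar_prod_def)
    then show "vnorm (A ^\<^sub>m k *\<^sub>v v) \<le> 1 * (1/2) ^ k * vnorm v" by simp
  qed simp
  then show ?thesis by (intro that[of "1/2" 1]) auto
next
  case False
  let ?C = "map_mat complex_of_real"
  define s where "s = spectral_radius (?C A)"
  have cA: "?C A \<in> carrier_mat n n" using A by simp
  have n: "n > 0" using False by simp
  have s: "s < 1" using stable by (simp add: schur_stable_def s_def)
  have "0 \<le> s" using spectral_radius_mem_max(1)[OF cA n] by (auto simp: s_def)
  define r where "r = (1 + s) / 2"
  have r: "0 < r" "r < 1" "s < r" using s \<open>0 \<le> s\<close> by (simp_all add: r_def)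
  define B where "B = (1 / r) \<cdot>\<^sub>m A"
  have B: "B \<in> carrier_mat n n" using A by (simp add: B_def)
  have cB: "?C B \<in> carrier_mat n n" using B by simp
  have "spectral_radius (?C B) < 1"
  proof -
    \<comment> \<open>The spectral radius of \<open>B\<close> is attained at an eigenvalue
      \<open>l\<close>; then \<open>r * l\<close> is an eigenvalue of \<open>A\<close>, so its
      modulus is at most \<open>s < r\<close>.\<close>
    obtain l where l: "eigenvalue (?C B) l" "spectral_radius (?C B) = norm l"
      using spectral_radius_mem_max(1)[OF cB n] by (auto simp: spectrum_def)
    then obtain v where v: "v \<in> carrier_vec n" "v \<noteq> 0\<^sub>v n" "?C B *\<^sub>v v = l \<cdot>\<^sub>v v"
      using B by (auto simp: eigenvalue_def eigenvector_def)
    have "?C A = of_real r \<cdot>\<^sub>m ?C B" using A r by (intro eq_matI) (auto simp: B_def)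
    then have "?C A *\<^sub>v v = of_real r \<cdot>\<^sub>v (?C B *\<^sub>v v)"
      using v(1) B by (intro eq_vecI) auto
    then have "?C A *\<^sub>v v = (of_real r * l) \<cdot>\<^sub>v v" by (simp add: v(3) smult_smult_assoc)
    then have "eigenvalue (?C A) (of_real r * l)"
      using v A by (auto simp: eigenvalue_def eigenvector_def)
    then have "norm (of_real r * l) \<le> s"
      unfolding s_def by (intro spectral_radius_mem_max(2)[OF cA n]) (auto simp: spectrum_def)
    then have "r * norm l \<le> s" using r by (simp add: norm_mult)
    then have "r * norm l < r * 1" using r(3) by linarith
    then have "norm l < 1" using r(1) by (rule mult_left_less_imp_less[OF _ less_imp_le])
    then show ?thesis using l by simp
  qed
  then obtain b where b: "\<And>k. norm_bound (?C B ^\<^sub>m k) b"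
    using spectral_radius_jnf_norm_bound_less_1_upper_triangular[OF cB] by blast
  have "op_bound (A ^\<^sub>m k) (real n * (real n * \<bar>b\<bar>) * r ^ k)" for k
  proof -
    have Ak: "A ^\<^sub>m k \<in> carrier_mat n n" using A by simp
    have "\<bar>(A ^\<^sub>m k) $$ (i, j)\<bar> \<le> \<bar>b\<bar> * r ^ k" if ij: "i < dim_row (A ^\<^sub>m k)" "j < dim_col (A ^\<^sub>m k)" for i j
    proof -
      have ij': "i < n" "j < n" using ij Ak by auto
      have "?C B ^\<^sub>m k = ?C (B ^\<^sub>m k)" by (rule of_real_hom.mat_hom_pow[OF B, symmetric])
      then have "norm (?C (B ^\<^sub>m k) $$ (i, j)) \<le> b"
        using b[of k] ij' B unfolding norm_bound_def by auto
      then have "\<bar>(B ^\<^sub>m k) $$ (i, j)\<bar> \<le> b" using ij' B by simp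
      also have "(B ^\<^sub>m k) $$ (i, j) = (1 / r) ^ k * (A ^\<^sub>m k) $$ (i, j)"
        unfolding B_def pow_mat_smult[OF A] using ij by simp
      finally have "\<bar>(A ^\<^sub>m k) $$ (i, j)\<bar> / r ^ k \<le> b" using r by (simp add: abs_mult power_divide)
      then have "\<bar>(A ^\<^sub>m k) $$ (i, j)\<bar> \<le> b * r ^ k" using r by (simp add: pos_divide_le_eq)
      also have "\<dots> \<le> \<bar>b\<bar> * r ^ k" using r by (intro mult_right_mono) auto
      finally show ?thesis .
    qed
    then have "op_bound (A ^\<^sub>m k) (real (dim_row (A ^\<^sub>m k)) * (real (dim_col (A ^\<^sub>m k)) * (\<bar>b\<bar> * r ^ k)))"
      using r by (intro op_bound_entries) simp_all
    then show ?thesis unfolding carrier_matD[OF Ak] by (simp add: mult.assoc)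
  qed
  then show ?thesis using r by (intro that[of r "real n * (real n * \<bar>b\<bar>)"]) auto
qed

text \<open>\<open>N v\<close> sums the norms of \<open>M ^\<^sub>m k *\<^sub>v v\<close> divided by
  \<open>\<sigma> ^ k\<close> over \<open>k < K\<close>, with \<open>r < \<sigma> < 1\<close>.
  Applying \<open>M\<close> shifts the sum at the price of a factor \<open>\<sigma>\<close>, and for
  large \<open>K\<close> the term gained at the end is at most the term lost at the start.\<close>

lemma adapted_norm:
  fixes M :: "real mat"
  assumes M: "M \<in> carrier_mat n n" and r: "0 < r" "r < 1" "0 \<le> c"
    and pow: "\<And>k. op_bound (M ^\<^sub>m k) (c * r ^ k)"
  shows "\<exists>N \<sigma> d. 0 < \<sigma> \<and> \<sigma> < 1 \<and> (\<forall>v. dim_vec v = n \<longrightarrow> vnorm v \<le> N v) \<and>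
    (\<forall>v. dim_vec v = n \<longrightarrow> N v \<le> d * vnorm v) \<and>
    (\<forall>u v. dim_vec u = n \<longrightarrow> dim_vec v = n \<longrightarrow> N (u + v) \<le> N u + N v) \<and>
    (\<forall>v. dim_vec v = n \<longrightarrow> N (M *\<^sub>v v) \<le> \<sigma> * N v)"
proof -
  define \<sigma> where "\<sigma> = (1 + r) / 2"
  have s: "0 < \<sigma>" "\<sigma> < 1" "r < \<sigma>" using r by (simp_all add: \<sigma>_def)
  \<comment> \<open>\<open>c + 1\<close> allows the division also for \<open>c = 0\<close>. The
    strict inequality forces \<open>K \<noteq> 0\<close>, which makes \<open>vnorm v\<close> itself
    a summand of \<open>N v\<close>.\<close>
  obtain K where K: "(r / \<sigma>) ^ K < 1 / (c + 1)"
    using real_arch_pow_inv[of "1 / (c + 1)" "r / \<sigma>"] s r by auto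
  have "K \<noteq> 0" using K r by (intro notI) simp
  have "c * (r / \<sigma>) ^ K \<le> (c + 1) * (r / \<sigma>) ^ K" using s r by (intro mult_right_mono) auto
  also have "\<dots> \<le> 1" using K r by (simp add: field_simps)
  finally have cK: "c * r ^ K / \<sigma> ^ K \<le> 1" by (simp add: power_divide)
  define a where "a v k = vnorm (M ^\<^sub>m k *\<^sub>v v) / \<sigma> ^ k" for v k
  define N where "N v = (\<Sum>k<K. a v k)" for v
  have a0: "a v 0 = vnorm v" if "dim_vec v = n" for v using that M by (simp add: a_def one_mult_mat_vec_dim)
  have an: "0 \<le> a v k" for v k using s by (simp add: a_def)
  have Md: "dim_row (M ^\<^sub>m k) = n" "dim_col (M ^\<^sub>m k) = n" for k
    using carrier_matD[OF pow_carrier_mat[OF M]] by auto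
  show ?thesis
  proof (rule exI[of _ N], rule exI[of _ \<sigma>], rule exI[of _ "\<Sum>k<K. c * r ^ k / \<sigma> ^ k"],
      intro conjI allI impI)
    show "0 < \<sigma>" "\<sigma> < 1" by (fact s)+
    show "vnorm v \<le> N v" if "dim_vec v = n" for v
      unfolding N_def a0[OF that, symmetric] using \<open>K \<noteq> 0\<close> an by (intro member_le_sum) auto
    show "N v \<le> (\<Sum>k<K. c * r ^ k / \<sigma> ^ k) * vnorm v" if v: "dim_vec v = n" for v
      unfolding N_def sum_distrib_right
    proof (rule sum_mono)
      fix k
      show "a v k \<le> c * r ^ k / \<sigma> ^ k * vnorm v"
        using divide_right_mono[OF op_boundD[OF pow[of k], of v], of "\<sigma> ^ k"] s v Md by (simp add: a_def)
    qed
    show "N (u + v) \<le> N u + N v" if "dim_vec u = n" "dim_vec v = n" for u v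
      unfolding N_def sum.distrib[symmetric]
    proof (rule sum_mono)
      fix k
      have "vnorm (M ^\<^sub>m k *\<^sub>v (u + v)) \<le> vnorm (M ^\<^sub>m k *\<^sub>v u) + vnorm (M ^\<^sub>m k *\<^sub>v v)"
        using that Md by (simp add: mult_mat_vec_add_dim vnorm_triangle)
      then show "a (u + v) k \<le> a u k + a v k"
        using s by (simp add: a_def divide_right_mono flip: add_divide_distrib)
    qed
    show "N (M *\<^sub>v v) \<le> \<sigma> * N v" if v: "dim_vec v = n" for v
    proof -
      have shift: "a (M *\<^sub>v v) k = \<sigma> * a v (Suc k)" for k
        using v M Md s by (simp add: a_def mult_mat_vec_assoc_dim)
      have "(\<Sum>k<K. a v (Suc k)) + a v 0 = (\<Sum>k<K. a v k) + a v K"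
        using sum.lessThan_Suc_shift[of "a v" K] sum.lessThan_Suc[of "a v" K] by simp
      moreover have "a v K \<le> a v 0"
      proof -
        have "a v K \<le> c * r ^ K / \<sigma> ^ K * vnorm v"
          using divide_right_mono[OF op_boundD[OF pow[of K], of v], of "\<sigma> ^ K"] s v Md by (simp add: a_def)
        also have "\<dots> \<le> 1 * vnorm v" using cK by (intro mult_right_mono) auto
        finally show ?thesis using a0[OF v] by simp
      qed
      ultimately have "(\<Sum>k<K. a v (Suc k)) \<le> N v" by (simp add: N_def)
      then show ?thesis
        using s by (simp add: N_def shift flip: sum_distrib_left)
    qed
  qed
qed

section \<open>One step of the Riccati recursion\<close>

lemma mat_eqI_form:
  fixes M N :: "real mat"
  assumes d: "dim_row M = n" "dim_col M = k" "dim_row N = n" "dim_col N = k"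
    and eq: "\<And>x y. dim_vec x = n \<Longrightarrow> dim_vec y = k \<Longrightarrow> x \<bullet> (M *\<^sub>v y) = x \<bullet> (N *\<^sub>v y)"
  shows "M = N"
proof (rule eq_matI)
  fix i j assume "i < dim_row N" "j < dim_col N"
  then have ij: "i < n" "j < k" using d by simp_all
  show "M $$ (i, j) = N $$ (i, j)"
    using eq[of "unit_vec n i" "unit_vec k j"] unit_vec_form[of M n k, OF d(1,2) ij] unit_vec_form[of N n k, OF d(3,4) ij]
    by simp
qed (use d in simp_all)

text \<open>A bound on the quadratic form bounds the operator: Cauchy-Schwarz at
  \<open>y = X *\<^sub>v v\<close> and \<open>v\<close>, after which one factor
  \<open>y \<bullet> y\<close> cancels.\<close>

lemma psd_op_bound:
  assumes X: "psd_mat X" and "0 \<le> m"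
    and le: "\<And>x. dim_vec x = dim_row X \<Longrightarrow> x \<bullet> (X *\<^sub>v x) \<le> m * (x \<bullet> x)"
  shows "op_bound X m"
proof (rule op_boundI[OF \<open>0 \<le> m\<close>])
  fix v :: "real vec" assume "dim_vec v = dim_col X"
  then have v: "dim_vec v = dim_row X" using psd_mat_dim[OF X] by simp
  let ?y = "X *\<^sub>v v"
  have "(?y \<bullet> ?y)\<^sup>2 \<le> (?y \<bullet> (X *\<^sub>v ?y)) * (v \<bullet> ?y)" by (rule psd_cauchy_schwarz[OF X _ v]) simp
  also have "\<dots> \<le> (m * (?y \<bullet> ?y)) * (m * (v \<bullet> v))"
    using v \<open>0 \<le> m\<close> by (intro mult_mono le psd_mat_nonneg[OF X] mult_nonneg_nonneg sprod_self_nonneg) simp_all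
  finally have *: "(?y \<bullet> ?y) * (?y \<bullet> ?y) \<le> (m\<^sup>2 * (v \<bullet> v)) * (?y \<bullet> ?y)"
    by (simp add: power2_eq_square mult_ac)
  have "?y \<bullet> ?y \<le> m\<^sup>2 * (v \<bullet> v)"
  proof (cases "?y \<bullet> ?y = 0")
    case True
    then show ?thesis using sprod_self_nonneg[of v] by simp
  next
    case False
    then have "?y \<bullet> ?y > 0" using sprod_self_nonneg[of ?y] by linarith
    then show ?thesis using * by (simp add: mult_le_cancel_right)
  qed
  then show "vnorm ?y \<le> m * vnorm v"
    using \<open>0 \<le> m\<close> by (intro vnorm_le_if_power2_le) (simp_all add: power_mult_distrib vnorm_power2)
qed

text \<open>\<open>B\<close> is not fixed here: inputs move the prediction but never the covariance,
  the gain or the closed loop.\<close>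

locale kalman_filter =
  fixes n p :: nat and A C Q R :: "real mat"
  assumes dims [simp]: "dim_row A = n" "dim_col A = n" "dim_row C = p" "dim_col C = n"
      "dim_row Q = n" "dim_row R = p"
    and psd_Q: "psd_mat Q" and pd_R: "pd_mat R"
begin

lemma dims_QR [simp]: "dim_col Q = n" "dim_col R = p"
  using psd_mat_dim[OF psd_Q] psd_mat_dim[OF pd_imp_psd[OF pd_R]] by simp_all

definition cov :: "real mat \<Rightarrow> bool" where "cov X \<longleftrightarrow> psd_mat X \<and> dim_row X = n"
definition innov :: "real mat \<Rightarrow> real mat" where "innov X = C * X * C\<^sup>T + R"
definition gain :: "real mat \<Rightarrow> real mat" where "gain X = kf_gain C R X"
definition corr :: "real mat \<Rightarrow> real mat" where "corr X = 1\<^sub>m n - gain X * C"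
definition closed :: "real mat \<Rightarrow> real mat" where "closed X = A * corr X"
definition riccati :: "real mat \<Rightarrow> real mat" where "riccati X = A * (corr X * X) * A\<^sup>T + Q"

lemma cov_psd: "cov X \<Longrightarrow> psd_mat X"
  by (simp add: cov_def)

lemma cov_dim [simp]: "cov X \<Longrightarrow> dim_row X = n" "cov X \<Longrightarrow> dim_col X = n"
  using psd_mat_dim by (auto simp: cov_def)

lemma kf_prior_Suc: "kf_prior A C Q R P (Suc t) = riccati (kf_prior A C Q R P t)"
  by (simp add: riccati_def corr_def gain_def Let_def)

lemma innov_dim [simp]: "dim_row (innov X) = p" "dim_col (innov X) = p"
  by (simp_all add: innov_def)

lemma innov_pd: "cov X \<Longrightarrow> pd_mat (innov X)"
  unfolding innov_def by (intro psd_add_pd psd_congruence pd_R) (simp_all add: cov_def)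

lemma gain_eq: "gain X = X * C\<^sup>T * mat_inv (innov X)"
  by (simp add: gain_def kf_gain_def innov_def)

lemma inv_dim [simp]: "cov X \<Longrightarrow> dim_row (mat_inv (innov X)) = p" "cov X \<Longrightarrow> dim_col (mat_inv (innov X)) = p"
  using mat_inv_pd(1,2)[OF innov_pd] by simp_all

lemma gain_dim [simp]: "cov X \<Longrightarrow> dim_row (gain X) = n" "cov X \<Longrightarrow> dim_col (gain X) = p"
  by (simp_all add: gain_eq)

lemma corr_dim [simp]: "cov X \<Longrightarrow> dim_row (corr X) = n" "cov X \<Longrightarrow> dim_col (corr X) = n"
  by (simp_all add: corr_def)

lemma closed_dim [simp]: "cov X \<Longrightarrow> dim_row (closed X) = n" "cov X \<Longrightarrow> dim_col (closed X) = n"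
  by (simp_all add: closed_def)

lemma riccati_dim [simp]: "dim_row (riccati X) = n" "dim_col (riccati X) = n"
  by (simp_all add: riccati_def)

lemma innov_inv_vec:
  assumes "cov X" "dim_vec q = p"
  shows "innov X *\<^sub>v (mat_inv (innov X) *\<^sub>v q) = q" "mat_inv (innov X) *\<^sub>v (innov X *\<^sub>v q) = q"
  using mat_inv_pd(3,4)[OF innov_pd[OF assms(1)]] assms
  by (simp_all flip: mult_mat_vec_assoc_dim add: one_mult_mat_vec_dim)

lemma innov_vec: "cov X \<Longrightarrow> dim_vec q = p \<Longrightarrow> innov X *\<^sub>v q = C *\<^sub>v (X *\<^sub>v (C\<^sup>T *\<^sub>v q)) + R *\<^sub>v q"
  by (simp add: innov_def mat_vec_simps)

lemma gain_innov: "cov X \<Longrightarrow> dim_vec q = p \<Longrightarrow> gain X *\<^sub>v (innov X *\<^sub>v q) = X *\<^sub>v (C\<^sup>T *\<^sub>v q)"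
  by (simp add: gain_eq mult_mat_vec_assoc_dim innov_inv_vec)

text \<open>Like \<open>gain_innov\<close>, this trades the inverse inside the gain for the
  innovation covariance, so that the Riccati identities become polynomial. It rests on the symmetry
  of both \<open>X\<close> and the inverse.\<close>

lemma innov_gain:
  assumes X: "cov X" and a: "dim_vec a = n"
  shows "innov X *\<^sub>v ((gain X)\<^sup>T *\<^sub>v a) = C *\<^sub>v (X *\<^sub>v a)"
proof -
  have "(gain X)\<^sup>T = mat_inv (innov X) * (C * X)"
    using X mat_inv_pd(5)[OF innov_pd[OF X]] psd_mat_transpose[OF cov_psd[OF X]]
    by (simp add: gain_eq transpose_mult_dim)
  then show ?thesis using X a by (simp add: mult_mat_vec_assoc_dim innov_inv_vec)
qed

lemma innov_sym: "cov X \<Longrightarrow> (innov X)\<^sup>T = innov X"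
  by (rule psd_mat_transpose[OF pd_imp_psd[OF innov_pd]])

text \<open>\<open>corr X * X\<close> is not visibly symmetric; factoring the correction through
  \<open>innov X\<close> lets both arguments enter alike.\<close>

lemma corr_form:
  assumes X: "cov X" and a: "dim_vec a = n" and b: "dim_vec b = n"
  shows "a \<bullet> ((corr X * X) *\<^sub>v b) =
    a \<bullet> (X *\<^sub>v b) - ((gain X)\<^sup>T *\<^sub>v a) \<bullet> (innov X *\<^sub>v ((gain X)\<^sup>T *\<^sub>v b))"
proof -
  have "a \<bullet> ((corr X * X) *\<^sub>v b) = a \<bullet> (X *\<^sub>v b) - a \<bullet> (gain X *\<^sub>v (C *\<^sub>v (X *\<^sub>v b)))"
    using X a b by (simp add: corr_def mat_vec_simps sprod_simps)
  also have "a \<bullet> (gain X *\<^sub>v (C *\<^sub>v (X *\<^sub>v b))) = ((gain X)\<^sup>T *\<^sub>v a) \<bullet> (innov X *\<^sub>v ((gain X)\<^sup>T *\<^sub>v b))"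
    using X a b by (simp add: sprod_adjoint[of a "gain X"] innov_gain)
  finally show ?thesis .
qed

lemma riccati_form:
  assumes X: "cov X" and x: "dim_vec x = n" and z: "dim_vec z = n"
  shows "x \<bullet> (riccati X *\<^sub>v z) = (A\<^sup>T *\<^sub>v x) \<bullet> (X *\<^sub>v (A\<^sup>T *\<^sub>v z))
    - ((gain X)\<^sup>T *\<^sub>v (A\<^sup>T *\<^sub>v x)) \<bullet> (innov X *\<^sub>v ((gain X)\<^sup>T *\<^sub>v (A\<^sup>T *\<^sub>v z))) + x \<bullet> (Q *\<^sub>v z)"
proof -
  have "x \<bullet> (riccati X *\<^sub>v z) = x \<bullet> (A *\<^sub>v ((corr X * X) *\<^sub>v (A\<^sup>T *\<^sub>v z))) + x \<bullet> (Q *\<^sub>v z)"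
    using X x z by (simp add: riccati_def mat_vec_simps sprod_simps)
  also have "x \<bullet> (A *\<^sub>v ((corr X * X) *\<^sub>v (A\<^sup>T *\<^sub>v z))) = (A\<^sup>T *\<^sub>v x) \<bullet> ((corr X * X) *\<^sub>v (A\<^sup>T *\<^sub>v z))"
    using X x z by (simp add: sprod_adjoint[of x A])
  finally show ?thesis using X x z by (simp add: corr_form)
qed

text \<open>The vector \<open>k\<close> is the optimal control \<open>u\<close> of the dual one-step problem.\<close>

lemma riccati_complete_square:
  assumes X: "cov X" and z: "dim_vec z = n" and u: "dim_vec u = p"
  defines "y \<equiv> A\<^sup>T *\<^sub>v z - C\<^sup>T *\<^sub>v u" and "k \<equiv> (gain X)\<^sup>T *\<^sub>v (A\<^sup>T *\<^sub>v z)"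
  shows "y \<bullet> (X *\<^sub>v y) + u \<bullet> (R *\<^sub>v u) + z \<bullet> (Q *\<^sub>v z)
    = z \<bullet> (riccati X *\<^sub>v z) + (u - k) \<bullet> (innov X *\<^sub>v (u - k))"
proof -
  define a where "a = A\<^sup>T *\<^sub>v z"
  have a [simp]: "dim_vec a = n" and k [simp]: "dim_vec k = p" using X by (simp_all add: a_def k_def)
  note psd = cov_psd[OF X]
  have ka: "k = (gain X)\<^sup>T *\<^sub>v a" by (simp add: k_def a_def)
  have Wk: "innov X *\<^sub>v k = C *\<^sub>v (X *\<^sub>v a)" unfolding ka by (rule innov_gain[OF X a])
  have cross: "a \<bullet> (X *\<^sub>v (C\<^sup>T *\<^sub>v u)) = u \<bullet> (C *\<^sub>v (X *\<^sub>v a))"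
    using X u sym_form_commute[OF psd_mat_transpose[OF psd], of a "C\<^sup>T *\<^sub>v u"]
    by (simp add: sprod_adjoint[of u C])
  have cross2: "(C\<^sup>T *\<^sub>v u) \<bullet> (X *\<^sub>v a) = u \<bullet> (C *\<^sub>v (X *\<^sub>v a))"
    using X u by (simp add: sprod_adjoint[of u C])
  have uWu: "u \<bullet> (innov X *\<^sub>v u) = (C\<^sup>T *\<^sub>v u) \<bullet> (X *\<^sub>v (C\<^sup>T *\<^sub>v u)) + u \<bullet> (R *\<^sub>v u)"
    using X u by (simp add: innov_vec sprod_simps sprod_adjoint[of u C])
  have kWu: "k \<bullet> (innov X *\<^sub>v u) = u \<bullet> (C *\<^sub>v (X *\<^sub>v a))"
    using sym_form_commute[OF innov_sym[OF X], of k u] u Wk by simp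
  have "y \<bullet> (X *\<^sub>v y) = a \<bullet> (X *\<^sub>v a) - 2 * (u \<bullet> (C *\<^sub>v (X *\<^sub>v a))) + (C\<^sup>T *\<^sub>v u) \<bullet> (X *\<^sub>v (C\<^sup>T *\<^sub>v u))"
    unfolding y_def a_def[symmetric] using X u cross cross2 by (simp add: mult_mat_vec_diff_dim sprod_simps)
  moreover have "(u - k) \<bullet> (innov X *\<^sub>v (u - k)) =
      u \<bullet> (innov X *\<^sub>v u) - 2 * (u \<bullet> (C *\<^sub>v (X *\<^sub>v a))) + k \<bullet> (innov X *\<^sub>v k)"
    using X u kWu Wk by (simp add: mult_mat_vec_diff_dim sprod_simps)
  moreover have "z \<bullet> (riccati X *\<^sub>v z) = a \<bullet> (X *\<^sub>v a) - k \<bullet> (innov X *\<^sub>v k) + z \<bullet> (Q *\<^sub>v z)"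
    using riccati_form[OF X z z] by (simp add: a_def k_def)
  ultimately show ?thesis using uWu by simp
qed

text \<open>The completed square is nonnegative, so any dual control \<open>u\<close>, optimal or
  not, yields an upper bound on the value. This is how steering controls bound the
  covariance.\<close>

lemma riccati_le:
  assumes X: "cov X" and z: "dim_vec z = n" and u: "dim_vec u = p"
  shows "z \<bullet> (riccati X *\<^sub>v z) \<le>
    (A\<^sup>T *\<^sub>v z - C\<^sup>T *\<^sub>v u) \<bullet> (X *\<^sub>v (A\<^sup>T *\<^sub>v z - C\<^sup>T *\<^sub>v u)) + u \<bullet> (R *\<^sub>v u) + z \<bullet> (Q *\<^sub>v z)"
  using riccati_complete_square[OF assms]
    psd_mat_nonneg[OF pd_imp_psd[OF innov_pd[OF X]], of "u - (gain X)\<^sup>T *\<^sub>v (A\<^sup>T *\<^sub>v z)"] X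
  by simp

lemma closed_transpose:
  assumes X: "cov X" and z: "dim_vec z = n"
  shows "(closed X)\<^sup>T *\<^sub>v z = A\<^sup>T *\<^sub>v z - C\<^sup>T *\<^sub>v ((gain X)\<^sup>T *\<^sub>v (A\<^sup>T *\<^sub>v z))"
  using assms by (simp add: closed_def corr_def transpose_mult_dim transpose_minus_dim mat_vec_simps)

text \<open>With the optimal control the square vanishes and the next dual state is the adjoint
  closed loop. This Joseph form shows positivity and later serves as the exact decrease of the
  Lyapunov function.\<close>

lemma riccati_closed_loop:
  assumes X: "cov X" and z: "dim_vec z = n"
  defines "k \<equiv> (gain X)\<^sup>T *\<^sub>v (A\<^sup>T *\<^sub>v z)"
  shows "z \<bullet> (riccati X *\<^sub>v z) =
    ((closed X)\<^sup>T *\<^sub>v z) \<bullet> (X *\<^sub>v ((closed X)\<^sup>T *\<^sub>v z)) + k \<bullet> (R *\<^sub>v k) + z \<bullet> (Q *\<^sub>v z)"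
proof -
  have k: "dim_vec k = p" using X by (simp add: k_def)
  have "k - k = 0\<^sub>v p" using k by (intro eq_vecI) simp_all
  then show ?thesis
    using riccati_complete_square[OF X z k] k closed_transpose[OF X z]
    by (simp add: mult_mat_zero_vec sprod_zero_vec flip: k_def)
qed

text \<open>The subtraction in the recursion hides positivity; the closed-loop identity writes the
  form as a sum of three nonnegative terms.\<close>

lemma riccati_cov:
  assumes X: "cov X" shows "cov (riccati X)"
  unfolding cov_def
proof (intro conjI psd_matI)
  show "(riccati X)\<^sup>T = riccati X"
  proof (rule mat_eqI_form[where n = n and k = n])
    fix x y :: "real vec" assume x: "dim_vec x = n" and y: "dim_vec y = n"
    have "x \<bullet> ((riccati X)\<^sup>T *\<^sub>v y) = y \<bullet> (riccati X *\<^sub>v x)"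
      using x y sprod_comm[of "riccati X *\<^sub>v x" y] by (simp add: sprod_adjoint[of x "(riccati X)\<^sup>T"])
    also have "\<dots> = x \<bullet> (riccati X *\<^sub>v y)"
      unfolding riccati_form[OF X x y] riccati_form[OF X y x]
      using X x y
        sym_form_commute[OF psd_mat_transpose[OF cov_psd[OF X]], of "A\<^sup>T *\<^sub>v x" "A\<^sup>T *\<^sub>v y"]
        sym_form_commute[OF psd_mat_transpose[OF psd_Q], of x y]
        sym_form_commute[OF innov_sym[OF X], of "(gain X)\<^sup>T *\<^sub>v (A\<^sup>T *\<^sub>v x)" "(gain X)\<^sup>T *\<^sub>v (A\<^sup>T *\<^sub>v y)"]
      by simp
    finally show "x \<bullet> ((riccati X)\<^sup>T *\<^sub>v y) = x \<bullet> (riccati X *\<^sub>v y)" .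
  qed simp_all
  fix z :: "real vec" assume "dim_vec z = dim_row (riccati X)"
  then have z: "dim_vec z = n" by simp
  show "0 \<le> z \<bullet> (riccati X *\<^sub>v z)"
    unfolding riccati_closed_loop[OF X z]
    using X z by (intro add_nonneg_nonneg psd_mat_nonneg cov_psd pd_imp_psd[OF pd_R] psd_Q) simp_all
qed simp_all

text \<open>Taking the gain of \<open>X\<close> on the left and that of \<open>Y\<close> on the
  right makes the difference exactly linear in \<open>X - Y\<close>; a common gain would leave a
  remainder quadratic in the gain difference.\<close>

lemma riccati_diff:
  assumes X: "cov X" and Y: "cov Y"
  shows "riccati X - riccati Y = closed X * (X - Y) * (closed Y)\<^sup>T"
proof (rule mat_eqI_form[where n = n and k = n])
  fix x z :: "real vec" assume x: "dim_vec x = n" and z: "dim_vec z = n"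
  define a b where "a = A\<^sup>T *\<^sub>v x" and "b = A\<^sup>T *\<^sub>v z"
  define k l where "k = (gain X)\<^sup>T *\<^sub>v a" and "l = (gain X)\<^sup>T *\<^sub>v b"
  define k' l' where "k' = (gain Y)\<^sup>T *\<^sub>v a" and "l' = (gain Y)\<^sup>T *\<^sub>v b"
  have d [simp]: "dim_vec a = n" "dim_vec b = n" "dim_vec k = p" "dim_vec l = p" "dim_vec k' = p" "dim_vec l' = p"
    using X Y by (simp_all add: a_def b_def k_def l_def k'_def l'_def)
  have adj: "(C\<^sup>T *\<^sub>v q) \<bullet> w = q \<bullet> (C *\<^sub>v w)" if "dim_vec q = p" "dim_vec w = n" for q w
    using that by (simp add: sprod_adjoint)
  have gains: "C *\<^sub>v (X *\<^sub>v b) = innov X *\<^sub>v l" "C *\<^sub>v (X *\<^sub>v a) = innov X *\<^sub>v k"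
    "C *\<^sub>v (Y *\<^sub>v b) = innov Y *\<^sub>v l'" "C *\<^sub>v (Y *\<^sub>v a) = innov Y *\<^sub>v k'"
    using X Y by (simp_all add: k_def l_def k'_def l'_def innov_gain)
  have move: "a \<bullet> (Z *\<^sub>v (C\<^sup>T *\<^sub>v q)) = q \<bullet> (C *\<^sub>v (Z *\<^sub>v a))" if Z: "cov Z" and q: "dim_vec q = p" for Z q
    using sym_form_commute[OF psd_mat_transpose[OF cov_psd[OF Z]], of a "C\<^sup>T *\<^sub>v q"] Z q by (simp add: adj)
  have inn: "C *\<^sub>v (Z *\<^sub>v (C\<^sup>T *\<^sub>v q)) = innov Z *\<^sub>v q - R *\<^sub>v q" if Z: "cov Z" and q: "dim_vec q = p" for Z q
    using Z q by (intro eq_vecI) (simp_all add: innov_vec)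
  have sym: "l' \<bullet> (innov X *\<^sub>v k) = k \<bullet> (innov X *\<^sub>v l')" "l' \<bullet> (innov Y *\<^sub>v k') = k' \<bullet> (innov Y *\<^sub>v l')"
    using X Y by (simp_all add: sym_form_commute[OF innov_sym])
  \<comment> \<open>Here \<open>k\<close> belongs to \<open>X\<close> and \<open>l'\<close> to
    \<open>Y\<close>. At \<open>Z = X\<close> the second and fourth terms cancel, at
    \<open>Z = Y\<close> the third and fourth; the \<open>R\<close> term is common and drops out of
    the difference.\<close>
  have expand: "(a - C\<^sup>T *\<^sub>v k) \<bullet> (Z *\<^sub>v (b - C\<^sup>T *\<^sub>v l')) = a \<bullet> (Z *\<^sub>v b) - l' \<bullet> (C *\<^sub>v (Z *\<^sub>v a))
      - k \<bullet> (C *\<^sub>v (Z *\<^sub>v b)) + k \<bullet> (innov Z *\<^sub>v l') - k \<bullet> (R *\<^sub>v l')" if Z: "cov Z" for Z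
    using Z by (simp add: mult_mat_vec_diff_dim sprod_simps adj move inn)
  have "x \<bullet> ((closed X * (X - Y) * (closed Y)\<^sup>T) *\<^sub>v z) = ((closed X)\<^sup>T *\<^sub>v x) \<bullet> ((X - Y) *\<^sub>v ((closed Y)\<^sup>T *\<^sub>v z))"
    using X Y x z by (simp add: mult_mat_vec_assoc_dim sprod_adjoint[of x "closed X"])
  also have "\<dots> = (a - C\<^sup>T *\<^sub>v k) \<bullet> (X *\<^sub>v (b - C\<^sup>T *\<^sub>v l')) - (a - C\<^sup>T *\<^sub>v k) \<bullet> (Y *\<^sub>v (b - C\<^sup>T *\<^sub>v l'))"
    using X Y x z
    by (simp add: closed_transpose a_def b_def k_def l'_def minus_mat_mult_vec_dim sprod_diff_right)
  also have "\<dots> = x \<bullet> (riccati X *\<^sub>v z) - x \<bullet> (riccati Y *\<^sub>v z)"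
    unfolding expand[OF X] expand[OF Y] gains sym riccati_form[OF X x z] riccati_form[OF Y x z]
    by (simp add: a_def[symmetric] b_def[symmetric] k_def[symmetric] l_def[symmetric] k'_def[symmetric] l'_def[symmetric])
  also have "\<dots> = x \<bullet> ((riccati X - riccati Y) *\<^sub>v z)"
    using x z by (simp add: minus_mat_mult_vec_dim sprod_diff_right)
  finally show "x \<bullet> ((riccati X - riccati Y) *\<^sub>v z) = x \<bullet> ((closed X * (X - Y) * (closed Y)\<^sup>T) *\<^sub>v z)" by simp
qed (use X Y in simp_all)

text \<open>On \<open>y = innov X *\<^sub>v q\<close> the gain of \<open>X\<close> gives
  \<open>X *\<^sub>v (C\<^sup>T *\<^sub>v q)\<close>, while \<open>innov X\<close> exceeds
  \<open>innov Y\<close> by \<open>C (X - Y) C\<^sup>T\<close>. Hence the gains differ by a term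
  linear in \<open>X - Y\<close> with uniformly boundable factors.\<close>

lemma gain_diff:
  assumes X: "cov X" and Y: "cov Y"
  shows "gain X - gain Y = corr Y * ((X - Y) * (C\<^sup>T * mat_inv (innov X)))"
proof (rule mat_eqI_vec)
  fix y :: "real vec" assume "dim_vec y = dim_col (corr Y * ((X - Y) * (C\<^sup>T * mat_inv (innov X))))"
  then have y: "dim_vec y = p" using X by simp
  define q where "q = mat_inv (innov X) *\<^sub>v y"
  have q [simp]: "dim_vec q = p" using X by (simp add: q_def)
  have yq: "y = innov X *\<^sub>v q" using X y by (simp add: q_def innov_inv_vec)
  define w where "w = (X - Y) *\<^sub>v (C\<^sup>T *\<^sub>v q)"
  have w [simp]: "dim_vec w = n" using Y by (simp add: w_def)
  have "innov X *\<^sub>v q = innov Y *\<^sub>v q + C *\<^sub>v w"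
  proof -
    have "C *\<^sub>v w = C *\<^sub>v (X *\<^sub>v (C\<^sup>T *\<^sub>v q)) - C *\<^sub>v (Y *\<^sub>v (C\<^sup>T *\<^sub>v q))"
      using X Y by (simp add: w_def minus_mat_mult_vec_dim mult_mat_vec_diff_dim)
    then show ?thesis using X Y by (intro eq_vecI) (simp_all add: innov_vec)
  qed
  then have "gain Y *\<^sub>v y = Y *\<^sub>v (C\<^sup>T *\<^sub>v q) + gain Y *\<^sub>v (C *\<^sub>v w)"
    using Y yq by (simp add: mult_mat_vec_add_dim gain_innov)
  moreover have "gain X *\<^sub>v y = X *\<^sub>v (C\<^sup>T *\<^sub>v q)" using X yq by (simp add: gain_innov)
  moreover have "w = X *\<^sub>v (C\<^sup>T *\<^sub>v q) - Y *\<^sub>v (C\<^sup>T *\<^sub>v q)" using X Y by (simp add: w_def minus_mat_mult_vec_dim)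
  moreover have "(corr Y * ((X - Y) * (C\<^sup>T * mat_inv (innov X)))) *\<^sub>v y = w - gain Y *\<^sub>v (C *\<^sub>v w)"
  proof -
    have "(corr Y * ((X - Y) * (C\<^sup>T * mat_inv (innov X)))) *\<^sub>v y = corr Y *\<^sub>v w"
      using X Y y by (simp add: mult_mat_vec_assoc_dim w_def q_def)
    also have "\<dots> = w - gain Y *\<^sub>v (C *\<^sub>v w)" using Y by (simp add: corr_def mat_vec_simps)
    finally show ?thesis .
  qed
  ultimately show "(gain X - gain Y) *\<^sub>v y = (corr Y * ((X - Y) * (C\<^sup>T * mat_inv (innov X)))) *\<^sub>v y"
    using X Y y by (intro eq_vecI) (simp_all add: minus_mat_mult_vec_dim)
qed (use X Y in simp_all)

text \<open>Every \<open>innov X\<close> dominates \<open>R\<close>, so a lower bound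
  \<open>r\<close> of \<open>R\<close> gives \<open>1 / r\<close> for all covariances at
  once.\<close>

lemma innov_inv_bound:
  obtains b where "0 \<le> b" "\<And>X. cov X \<Longrightarrow> op_bound (mat_inv (innov X)) b"
proof -
  obtain r where r: "r > 0" "\<And>x. dim_vec x = p \<Longrightarrow> r * (x \<bullet> x) \<le> x \<bullet> (R *\<^sub>v x)"
    using pd_lower_bound[OF pd_R] by auto
  have "op_bound (mat_inv (innov X)) (1 / r)" if X: "cov X" for X
  proof (rule op_boundI)
    fix v :: "real vec" assume "dim_vec v = dim_col (mat_inv (innov X))"
    then have v: "dim_vec v = p" using X by simp
    define x where "x = mat_inv (innov X) *\<^sub>v v"
    have x [simp]: "dim_vec x = p" using X by (simp add: x_def)
    have "r * (vnorm x)\<^sup>2 \<le> x \<bullet> (R *\<^sub>v x)" using r(2)[of x] by (simp add: vnorm_power2)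
    also have "\<dots> \<le> x \<bullet> (innov X *\<^sub>v x)"
      using psd_mat_nonneg[OF cov_psd[OF X], of "C\<^sup>T *\<^sub>v x"] X
      by (simp add: innov_vec sprod_simps sprod_adjoint[of x C])
    also have "\<dots> = x \<bullet> v" using X v by (simp add: x_def innov_inv_vec)
    also have "\<dots> \<le> vnorm x * vnorm v" using vnorm_cauchy_schwarz[of x v] v by simp
    finally have "vnorm x * (r * vnorm x) \<le> vnorm x * vnorm v" by (simp add: power2_eq_square mult_ac)
    then have "r * vnorm x \<le> vnorm v"
      using vnorm_nonneg[of x] vnorm_nonneg[of v] by (cases "vnorm x = 0") (auto simp: mult_le_cancel_left)
    then show "vnorm (mat_inv (innov X) *\<^sub>v v) \<le> 1 / r * vnorm v"
      using r(1) by (simp add: x_def field_simps)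
  qed (use r in simp)
  then show ?thesis using r(1) by (intro that[of "1 / r"]) simp_all
qed

end

section \<open>Bounded covariances and exponential stability\<close>

lemma op_bound_form_le:
  assumes M: "op_bound M c" and d: "dim_row M = n" "dim_col M = n" "dim_vec x = n"
  shows "x \<bullet> (M *\<^sub>v x) \<le> c * (x \<bullet> x)"
proof -
  have "x \<bullet> (M *\<^sub>v x) \<le> vnorm x * vnorm (M *\<^sub>v x)" using vnorm_cauchy_schwarz[of x "M *\<^sub>v x"] d by simp
  also have "\<dots> \<le> vnorm x * (c * vnorm x)" using d by (intro mult_left_mono op_boundD[OF M]) auto
  also have "\<dots> = c * (x \<bullet> x)" by (simp add: power2_eq_square flip: vnorm_power2)
  finally show ?thesis .
qed

lemma sprod_self_le_power2:
  assumes M: "op_bound M c" and x: "dim_vec x = dim_col M"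
  shows "(M *\<^sub>v x) \<bullet> (M *\<^sub>v x) \<le> c\<^sup>2 * (x \<bullet> x)"
  using power_mono[OF op_boundD[OF M x], of 2] by (simp add: vnorm_power2 power_mult_distrib)

text \<open>Convexity of the square with weights \<open>\<sigma>\<close> and
  \<open>1 - \<sigma>\<close> at the points \<open>x\<close> and
  \<open>y / (1 - \<sigma>)\<close>.\<close>

lemma convex_square_le:
  fixes x y \<sigma> :: real
  assumes "0 < \<sigma>" "\<sigma> < 1"
  shows "(\<sigma> * x + y)\<^sup>2 \<le> \<sigma> * x\<^sup>2 + y\<^sup>2 / (1 - \<sigma>)"
proof -
  have "\<sigma> * x\<^sup>2 + y\<^sup>2 / (1 - \<sigma>) - (\<sigma> * x + y)\<^sup>2 = \<sigma> / (1 - \<sigma>) * ((1 - \<sigma>) * x - y)\<^sup>2"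
    using assms by (simp add: field_simps power2_eq_square)
  also have "\<dots> \<ge> 0" using assms by simp
  finally show ?thesis by simp
qed

context kalman_filter
begin

section \<open>Observability Gramian and the uniform covariance bound\<close>

abbreviation prior :: "real mat \<Rightarrow> nat \<Rightarrow> real mat" where "prior X t \<equiv> kf_prior A C Q R X t"

declare kf_prior.simps(2) [simp del]

lemma prior_cov: "cov X \<Longrightarrow> cov (prior X t)"
proof (induction t)
  case (Suc t)
  then show ?case unfolding kf_prior_Suc by (intro riccati_cov)
qed simp

text \<open>The observability Gramian, the sum over \<open>i < k\<close> of
  \<open>C A\<^sup>i\<close> transposed times itself. The recursive form is the identity that
  propagates the steered dual state.\<close>

fun gram :: "nat \<Rightarrow> real mat" where
  "gram 0 = 0\<^sub>m n n"
| "gram (Suc k) = C\<^sup>T * C + A\<^sup>T * gram k * A"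

lemma gram_dim [simp]: "dim_row (gram k) = n" "dim_col (gram k) = n"
  by (cases k; simp)+

lemma gram_Suc_vec: "dim_vec v = n \<Longrightarrow> gram (Suc k) *\<^sub>v v = C\<^sup>T *\<^sub>v (C *\<^sub>v v) + A\<^sup>T *\<^sub>v (gram k *\<^sub>v (A *\<^sub>v v))"
  by (simp add: mat_vec_simps)

lemma gram_Suc_form:
  "dim_vec u = n \<Longrightarrow> dim_vec v = n \<Longrightarrow>
    u \<bullet> (gram (Suc k) *\<^sub>v v) = (C *\<^sub>v u) \<bullet> (C *\<^sub>v v) + (A *\<^sub>v u) \<bullet> (gram k *\<^sub>v (A *\<^sub>v v))"
  by (simp add: gram_Suc_vec sprod_add_right sprod_adjoint[of u "C\<^sup>T"] sprod_adjoint[of u "A\<^sup>T"] del: gram.simps)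

lemma gram_psd: "psd_mat (gram k)"
proof (rule psd_matI)
  have sym: "u \<bullet> (gram k *\<^sub>v v) = v \<bullet> (gram k *\<^sub>v u)" if "dim_vec u = n" "dim_vec v = n" for u v
    using that
  proof (induction k arbitrary: u v)
    case 0
    then show ?case by (simp add: zero_mat_mult_vec_dim sprod_zero_vec)
  next
    case (Suc k)
    then show ?case using Suc.IH[of "A *\<^sub>v u" "A *\<^sub>v v"] sprod_comm[of "C *\<^sub>v u" "C *\<^sub>v v"]
      by (simp add: gram_Suc_form del: gram.simps)
  qed
  show "(gram k)\<^sup>T = gram k"
  proof (rule mat_eqI_form[where n = n and k = n])
    fix x y :: "real vec" assume x: "dim_vec x = n" and y: "dim_vec y = n"
    have "x \<bullet> ((gram k)\<^sup>T *\<^sub>v y) = y \<bullet> (gram k *\<^sub>v x)"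
      using x y sprod_comm[of "gram k *\<^sub>v x" y] by (simp add: sprod_adjoint[of x "(gram k)\<^sup>T"])
    then show "x \<bullet> ((gram k)\<^sup>T *\<^sub>v y) = x \<bullet> (gram k *\<^sub>v y)" using sym[OF x y] by simp
  qed simp_all
  show "0 \<le> x \<bullet> (gram k *\<^sub>v x)" if "dim_vec x = dim_row (gram k)" for x
  proof -
    have "dim_vec x = n" using that by simp
    then show ?thesis
    proof (induction k arbitrary: x)
      case 0
      then show ?case by (simp add: zero_mat_mult_vec_dim sprod_zero_vec)
    next
      case (Suc k)
      then show ?case using Suc.IH[of "A *\<^sub>v x"] sprod_self_nonneg[of "C *\<^sub>v x"]
        by (simp add: gram_Suc_form del: gram.simps)
    qed
  qed
qed simp

text \<open>Unrolling the recursion splits the form into nonnegative summands, each of which must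
  vanish.\<close>

lemma gram_form_zero:
  assumes "dim_vec v = n" "v \<bullet> (gram k *\<^sub>v v) = 0" "i < k"
  shows "C *\<^sub>v (A ^\<^sub>m i *\<^sub>v v) = 0\<^sub>v p"
  using assms
proof (induction k arbitrary: v i)
  case (Suc k)
  have Av: "dim_vec (A *\<^sub>v v) = n" by simp
  have "(C *\<^sub>v v) \<bullet> (C *\<^sub>v v) = 0" and gk: "(A *\<^sub>v v) \<bullet> (gram k *\<^sub>v (A *\<^sub>v v)) = 0"
    using Suc.prems(1,2) sprod_self_nonneg[of "C *\<^sub>v v"] psd_mat_nonneg[OF gram_psd, of "A *\<^sub>v v" k]
    by (simp_all add: gram_Suc_form del: gram.simps)
  then have Cv: "C *\<^sub>v v = 0\<^sub>v p" using vec_eq_zero_if_sprod_self[of "C *\<^sub>v v"] by simp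
  show ?case
  proof (cases i)
    case 0
    then show ?thesis using Cv Suc.prems(1) by (simp add: one_mult_mat_vec_dim)
  next
    case (Suc j)
    have "A ^\<^sub>m i *\<^sub>v v = A ^\<^sub>m j *\<^sub>v (A *\<^sub>v v)"
      unfolding Suc using Suc.prems(1) by (simp add: mult_mat_vec_assoc_dim)
    then show ?thesis using Suc.IH[OF Av gk, of j] Suc.prems(3) Suc by simp
  qed
qed simp

lemma gram_pd:
  assumes obs: "observable n A C" shows "pd_mat (gram n)"
proof (rule pd_matI)
  fix x :: "real vec" assume "dim_vec x = dim_row (gram n)" and nz: "x \<noteq> 0\<^sub>v (dim_row (gram n))"
  then have x: "dim_vec x = n" by simp
  have "x \<bullet> (gram n *\<^sub>v x) \<noteq> 0"
  proof
    assume "x \<bullet> (gram n *\<^sub>v x) = 0"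
    from gram_form_zero[OF x this] have "\<forall>k<n. (C * A ^\<^sub>m k) *\<^sub>v x = 0\<^sub>v (dim_row C)"
      using x by (simp add: mult_mat_vec_assoc_dim)
    then have "x = 0\<^sub>v n" using obs x unfolding observable_def by (metis carrier_vecI)
    then show False using nz by simp
  qed
  then show "0 < x \<bullet> (gram n *\<^sub>v x)" using psd_mat_nonneg[OF gram_psd, of x n] x by simp
qed (use psd_mat_transpose[OF gram_psd] in simp_all)

text \<open>\<open>z\<^sup>T P\<^sub>t z\<close> is the value of a linear-quadratic problem for the dual system \<open>z' = A\<^sup>T z - C\<^sup>T u\<close>. By
  observability any \<open>z\<close> can be steered to \<open>0\<close> in \<open>n\<close> steps, with controls linear in \<open>z\<close>,
  so the value is bounded independently of the horizon.\<close>

lemma prior_bounded: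
  assumes obs: "observable n A C" and X: "cov X"
  shows "\<exists>m. \<forall>t. op_bound (prior X t) m"
proof -
  define B where "B = A\<^sup>T"
  have Bd [simp]: "dim_row B = n" "dim_col B = n" by (simp_all add: B_def)
  define G where "G = mat_inv (gram n)"
  note Ginv = mat_inv_pd[OF gram_pd[OF obs], folded G_def]
  have Gd [simp]: "dim_row G = n" "dim_col G = n" using Ginv by simp_all
  \<comment> \<open>Minimum-energy steering to the origin: \<open>U j\<close> maps the initial dual
    state to the control at step \<open>j\<close>, and \<open>Z j\<close> maps it to the state
    before that step. \<open>Z 0\<close> is the identity since \<open>gram 0 = 0\<close>, and
    \<open>Z n = 0\<close> since \<open>G\<close> inverts \<open>gram n\<close>.\<close>
  define H where "H = G * B ^\<^sub>m n"
  have Hd [simp]: "dim_row H = n" "dim_col H = n" by (simp_all add: H_def)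
  define Z where "Z j = B ^\<^sub>m j - gram j * (A ^\<^sub>m (n - j) * H)" for j
  define U where "U j = C * (A ^\<^sub>m (n - Suc j) * H)" for j
  have Zd [simp]: "dim_row (Z j) = n" "dim_col (Z j) = n" for j by (simp_all add: Z_def)
  have Ud [simp]: "dim_row (U j) = p" "dim_col (U j) = n" for j by (simp_all add: U_def)
  have Z0: "Z 0 *\<^sub>v z = z" if "dim_vec z = n" for z
    using that by (intro eq_vecI) (simp_all add: Z_def mat_vec_simps)
  have Zn: "Z n *\<^sub>v z = 0\<^sub>v n" if z: "dim_vec z = n" for z :: "real vec"
  proof -
    have "gram n *\<^sub>v (G *\<^sub>v y) = y" if "dim_vec y = n" for y
      using that Ginv(3) by (simp flip: mult_mat_vec_assoc_dim add: one_mult_mat_vec_dim)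
    then show ?thesis using z by (intro eq_vecI) (simp_all add: Z_def H_def mat_vec_simps)
  qed
  have step: "Z (Suc j) *\<^sub>v z = A\<^sup>T *\<^sub>v (Z j *\<^sub>v z) - C\<^sup>T *\<^sub>v (U j *\<^sub>v z)" if j: "j < n" and z: "dim_vec z = n" for j and z :: "real vec"
  proof -
    define y where "y = A ^\<^sub>m (n - Suc j) *\<^sub>v (H *\<^sub>v z)"
    have y [simp]: "dim_vec y = n" by (simp add: y_def)
    have A1: "A ^\<^sub>m 1 = A" "B ^\<^sub>m 1 = B" by (simp_all add: left_mult_one_mat[of _ n n] carrier_matI)
    have "n - j = 1 + (n - Suc j)" using j by simp
    then have "A ^\<^sub>m (n - j) = A * A ^\<^sub>m (n - Suc j)" using pow_mat_add[of A n 1 "n - Suc j"] A1 by simp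
    then have Ay: "(A ^\<^sub>m (n - j) * H) *\<^sub>v z = A *\<^sub>v y" using z by (simp add: y_def mat_vec_simps)
    have "B ^\<^sub>m Suc j = B * B ^\<^sub>m j" using pow_mat_add[of B n 1 j] A1 by simp
    then have "Z (Suc j) *\<^sub>v z = B *\<^sub>v (B ^\<^sub>m j *\<^sub>v z) - gram (Suc j) *\<^sub>v y"
      using z by (simp add: Z_def y_def mat_vec_simps del: pow_mat.simps gram.simps)
    also have "gram (Suc j) *\<^sub>v y = C\<^sup>T *\<^sub>v (C *\<^sub>v y) + B *\<^sub>v (gram j *\<^sub>v (A *\<^sub>v y))"
      unfolding B_def by (rule gram_Suc_vec) simp
    also have "C *\<^sub>v y = U j *\<^sub>v z" using z by (simp add: U_def y_def mat_vec_simps)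
    also have "B *\<^sub>v (B ^\<^sub>m j *\<^sub>v z) - (C\<^sup>T *\<^sub>v (U j *\<^sub>v z) + B *\<^sub>v (gram j *\<^sub>v (A *\<^sub>v y))) =
        B *\<^sub>v (B ^\<^sub>m j *\<^sub>v z - gram j *\<^sub>v (A *\<^sub>v y)) - C\<^sup>T *\<^sub>v (U j *\<^sub>v z)"
      using z by (simp add: mult_mat_vec_diff_dim) (intro eq_vecI, simp_all)
    also have "B ^\<^sub>m j *\<^sub>v z - gram j *\<^sub>v (A *\<^sub>v y) = Z j *\<^sub>v z"
      using z Ay by (simp add: Z_def minus_mat_mult_vec_dim mult_mat_vec_assoc_dim[of "gram j"])
    finally show ?thesis by (simp add: B_def)
  qed
  obtain cZ cU where cZ: "\<And>j. j < n \<Longrightarrow> op_bound (Z j) cZ" and cU: "\<And>j. j < n \<Longrightarrow> op_bound (U j) cU"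
    using op_bound_uniform_finite[of n Z] op_bound_uniform_finite[of n U] by blast
  obtain cR cQ where cR: "op_bound R cR" and cQ: "op_bound Q cQ" using op_bound_exists by blast
  define \<gamma> where "\<gamma> = cR * cU\<^sup>2 + cQ * cZ\<^sup>2"
  have \<gamma>: "0 \<le> \<gamma>" using op_bound_nonneg[OF cR] op_bound_nonneg[OF cQ] by (simp add: \<gamma>_def)
  define J where "J t z = z \<bullet> (prior X t *\<^sub>v z)" for t z
  \<comment> \<open>Covariance index and control index run in opposite directions: a step of the
    dual system consumes one Riccati step.\<close>
  have descend: "J (Suc t) (Z j *\<^sub>v z) \<le> J t (Z (Suc j) *\<^sub>v z) + \<gamma> * (z \<bullet> z)" if "j < n" "dim_vec z = n" for j z t
  proof -
    have "J (Suc t) (Z j *\<^sub>v z) \<le> J t (Z (Suc j) *\<^sub>v z) + (U j *\<^sub>v z) \<bullet> (R *\<^sub>v (U j *\<^sub>v z))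
        + (Z j *\<^sub>v z) \<bullet> (Q *\<^sub>v (Z j *\<^sub>v z))"
      unfolding J_def kf_prior_Suc step[OF that] by (rule riccati_le[OF prior_cov[OF X]]) simp_all
    moreover have "(U j *\<^sub>v z) \<bullet> (R *\<^sub>v (U j *\<^sub>v z)) \<le> cR * (cU\<^sup>2 * (z \<bullet> z))"
      using that by (intro order_trans[OF op_bound_form_le[OF cR, of p]] mult_left_mono
          sprod_self_le_power2 cU op_bound_nonneg[OF cR]) simp_all
    moreover have "(Z j *\<^sub>v z) \<bullet> (Q *\<^sub>v (Z j *\<^sub>v z)) \<le> cQ * (cZ\<^sup>2 * (z \<bullet> z))"
      using that by (intro order_trans[OF op_bound_form_le[OF cQ, of n]] mult_left_mono
          sprod_self_le_power2 cZ op_bound_nonneg[OF cQ]) simp_all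
    ultimately show ?thesis by (simp add: \<gamma>_def algebra_simps)
  qed
  have iterate: "J (t + j) z \<le> J t (Z j *\<^sub>v z) + real j * \<gamma> * (z \<bullet> z)" if "j \<le> n" "dim_vec z = n" for j z t
    using that
  proof (induction j arbitrary: t)
    case 0
    then show ?case by (simp add: Z0)
  next
    case (Suc j)
    then show ?case using Suc.IH[of "Suc t"] descend[of j z t] by (simp add: algebra_simps)
  qed
  have large: "op_bound (prior X (t + n)) (real n * \<gamma>)" for t
  proof (rule psd_op_bound[OF cov_psd[OF prior_cov[OF X]]])
    fix z :: "real vec" assume "dim_vec z = dim_row (prior X (t + n))"
    then have z: "dim_vec z = n" using cov_dim(1)[OF prior_cov[OF X]] by metis
    \<comment> \<open>The state has reached 0, so nothing of \<open>prior X t\<close> is left in the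
      bound and it is uniform in \<open>t\<close>.\<close>
    have "J t (Z n *\<^sub>v z) = 0" using cov_dim[OF prior_cov[OF X, of t]] by (simp add: Zn[OF z] J_def sprod_zero_vec)
    then show "z \<bullet> (prior X (t + n) *\<^sub>v z) \<le> real n * \<gamma> * (z \<bullet> z)"
      using iterate[of n z t] z by (simp add: J_def)
  qed (use \<gamma> in simp)
  obtain c0 where c0: "\<And>t. t < n \<Longrightarrow> op_bound (prior X t) c0"
    using op_bound_uniform_finite[of n "prior X"] by blast
  have "op_bound (prior X t) (max c0 (real n * \<gamma>))" for t
  proof (cases "t < n")
    case True
    then show ?thesis using op_bound_mono[OF c0] by simp
  next
    case False
    then show ?thesis using op_bound_mono[OF large[of "t - n"]] by simp
  qed
  then show ?thesis by blast
qed

text \<open>State transition matrix of the closed loop from time \<open>s\<close> to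
  \<open>s + k\<close>, latest factor on the left. The start is a parameter because variation of
  constants needs propagation from every input time.\<close>

fun trans :: "real mat \<Rightarrow> nat \<Rightarrow> nat \<Rightarrow> real mat" where
  "trans X s 0 = 1\<^sub>m n"
| "trans X s (Suc k) = closed (prior X (s + k)) * trans X s k"

lemma trans_dim [simp]: "cov X \<Longrightarrow> dim_row (trans X s k) = n" "cov X \<Longrightarrow> dim_col (trans X s k) = n"
  by (induction k) (simp_all add: prior_cov)

text \<open>The Lyapunov function \<open>z\<^sup>T P\<^sub>t z + N(z)\<^sup>2 / \<beta>\<close> of the adjoint closed loop combines the Riccati
  solution, whose decrease controls only \<open>Q z\<close> and the gain, with an adapted norm \<open>N\<close> of
  the stabilized matrix \<open>(A + Q\<^sup>1\<^sup>/\<^sup>2 K)\<^sup>T\<close>, which turns this control into contraction.\<close>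

lemma trans_exponentially_stable:
  assumes obs: "observable n A C" and stab: "stabilizable A (mat_sqrt Q)" and X: "cov X"
  shows "\<exists>c \<rho>. 0 \<le> c \<and> 0 < \<rho> \<and> \<rho> < 1 \<and> (\<forall>s k. op_bound (trans X s k) (c * \<rho> ^ k))"
proof -
  define S where "S = mat_sqrt Q"
  note S = mat_sqrt_psd[OF psd_Q, folded S_def]
  have Sd [simp]: "dim_row S = n" "dim_col S = n" using S by simp_all
  obtain K where K: "K \<in> carrier_mat n n" and stable: "schur_stable (A + S * K)"
    using stab unfolding stabilizable_def S_def[symmetric] by auto
  have Kd [simp]: "dim_row K = n" "dim_col K = n" using K by auto
  have AK: "A + S * K \<in> carrier_mat n n" by (intro carrier_matI) simp_all
  define M where "M = (A + S * K)\<^sup>T"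
  have Mc: "M \<in> carrier_mat n n" unfolding M_def by (intro carrier_matI) simp_all
  obtain c0 r0 where r0: "0 < r0" "r0 < 1" "0 \<le> c0" and pow: "\<And>k. op_bound ((A + S * K) ^\<^sub>m k) (c0 * r0 ^ k)"
    using schur_stable_power_bound[OF AK stable] by blast
  have powM: "op_bound (M ^\<^sub>m k) (c0 * r0 ^ k)" for k
    unfolding M_def pow_mat_transpose[OF AK] by (rule op_bound_transpose[OF pow])
  obtain N \<sigma> d where \<sigma>: "0 < \<sigma>" "\<sigma> < 1"
    and N: "\<forall>v. dim_vec v = n \<longrightarrow> vnorm v \<le> N v" "\<forall>v. dim_vec v = n \<longrightarrow> N v \<le> d * vnorm v"
      "\<forall>u v. dim_vec u = n \<longrightarrow> dim_vec v = n \<longrightarrow> N (u + v) \<le> N u + N v"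
      "\<forall>v. dim_vec v = n \<longrightarrow> N (M *\<^sub>v v) \<le> \<sigma> * N v"
    using adapted_norm[OF Mc r0 powM] by blast
  note N_ge = N(1)[rule_format] and N_le = N(2)[rule_format] and N_add = N(3)[rule_format]
    and N_M = N(4)[rule_format]
  have N_nonneg: "0 \<le> N v" if "dim_vec v = n" for v using N_ge[OF that] vnorm_nonneg[of v] by linarith
  obtain r where r: "r > 0" "\<And>x. dim_vec x = p \<Longrightarrow> r * (x \<bullet> x) \<le> x \<bullet> (R *\<^sub>v x)"
    using pd_lower_bound[OF pd_R] by auto
  obtain cK where cK: "op_bound (K\<^sup>T) cK" using op_bound_exists by blast
  obtain cC where cC: "op_bound (C\<^sup>T) cC" using op_bound_exists by blast
  obtain m where m: "\<And>t. op_bound (prior X t) m" using prior_bounded[OF obs X] by blast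
  have m0: "0 \<le> m" using op_bound_nonneg[OF m[of 0]] .
  \<comment> \<open>\<open>b\<close> is the constant in
    \<open>(d * vnorm e)\<^sup>2 \<le> b * w\<close> below. After convexity the error is at most
    \<open>b * w / (1 - \<sigma>)\<close>, so this \<open>\<beta>\<close> makes it at most
    \<open>w\<close> once divided by \<open>\<beta>\<close>; the added 1 keeps
    \<open>\<beta>\<close> positive.\<close>
  define b where "b = 2 * d\<^sup>2 * (cK\<^sup>2 + cC\<^sup>2 / r)"
  define \<beta> where "\<beta> = b / (1 - \<sigma>) + 1"
  have b0: "0 \<le> b" using r by (simp add: b_def)
  have \<beta>: "\<beta> > 0" using b0 \<sigma> by (simp add: \<beta>_def add_nonneg_pos)
  define V where "V t z = z \<bullet> (prior X t *\<^sub>v z) + (N z)\<^sup>2 / \<beta>" for t z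
  \<comment> \<open>Since \<open>N\<close> dominates the norm, \<open>V\<close> is at most
    \<open>\<beta> * m + 1\<close> times \<open>(N z)\<^sup>2 / \<beta>\<close>. Hence the loss
    \<open>(1 - \<sigma>)\<close> of the norm part is at least the fraction \<open>\<delta>\<close>
    of all of \<open>V\<close>.\<close>
  define \<delta> where "\<delta> = (1 - \<sigma>) / (\<beta> * m + 1)"
  have bm: "\<beta> * m + 1 \<ge> 1" using \<beta> m0 by simp
  have \<delta>: "0 < \<delta>" "\<delta> < 1" using bm \<sigma> by (simp_all add: \<delta>_def divide_less_eq)
  have decrease: "V t ((closed (prior X t))\<^sup>T *\<^sub>v z) \<le> (1 - \<delta>) * V (Suc t) z" if z: "dim_vec z = n" for t z
  proof -
    note cv = prior_cov[OF X, of t]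
    define k where "k = (gain (prior X t))\<^sup>T *\<^sub>v (A\<^sup>T *\<^sub>v z)"
    define f where "f = (closed (prior X t))\<^sup>T *\<^sub>v z"
    \<comment> \<open>The mismatch between the adjoint closed loop and the stabilized
      \<open>M\<close>. It involves \<open>z\<close> only through \<open>S *\<^sub>v z\<close>,
      whose squared norm is \<open>z \<bullet> (Q *\<^sub>v z)\<close>, and through the gain term
      \<open>k\<close>, controlled by \<open>R\<close>; so \<open>w\<close> bounds its square up to
      a constant.\<close>
    define e where "e = (- 1) \<cdot>\<^sub>v (K\<^sup>T *\<^sub>v (S *\<^sub>v z) + C\<^sup>T *\<^sub>v k)"
    define w where "w = z \<bullet> (Q *\<^sub>v z) + k \<bullet> (R *\<^sub>v k)"
    have kd [simp]: "dim_vec k = p" "dim_vec f = n" "dim_vec e = n" using cv by (simp_all add: k_def f_def e_def)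
    have "M *\<^sub>v z = A\<^sup>T *\<^sub>v z + K\<^sup>T *\<^sub>v (S *\<^sub>v z)"
      using z psd_mat_transpose[OF S(1)] by (simp add: M_def transpose_add_dim transpose_mult_dim mat_vec_simps)
    then have fe: "f = M *\<^sub>v z + e"
      using closed_transpose[OF cv z] z by (intro eq_vecI) (simp_all add: f_def e_def flip: k_def)
    have SQ: "(S *\<^sub>v z) \<bullet> (S *\<^sub>v z) = z \<bullet> (Q *\<^sub>v z)"
      using z S(4) psd_mat_transpose[OF S(1)] by (simp add: sprod_adjoint[of z S] mult_mat_vec_assoc_dim flip: S(4))
    have kR: "k \<bullet> k \<le> (k \<bullet> (R *\<^sub>v k)) / r" using r(1) r(2)[of k] by (simp add: pos_le_divide_eq mult.commute)
    have "vnorm e \<le> vnorm (K\<^sup>T *\<^sub>v (S *\<^sub>v z)) + vnorm (C\<^sup>T *\<^sub>v k)"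
      by (simp add: e_def vnorm_smult vnorm_triangle)
    then have "(vnorm e)\<^sup>2 \<le> (vnorm (K\<^sup>T *\<^sub>v (S *\<^sub>v z)) + vnorm (C\<^sup>T *\<^sub>v k))\<^sup>2" by (intro power_mono) simp_all
    also have "\<dots> \<le> 2 * ((vnorm (K\<^sup>T *\<^sub>v (S *\<^sub>v z)))\<^sup>2 + (vnorm (C\<^sup>T *\<^sub>v k))\<^sup>2)"
      using sum_squares_bound[of "vnorm (K\<^sup>T *\<^sub>v (S *\<^sub>v z))" "vnorm (C\<^sup>T *\<^sub>v k)"] by (simp add: power2_sum)
    also have "\<dots> \<le> 2 * (cK\<^sup>2 * (z \<bullet> (Q *\<^sub>v z)) + cC\<^sup>2 * ((k \<bullet> (R *\<^sub>v k)) / r))"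
    proof -
      have "(vnorm (K\<^sup>T *\<^sub>v (S *\<^sub>v z)))\<^sup>2 \<le> cK\<^sup>2 * (z \<bullet> (Q *\<^sub>v z))"
        using sprod_self_le_power2[OF cK, of "S *\<^sub>v z"] SQ by (simp add: vnorm_power2)
      moreover have "(vnorm (C\<^sup>T *\<^sub>v k))\<^sup>2 \<le> cC\<^sup>2 * ((k \<bullet> (R *\<^sub>v k)) / r)"
        using order_trans[OF sprod_self_le_power2[OF cC, of k] mult_left_mono[OF kR, of "cC\<^sup>2"]] by (simp add: vnorm_power2)
      ultimately show ?thesis by simp
    qed
    also have "\<dots> \<le> 2 * ((cK\<^sup>2 + cC\<^sup>2 / r) * w)"
    proof -
      have "0 \<le> z \<bullet> (Q *\<^sub>v z)" "0 \<le> k \<bullet> (R *\<^sub>v k)"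
        using z by (simp_all add: psd_mat_nonneg[OF psd_Q] psd_mat_nonneg[OF pd_imp_psd[OF pd_R]])
      then have "0 \<le> cK\<^sup>2 * (k \<bullet> (R *\<^sub>v k))" "0 \<le> cC\<^sup>2 / r * (z \<bullet> (Q *\<^sub>v z))" using r(1) by simp_all
      then show ?thesis by (simp add: w_def algebra_simps)
    qed
    finally have "d\<^sup>2 * (vnorm e)\<^sup>2 \<le> d\<^sup>2 * (2 * ((cK\<^sup>2 + cC\<^sup>2 / r) * w))" by (intro mult_left_mono) simp_all
    then have e2: "(d * vnorm e)\<^sup>2 \<le> b * w" by (simp add: b_def power_mult_distrib algebra_simps)
    have w0: "0 \<le> w"
      using z by (simp add: w_def psd_mat_nonneg[OF psd_Q] psd_mat_nonneg[OF pd_imp_psd[OF pd_R]])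
    have "N f \<le> \<sigma> * N z + d * vnorm e"
      using N_add[of "M *\<^sub>v z" e] N_M[OF z] N_le[of e] Mc unfolding fe by simp
    then have "(N f)\<^sup>2 \<le> (\<sigma> * N z + d * vnorm e)\<^sup>2" by (rule power_mono) (simp add: N_nonneg)
    also have "\<dots> \<le> \<sigma> * (N z)\<^sup>2 + (d * vnorm e)\<^sup>2 / (1 - \<sigma>)" by (rule convex_square_le[OF \<sigma>])
    also have "(d * vnorm e)\<^sup>2 / (1 - \<sigma>) \<le> b * w / (1 - \<sigma>)" using e2 \<sigma> by (intro divide_right_mono) simp_all
    also have "\<dots> \<le> \<beta> * w" using w0 by (simp add: \<beta>_def distrib_right)
    finally have "(N f)\<^sup>2 / \<beta> \<le> (\<sigma> * (N z)\<^sup>2 + \<beta> * w) / \<beta>" using \<beta> by (intro divide_right_mono) simp_all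
    also have "\<dots> = \<sigma> * ((N z)\<^sup>2 / \<beta>) + w" using \<beta> by (simp add: field_simps)
    finally have Nf: "(N f)\<^sup>2 / \<beta> \<le> \<sigma> * ((N z)\<^sup>2 / \<beta>) + w" .
    \<comment> \<open>The Riccati form loses exactly \<open>w\<close>, which offsets the
      \<open>w\<close> in the estimate of the norm part.\<close>
    have "z \<bullet> (prior X (Suc t) *\<^sub>v z) = f \<bullet> (prior X t *\<^sub>v f) + w"
      unfolding kf_prior_Suc riccati_closed_loop[OF cv z] by (simp add: f_def k_def w_def)
    then have *: "V t f \<le> V (Suc t) z - (1 - \<sigma>) * ((N z)\<^sup>2 / \<beta>)"
      using Nf unfolding V_def left_diff_distrib by linarith
    have "z \<bullet> (prior X (Suc t) *\<^sub>v z) \<le> m * (N z)\<^sup>2"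
    proof -
      have "z \<bullet> (prior X (Suc t) *\<^sub>v z) \<le> m * (z \<bullet> z)"
        using cov_dim[OF prior_cov[OF X, of "Suc t"]] z by (intro op_bound_form_le[OF m]) 
      also have "\<dots> \<le> m * (N z)\<^sup>2"
        using power_mono[OF N_ge[OF z], of 2] m0 by (intro mult_left_mono) (simp_all add: vnorm_power2)
      finally show ?thesis .
    qed
    then have "V (Suc t) z \<le> (\<beta> * m + 1) * ((N z)\<^sup>2 / \<beta>)" using \<beta> by (simp add: V_def field_simps)
    then have "\<delta> * V (Suc t) z \<le> \<delta> * ((\<beta> * m + 1) * ((N z)\<^sup>2 / \<beta>))" using \<delta> by (intro mult_left_mono) simp_all
    also have "\<dots> = (1 - \<sigma>) * ((N z)\<^sup>2 / \<beta>)" using bm by (simp add: \<delta>_def)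
    finally show ?thesis using * by (simp add: f_def algebra_simps)
  qed
  \<comment> \<open>Transposition reverses the product, so the latest closed loop acts first and
    \<open>V\<close> is followed backwards from time \<open>s + k\<close> to
    \<open>s\<close>.\<close>
  have V_trans: "V s ((trans X s k)\<^sup>T *\<^sub>v z) \<le> (1 - \<delta>) ^ k * V (s + k) z" if "dim_vec z = n" for s k z
    using that
  proof (induction k arbitrary: z)
    case 0
    then show ?case by (simp add: one_mult_mat_vec_dim)
  next
    case (Suc k)
    let ?f = "(closed (prior X (s + k)))\<^sup>T *\<^sub>v z"
    have cv: "cov (prior X (s + k))" using prior_cov[OF X] .
    have "(trans X s (Suc k))\<^sup>T *\<^sub>v z = (trans X s k)\<^sup>T *\<^sub>v ?f"
      using X cv Suc.prems by (simp add: transpose_mult_dim mult_mat_vec_assoc_dim)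
    then have "V s ((trans X s (Suc k))\<^sup>T *\<^sub>v z) \<le> (1 - \<delta>) ^ k * V (s + k) ?f"
      using Suc.IH[of ?f] cv by simp
    also have "\<dots> \<le> (1 - \<delta>) ^ k * ((1 - \<delta>) * V (Suc (s + k)) z)"
      using \<delta> by (intro mult_left_mono decrease[OF Suc.prems]) simp
    finally show ?case by (simp add: mult_ac)
  qed
  \<comment> \<open>\<open>V\<close> is quadratic, so norms contract with the square root of its
    factor. The constant \<open>c\<close> below comes from
    \<open>V \<le> m + d\<^sup>2 / \<beta>\<close> on unit vectors, multiplied by
    \<open>\<beta>\<close>.\<close>
  define \<rho> where "\<rho> = sqrt (1 - \<delta>)"
  have \<rho>: "0 < \<rho>" "\<rho> < 1" using \<delta> by (simp_all add: \<rho>_def)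
  define c where "c = sqrt (\<beta> * m + d\<^sup>2)"
  have c: "0 \<le> c" using \<beta> m0 by (simp add: c_def)
  have "op_bound (trans X s k)\<^sup>T (c * \<rho> ^ k)" for s k
  proof (rule op_boundI)
    show "0 \<le> c * \<rho> ^ k" using c \<rho> by simp
    fix z :: "real vec" assume "dim_vec z = dim_col (trans X s k)\<^sup>T"
    then have z: "dim_vec z = n" using X by simp
    let ?x = "(trans X s k)\<^sup>T *\<^sub>v z"
    have x: "dim_vec ?x = n" using X by simp
    have "(N ?x)\<^sup>2 / \<beta> \<le> V s ?x"
      using psd_mat_nonneg[OF cov_psd[OF prior_cov[OF X]], of ?x s] cov_dim[OF prior_cov[OF X, of s]] x by (simp add: V_def)
    also have "\<dots> \<le> (1 - \<delta>) ^ k * V (s + k) z" by (rule V_trans[OF z])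
    also have "V (s + k) z \<le> m * (z \<bullet> z) + (d * vnorm z)\<^sup>2 / \<beta>"
      unfolding V_def
    proof (rule add_mono)
      show "z \<bullet> (prior X (s + k) *\<^sub>v z) \<le> m * (z \<bullet> z)"
        using cov_dim[OF prior_cov[OF X, of "s + k"]] z by (intro op_bound_form_le[OF m])
      show "(N z)\<^sup>2 / \<beta> \<le> (d * vnorm z)\<^sup>2 / \<beta>"
        using \<beta> N_le[OF z] N_nonneg[OF z] by (intro divide_right_mono power_mono) simp_all
    qed
    finally have "(N ?x)\<^sup>2 \<le> \<beta> * ((1 - \<delta>) ^ k * (m * (z \<bullet> z) + (d * vnorm z)\<^sup>2 / \<beta>))"
      using \<beta> \<delta> by (simp add: pos_divide_le_eq mult.commute)
    also have "\<dots> = (\<beta> * m + d\<^sup>2) * (1 - \<delta>) ^ k * (vnorm z)\<^sup>2"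
      using \<beta> by (simp add: field_simps vnorm_power2)
    also have "\<dots> = (c * \<rho> ^ k * vnorm z)\<^sup>2"
    proof -
      have "c\<^sup>2 = \<beta> * m + d\<^sup>2" using \<beta> m0 by (simp add: c_def)
      moreover have "(\<rho> ^ k)\<^sup>2 = (1 - \<delta>) ^ k" using \<delta> by (simp add: \<rho>_def power_mult[symmetric] mult.commute[of k 2]) (simp add: power_mult)
      ultimately show ?thesis by (simp add: power_mult_distrib)
    qed
    finally have "N ?x \<le> c * \<rho> ^ k * vnorm z" using c \<rho> by (intro power2_le_imp_le[of "N ?x"]) simp_all
    then show "vnorm ?x \<le> c * \<rho> ^ k * vnorm z" using N_ge[OF x] by linarith
  qed
  then have "op_bound (trans X s k) (c * \<rho> ^ k)" for s k
    using op_bound_transpose by fastforce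
  then show ?thesis using c \<rho> by blast
qed

end

section \<open>Coefficients of the predictor\<close>

text \<open>The columns are the images of unit vectors. Induction over the truncations
  \<open>w k\<close> of \<open>v\<close> reconstructs \<open>f v\<close> entry by entry, without
  finite sums of vectors.\<close>

lemma linear_map_eq_mat:
  fixes f :: "real vec \<Rightarrow> real vec"
  assumes dim: "\<And>v. dim_vec v = N \<Longrightarrow> dim_vec (f v) = n"
    and add: "\<And>u v. dim_vec u = N \<Longrightarrow> dim_vec v = N \<Longrightarrow> f (u + v) = f u + f v"
    and smult: "\<And>c v. dim_vec v = N \<Longrightarrow> f (c \<cdot>\<^sub>v v) = c \<cdot>\<^sub>v f v"
  shows "\<exists>M. dim_row M = n \<and> dim_col M = N \<and> (\<forall>v. dim_vec v = N \<longrightarrow> f v = M *\<^sub>v v)"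
proof (intro exI conjI allI impI)
  let ?M = "mat n N (\<lambda>(i, j). f (unit_vec N j) $ i)"
  fix v :: "real vec" assume v: "dim_vec v = N"
  define w where "w k = vec N (\<lambda>i. if i < k then v $ i else 0)" for k
  have w [simp]: "dim_vec (w k) = N" for k by (simp add: w_def)
  have part: "f (w k) $ i = (\<Sum>j<k. f (unit_vec N j) $ i * v $ j)" if "k \<le> N" "i < n" for k i
    using that(1)
  proof (induction k)
    case 0
    have "w 0 = 0 \<cdot>\<^sub>v w 0" by (intro eq_vecI) (simp_all add: w_def)
    then have "f (w 0) = 0 \<cdot>\<^sub>v f (w 0)" using smult[of "w 0" 0] by simp
    then show ?case using dim[of "w 0"] that(2) by (metis index_smult_vec(1) lessThan_0 mult_zero_left sum.empty w)
  next
    case (Suc k)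
    have "w (Suc k) = w k + (v $ k) \<cdot>\<^sub>v unit_vec N k"
      using Suc.prems by (intro eq_vecI) (auto simp: w_def unit_vec_def less_Suc_eq)
    then have "f (w (Suc k)) = f (w k) + (v $ k) \<cdot>\<^sub>v f (unit_vec N k)" by (simp add: add smult)
    then show ?case using Suc that(2) dim[of "unit_vec N k"] by simp
  qed
  have "w N = v" using v by (intro eq_vecI) (simp_all add: w_def)
  then show "f v = ?M *\<^sub>v v"
    using part[of N] v dim[OF v] by (intro eq_vecI) (simp_all add: scalar_prod_def atLeast0LessThan)
qed simp_all

lemma vnorm_slice:
  assumes "k + m \<le> dim_vec d"
  shows "vnorm (vec m (\<lambda>i. d $ (k + i))) \<le> vnorm d"
proof -
  have "(\<Sum>i = 0..<m. (d $ (k + i))\<^sup>2) = (\<Sum>i = 0 + k..<m + k. (d $ i)\<^sup>2)"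
    by (subst sum.shift_bounds_nat_ivl) (simp add: add.commute)
  also have "\<dots> \<le> (\<Sum>i = 0..<dim_vec d. (d $ i)\<^sup>2)" using assms by (intro sum_mono2) auto
  finally show ?thesis by (simp add: vnorm_L2_set L2_set_def)
qed

context kalman_filter
begin

section \<open>Linearity of the predictor in mean and data\<close>

abbreviation xpred where "xpred B X mu us ys t \<equiv> kf_xpred A B C Q R X mu us ys t"

lemma xpred_dim [simp]: "dim_row B = n \<Longrightarrow> dim_vec mu = n \<Longrightarrow> dim_vec (xpred B X mu us ys t) = n"
  by (cases t) (simp_all add: Let_def)

lemma xpred_cong:
  "(\<And>i. i < t \<Longrightarrow> us i = us' i) \<Longrightarrow> (\<And>i. i < t \<Longrightarrow> ys i = ys' i) \<Longrightarrow>
    xpred B X mu us ys t = xpred B X mu us' ys' t"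
  by (induction t) (simp_all add: Let_def)

declare kf_xpred.simps(2) [simp del]

lemma xpred_Suc:
  assumes X: "cov X" and "dim_row B = n" "dim_vec mu = n" "dim_vec (ys t) = p" "dim_vec (us t) = dim_col B"
  shows "xpred B X mu us ys (Suc t) = closed (prior X t) *\<^sub>v xpred B X mu us ys t
    + (A *\<^sub>v (gain (prior X t) *\<^sub>v ys t) + B *\<^sub>v us t)"
proof -
  have cv: "cov (prior X t)" using prior_cov[OF X] .
  have "xpred B X mu us ys (Suc t) = A *\<^sub>v (xpred B X mu us ys t + gain (prior X t) *\<^sub>v (ys t - C *\<^sub>v xpred B X mu us ys t))
      + B *\<^sub>v us t"
    by (simp add: kf_xpred.simps(2) Let_def gain_def)
  also have "\<dots> = closed (prior X t) *\<^sub>v xpred B X mu us ys t + (A *\<^sub>v (gain (prior X t) *\<^sub>v ys t) + B *\<^sub>v us t)"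
    using assms cv by (simp add: closed_def corr_def mat_vec_simps) (intro eq_vecI, simp_all)
  finally show ?thesis .
qed

text \<open>Joint linearity in mean, inputs and outputs: one statement supplies additivity and
  homogeneity in the data as well as the separation of the data from the mean.\<close>

lemma xpred_superpose:
  assumes X: "cov X" and B: "dim_row B = n" "dim_col B = m" and mu: "dim_vec mu = n" "dim_vec mu' = n"
    and u: "\<And>i. i < t \<Longrightarrow> dim_vec (us i) = m" "\<And>i. i < t \<Longrightarrow> dim_vec (us' i) = m"
    and y: "\<And>i. i < t \<Longrightarrow> dim_vec (ys i) = p" "\<And>i. i < t \<Longrightarrow> dim_vec (ys' i) = p"
  shows "xpred B X (mu + a \<cdot>\<^sub>v mu') (\<lambda>i. us i + a \<cdot>\<^sub>v us' i) (\<lambda>i. ys i + a \<cdot>\<^sub>v ys' i) t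
    = xpred B X mu us ys t + a \<cdot>\<^sub>v xpred B X mu' us' ys' t"
  using u y
proof (induction t)
  case (Suc t)
  have cv: "cov (prior X t)" using prior_cov[OF X] .
  let ?x = "xpred B X mu us ys t" and ?x' = "xpred B X mu' us' ys' t"
  let ?U = "\<lambda>i. us i + a \<cdot>\<^sub>v us' i" and ?Y = "\<lambda>i. ys i + a \<cdot>\<^sub>v ys' i"
  have d: "dim_vec (us t) = m" "dim_vec (us' t) = m" "dim_vec (ys t) = p" "dim_vec (ys' t) = p"
    using Suc.prems by simp_all
  have "xpred B X (mu + a \<cdot>\<^sub>v mu') ?U ?Y (Suc t) = closed (prior X t) *\<^sub>v (?x + a \<cdot>\<^sub>v ?x')
      + (A *\<^sub>v (gain (prior X t) *\<^sub>v ?Y t) + B *\<^sub>v ?U t)"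
    using xpred_Suc[OF X B(1), of "mu + a \<cdot>\<^sub>v mu'" ?Y t ?U] Suc d mu B by simp
  also have "\<dots> = (closed (prior X t) *\<^sub>v ?x + (A *\<^sub>v (gain (prior X t) *\<^sub>v ys t) + B *\<^sub>v us t))
      + a \<cdot>\<^sub>v (closed (prior X t) *\<^sub>v ?x' + (A *\<^sub>v (gain (prior X t) *\<^sub>v ys' t) + B *\<^sub>v us' t))"
    using cv B d mu by (simp add: mult_mat_vec_add_dim mult_mat_vec_smult_dim) (intro eq_vecI, simp_all add: algebra_simps)
  also have "\<dots> = xpred B X mu us ys (Suc t) + a \<cdot>\<^sub>v xpred B X mu' us' ys' (Suc t)"
    using xpred_Suc[OF X B(1), of mu ys t us] xpred_Suc[OF X B(1), of mu' ys' t us'] d mu B by simp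
  finally show ?case .
qed simp

text \<open>Without data the recursion is homogeneous, which identifies the coefficient of the mean,
  \<open>kf_psi\<close>, as a transition matrix.\<close>

lemma xpred_zero_data:
  assumes X: "cov X" and B: "dim_row B = n" "dim_col B = m" and mu: "dim_vec mu = n"
  shows "xpred B X mu (\<lambda>_. 0\<^sub>v m) (\<lambda>_. 0\<^sub>v p) t = trans X 0 t *\<^sub>v mu"
proof (induction t)
  case 0
  then show ?case using mu by (simp add: one_mult_mat_vec_dim)
next
  case (Suc t)
  have cv: "cov (prior X t)" using prior_cov[OF X] .
  have "xpred B X mu (\<lambda>_. 0\<^sub>v m) (\<lambda>_. 0\<^sub>v p) (Suc t) = closed (prior X t) *\<^sub>v (trans X 0 t *\<^sub>v mu)
      + (A *\<^sub>v (gain (prior X t) *\<^sub>v 0\<^sub>v p) + B *\<^sub>v 0\<^sub>v m)"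
    using xpred_Suc[OF X B(1), of mu "\<lambda>_. 0\<^sub>v p" t "\<lambda>_. 0\<^sub>v m"] mu B Suc by simp
  also have "\<dots> = closed (prior X t) *\<^sub>v (trans X 0 t *\<^sub>v mu)"
    using cv B mu X by (simp add: mult_mat_zero_vec) (intro eq_vecI, simp_all)
  also have "\<dots> = trans X 0 (Suc t) *\<^sub>v mu" using cv X mu by (simp add: mult_mat_vec_assoc_dim)
  finally show ?case .
qed

end

text \<open>Together with \<open>y_block\<close> the inverse of \<open>stack_data\<close>: an
  arbitrary vector of the right length is read as input and output data, so that the coefficient
  matrix can be tested on it.\<close>

definition u_block :: "nat \<Rightarrow> real vec \<Rightarrow> nat \<Rightarrow> real vec" where
  "u_block m d i = vec m (\<lambda>k. d $ (i * m + k))"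

definition y_block :: "nat \<Rightarrow> nat \<Rightarrow> nat \<Rightarrow> real vec \<Rightarrow> nat \<Rightarrow> real vec" where
  "y_block m p T d i = vec p (\<lambda>k. d $ (T * m + i * p + k))"

lemma block_dim [simp]: "dim_vec (u_block m d i) = m" "dim_vec (y_block m p T d i) = p"
  by (simp_all add: u_block_def y_block_def)

lemma block_index_less: "i < T \<Longrightarrow> k < m \<Longrightarrow> i * m + k < T * m" for i k m T :: nat
  by (metis div_less_iff_less_mult div_mult_self3 div_less add.right_neutral gr_implies_not0 neq0_conv)

lemma block_le: "i < T \<Longrightarrow> i * m + m \<le> T * m" for i m T :: nat
  by (metis Suc_leI add.commute mult_Suc mult_le_mono1)

lemma block_vnorm_le:
  assumes "dim_vec d = T * m + T * p" "i < T"
  shows "vnorm (u_block m d i) \<le> vnorm d" "vnorm (y_block m p T d i) \<le> vnorm d"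
  unfolding u_block_def y_block_def
  using block_le[OF assms(2), of m] block_le[OF assms(2), of p] assms(1) by (intro vnorm_slice; simp)+

lemma stack_blocks:
  assumes d: "dim_vec d = T * m + T * p"
  shows "stack_data m p T (u_block m d) (y_block m p T d) = d"
proof (rule eq_vecI)
  fix i assume "i < dim_vec d"
  then have i: "i < T * m + T * p" using d by simp
  show "stack_data m p T (u_block m d) (y_block m p T d) $ i = d $ i"
  proof (cases "i < T * m")
    case True
    then have "m > 0" by (cases m) auto
    then show ?thesis using True i by (simp add: stack_data_def u_block_def)
  next
    case False
    then have "p > 0" using i by (cases p) auto
    then show ?thesis using False i by (simp add: stack_data_def y_block_def)
  qed
qed (use d in \<open>simp add: stack_data_def\<close>)

lemma blocks_stack:
  assumes "i < T" "dim_vec (us i) = m" "dim_vec (ys i) = p"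
  shows "u_block m (stack_data m p T us ys) i = us i" "y_block m p T (stack_data m p T us ys) i = ys i"
proof -
  show "u_block m (stack_data m p T us ys) i = us i"
  proof (rule eq_vecI)
    fix k assume "k < dim_vec (us i)"
    then have k: "k < m" using assms by simp
    then have "i * m + k < T * m" by (rule block_index_less[OF assms(1)])
    then show "u_block m (stack_data m p T us ys) i $ k = us i $ k"
      using k by (simp add: u_block_def stack_data_def)
  qed (use assms in simp)
  show "y_block m p T (stack_data m p T us ys) i = ys i"
  proof (rule eq_vecI)
    fix k assume "k < dim_vec (ys i)"
    then have k: "k < p" using assms by simp
    then have "i * p + k < T * p" by (rule block_index_less[OF assms(1)])
    then show "y_block m p T (stack_data m p T us ys) i $ k = ys i $ k"
      using k by (simp add: y_block_def stack_data_def)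
  qed (use assms in simp)
qed

lemma blocks_lincomb:
  assumes "dim_vec d = T * m + T * p" "dim_vec d' = T * m + T * p" "i < T"
  shows "u_block m (d + a \<cdot>\<^sub>v d') i = u_block m d i + a \<cdot>\<^sub>v u_block m d' i"
    "y_block m p T (d + a \<cdot>\<^sub>v d') i = y_block m p T d i + a \<cdot>\<^sub>v y_block m p T d' i"
proof -
  have "i * m + k < T * m + T * p" if "k < m" for k using block_index_less[OF assms(3) that] by simp
  then show "u_block m (d + a \<cdot>\<^sub>v d') i = u_block m d i + a \<cdot>\<^sub>v u_block m d' i"
    using assms by (intro eq_vecI) (simp_all add: u_block_def)
  have "T * m + i * p + k < T * m + T * p" if "k < p" for k using block_index_less[OF assms(3) that] by simp
  then show "y_block m p T (d + a \<cdot>\<^sub>v d') i = y_block m p T d i + a \<cdot>\<^sub>v y_block m p T d' i"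
    using assms by (intro eq_vecI) (simp_all add: y_block_def)
qed

context kalman_filter
begin

text \<open>Existence follows from linearity in the data, uniqueness from testing with zero mean and
  with zero data. The last conjunct is the handle for estimates: the data coefficient acts by
  running the filter from zero mean.\<close>

lemma kf_coeffs_characterization:
  assumes X: "cov X" and B: "dim_row B = n" "dim_col B = m"
  shows "\<exists>Th. dim_row Th = n \<and> dim_col Th = T * m + T * p \<and>
    kf_coeffs n m p A B C Q R X T = (Th, trans X 0 T) \<and>
    (\<forall>d. dim_vec d = T * m + T * p \<longrightarrow> Th *\<^sub>v d = xpred B X (0\<^sub>v n) (u_block m d) (y_block m p T d) T)"
proof -
  let ?N = "T * m + T * p"
  define f where "f d = xpred B X (0\<^sub>v n) (u_block m d) (y_block m p T d) T" for d
  have lin: "f (d + a \<cdot>\<^sub>v d') = f d + a \<cdot>\<^sub>v f d'" if "dim_vec d = ?N" "dim_vec d' = ?N" for a d d'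
  proof -
    have "f (d + a \<cdot>\<^sub>v d') = xpred B X (0\<^sub>v n + a \<cdot>\<^sub>v 0\<^sub>v n)
        (\<lambda>i. u_block m d i + a \<cdot>\<^sub>v u_block m d' i) (\<lambda>i. y_block m p T d i + a \<cdot>\<^sub>v y_block m p T d' i) T"
    proof -
      have "0\<^sub>v n = 0\<^sub>v n + a \<cdot>\<^sub>v 0\<^sub>v n" by (intro eq_vecI) simp_all
      then show ?thesis unfolding f_def
        using xpred_cong[of T "u_block m (d + a \<cdot>\<^sub>v d')" "\<lambda>i. u_block m d i + a \<cdot>\<^sub>v u_block m d' i"
          "y_block m p T (d + a \<cdot>\<^sub>v d')" "\<lambda>i. y_block m p T d i + a \<cdot>\<^sub>v y_block m p T d' i" B X "0\<^sub>v n"]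
          blocks_lincomb[OF that] by simp
    qed
    also have "\<dots> = f d + a \<cdot>\<^sub>v f d'" unfolding f_def by (rule xpred_superpose[OF X B]) simp_all
    finally show ?thesis .
  qed
  have f_dim: "dim_vec (f d) = n" for d using B by (simp add: f_def)
  have f0: "f (0\<^sub>v ?N) = 0\<^sub>v n"
  proof -
    \<comment> \<open>Only affine combinations are known to be respected so far; with coefficient -1
      they give \<open>f 0\<close> as \<open>f 0\<close> minus itself.\<close>
    have "(0\<^sub>v ?N :: real vec) = 0\<^sub>v ?N + (-1) \<cdot>\<^sub>v 0\<^sub>v ?N" by (intro eq_vecI) simp_all
    then have *: "f (0\<^sub>v ?N) = f (0\<^sub>v ?N) + (-1) \<cdot>\<^sub>v f (0\<^sub>v ?N)" using lin[of "0\<^sub>v ?N" "0\<^sub>v ?N" "-1"] by simp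
    show ?thesis
    proof (rule eq_vecI)
      fix i assume "i < dim_vec (0\<^sub>v n :: real vec)"
      then show "f (0\<^sub>v ?N) $ i = 0\<^sub>v n $ i"
        using arg_cong[OF *, of "\<lambda>v. v $ i"] f_dim[of "0\<^sub>v ?N"] by simp
    qed (simp add: f_dim)
  qed
  have "\<exists>Th. dim_row Th = n \<and> dim_col Th = ?N \<and> (\<forall>d. dim_vec d = ?N \<longrightarrow> f d = Th *\<^sub>v d)"
  proof (rule linear_map_eq_mat)
    fix u v :: "real vec" assume uv: "dim_vec u = ?N" "dim_vec v = ?N"
    have "u + v = u + 1 \<cdot>\<^sub>v v" by simp
    then show "f (u + v) = f u + f v" using lin[OF uv, of 1] by simp
  next
    fix c and v :: "real vec" assume v: "dim_vec v = ?N"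
    have "c \<cdot>\<^sub>v v = 0\<^sub>v ?N + c \<cdot>\<^sub>v v" using v by (intro eq_vecI) simp_all
    then have "f (c \<cdot>\<^sub>v v) = 0\<^sub>v n + c \<cdot>\<^sub>v f v" using lin[of "0\<^sub>v ?N" v c] v f0 by simp
    then show "f (c \<cdot>\<^sub>v v) = c \<cdot>\<^sub>v f v" using f_dim[of v] by (intro eq_vecI) simp_all
  qed (rule f_dim)
  then obtain Th where Th: "dim_row Th = n" "dim_col Th = ?N" and fTh: "\<And>d. dim_vec d = ?N \<Longrightarrow> f d = Th *\<^sub>v d"
    by blast
  define spec where "spec = (\<lambda>(Th, Ps). Th \<in> carrier_mat n ?N \<and> Ps \<in> carrier_mat n n \<and>
      (\<forall>mu us ys. mu \<in> carrier_vec n \<longrightarrow> (\<forall>i<T. us i \<in> carrier_vec m) \<longrightarrow>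
         (\<forall>i<T. ys i \<in> carrier_vec p) \<longrightarrow>
         xpred B X mu us ys T = Th *\<^sub>v stack_data m p T us ys + Ps *\<^sub>v mu))"
  have eq: "xpred B X mu us ys T = Th *\<^sub>v stack_data m p T us ys + trans X 0 T *\<^sub>v mu"
    if mu: "dim_vec mu = n" and u: "\<And>i. i < T \<Longrightarrow> dim_vec (us i) = m" and y: "\<And>i. i < T \<Longrightarrow> dim_vec (ys i) = p"
    for mu us ys
  proof -
    let ?U = "\<lambda>i. us i + 1 \<cdot>\<^sub>v 0\<^sub>v m" and ?Y = "\<lambda>i. ys i + 1 \<cdot>\<^sub>v 0\<^sub>v p"
    \<comment> \<open>Padding with zeros splits the prediction into a data part with zero mean and a
      mean part with zero data.\<close>
    have "xpred B X mu us ys T = xpred B X (0\<^sub>v n + 1 \<cdot>\<^sub>v mu) ?U ?Y T"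
    proof -
      have "0\<^sub>v n + 1 \<cdot>\<^sub>v mu = mu" using mu by (intro eq_vecI) simp_all
      moreover have "?U i = us i" "?Y i = ys i" if "i < T" for i using u[OF that] y[OF that] by (auto intro!: eq_vecI)
      ultimately show ?thesis using xpred_cong[of T us ?U ys ?Y B X mu] by simp
    qed
    also have "\<dots> = xpred B X (0\<^sub>v n) us ys T + 1 \<cdot>\<^sub>v xpred B X mu (\<lambda>_. 0\<^sub>v m) (\<lambda>_. 0\<^sub>v p) T"
      by (rule xpred_superpose[OF X B]) (use mu u y in simp_all)
    also have "xpred B X (0\<^sub>v n) us ys T = f (stack_data m p T us ys)"
      unfolding f_def using u y by (intro xpred_cong) (simp_all add: blocks_stack)
    also have "\<dots> = Th *\<^sub>v stack_data m p T us ys" by (rule fTh) (simp add: stack_data_def)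
    finally show ?thesis using xpred_zero_data[OF X B mu] by simp
  qed
  have coeffs: "kf_coeffs n m p A B C Q R X T = The spec" by (simp add: kf_coeffs_def spec_def)
  also have "\<dots> = (Th, trans X 0 T)"
  proof (rule the_equality)
    show "spec (Th, trans X 0 T)"
      unfolding spec_def prod.case
    proof (intro conjI allI impI eq)
      show "Th \<in> carrier_mat n ?N" "trans X 0 T \<in> carrier_mat n n" using Th X by (intro carrier_matI; simp)+
    qed auto
    fix q assume q: "spec q"
    obtain Th' Ps where q_def: "q = (Th', Ps)" by (cases q)
    have q': "Th' \<in> carrier_mat n ?N" "Ps \<in> carrier_mat n n"
      "\<forall>mu us ys. mu \<in> carrier_vec n \<longrightarrow> (\<forall>i<T. us i \<in> carrier_vec m) \<longrightarrow>
         (\<forall>i<T. ys i \<in> carrier_vec p) \<longrightarrow>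
         xpred B X mu us ys T = Th' *\<^sub>v stack_data m p T us ys + Ps *\<^sub>v mu"
      using q unfolding q_def spec_def prod.case by blast+
    note d = carrier_matD[OF q'(1)] carrier_matD[OF q'(2)]
    have eq': "xpred B X mu us ys T = Th' *\<^sub>v stack_data m p T us ys + Ps *\<^sub>v mu"
      if "dim_vec mu = n" "\<And>i. i < T \<Longrightarrow> dim_vec (us i) = m" "\<And>i. i < T \<Longrightarrow> dim_vec (ys i) = p" for mu us ys
      using q'(3) that carrier_vecI by blast
    \<comment> \<open>Zero mean, with data unpacked from \<open>v\<close>, isolates the first
      coefficient; zero data will isolate the second.\<close>
    have "Th' = Th"
    proof (rule mat_eqI_vec)
      fix v :: "real vec" assume "dim_vec v = dim_col Th"
      then have v: "dim_vec v = ?N" using Th by simp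
      have "Th' *\<^sub>v v + 0\<^sub>v n = Th *\<^sub>v v + 0\<^sub>v n"
        using eq[of "0\<^sub>v n" "u_block m v" "y_block m p T v"] eq'[of "0\<^sub>v n" "u_block m v" "y_block m p T v"]
          d X by (simp add: stack_blocks[OF v] mult_mat_zero_vec)
      moreover have "Th' *\<^sub>v v + 0\<^sub>v n = Th' *\<^sub>v v" "Th *\<^sub>v v + 0\<^sub>v n = Th *\<^sub>v v"
        using d Th by (auto intro!: eq_vecI)
      ultimately show "Th' *\<^sub>v v = Th *\<^sub>v v" by simp
    qed (use d Th in simp_all)
    moreover have "Ps = trans X 0 T"
    proof (rule mat_eqI_vec)
      fix v :: "real vec" assume "dim_vec v = dim_col (trans X 0 T)"
      then have v: "dim_vec v = n" using X by simp
      let ?s = "Th *\<^sub>v stack_data m p T (\<lambda>_. 0\<^sub>v m) (\<lambda>_. 0\<^sub>v p)"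
      have sum: "?s + Ps *\<^sub>v v = ?s + trans X 0 T *\<^sub>v v"
        using eq[OF v, of "\<lambda>_. 0\<^sub>v m" "\<lambda>_. 0\<^sub>v p"] eq'[OF v, of "\<lambda>_. 0\<^sub>v m" "\<lambda>_. 0\<^sub>v p"] \<open>Th' = Th\<close> by simp
      show "Ps *\<^sub>v v = trans X 0 T *\<^sub>v v"
      proof (rule eq_vecI)
        fix i assume "i < dim_vec (trans X 0 T *\<^sub>v v)"
        then have i: "i < n" using X by simp
        have "?s $ i + (Ps *\<^sub>v v) $ i = ?s $ i + (trans X 0 T *\<^sub>v v) $ i"
          using arg_cong[OF sum, of "\<lambda>x. x $ i"] i d X Th by simp
        then show "(Ps *\<^sub>v v) $ i = (trans X 0 T *\<^sub>v v) $ i" by linarith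
      qed (use d X in simp)
    qed (use d X in simp_all)
    ultimately show "q = (Th, trans X 0 T)" by (simp add: q_def)
  qed
  finally show ?thesis using Th fTh by (intro exI[of _ Th]) (simp add: f_def)
qed

end

section \<open>Forgetting the initial covariance\<close>

lemma geometric_partial_sum_le:
  fixes \<rho> :: real
  assumes "0 < \<rho>" "\<rho> < 1"
  shows "(\<Sum>s<T. \<rho> ^ s) \<le> 1 / (1 - \<rho>)"
  using sum_le_suminf[of "\<lambda>s. \<rho> ^ s" "{..<T}"] assms by (simp add: suminf_geometric summable_geometric)

context kalman_filter
begin

text \<open>\<open>trans\<close> grows at its latest factor, whereas variation of constants has to
  split off the earliest one.\<close>

lemma trans_Suc_left:
  "cov X \<Longrightarrow> trans X s (Suc k) = trans X (Suc s) k * closed (prior X s)"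
proof (induction k)
  case 0
  have cv: "cov (prior X s)" using prior_cov[OF 0] .
  show ?case using cv by (intro mat_eqI_vec) (simp_all add: mult_mat_vec_assoc_dim one_mult_mat_vec_dim)
next
  case (Suc k)
  have cv: "cov (prior X t)" for t using prior_cov[OF Suc.prems] .
  have "trans X s (Suc (Suc k)) = closed (prior X (s + Suc k)) * (trans X (Suc s) k * closed (prior X s))"
    using Suc by simp
  also have "\<dots> = trans X (Suc s) (Suc k) * closed (prior X s)"
    using cv Suc.prems by (simp add: mult_mat_assoc_dim)
  finally show ?case .
qed

lemma prior_diff:
  assumes X: "cov X" and Y: "cov Y"
  shows "prior X t - prior Y t = trans X 0 t * (X - Y) * (trans Y 0 t)\<^sup>T"
proof (induction t)
  case 0
  then show ?case using X Y
    by (intro mat_eqI_vec) (simp_all add: mult_mat_vec_assoc_dim one_mult_mat_vec_dim)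
next
  case (Suc t)
  have cX: "cov (prior X t)" and cY: "cov (prior Y t)" using prior_cov X Y by simp_all
  have "prior X (Suc t) - prior Y (Suc t) = closed (prior X t) * (prior X t - prior Y t) * (closed (prior Y t))\<^sup>T"
    unfolding kf_prior_Suc by (rule riccati_diff[OF cX cY])
  also have "\<dots> = trans X 0 (Suc t) * (X - Y) * (trans Y 0 (Suc t))\<^sup>T"
    unfolding Suc using X Y cX cY by (simp add: transpose_mult_dim mult_mat_assoc_dim)
  finally show ?case .
qed

text \<open>Variation of constants, phrased through \<open>trans X t j\<close> so that the induction closes.\<close>

lemma driven_bound:
  assumes X: "cov X" and c: "0 \<le> c" and \<rho>: "0 < \<rho>"
    and bound: "\<And>s k. op_bound (trans X s k) (c * \<rho> ^ k)"
    and g0: "g 0 = 0\<^sub>v n" and h_dim: "\<And>t. t < T \<Longrightarrow> dim_vec (h t) = n"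
    and rec: "\<And>t. t < T \<Longrightarrow> g (Suc t) = closed (prior X t) *\<^sub>v g t + h t"
    and h: "\<And>t. t < T \<Longrightarrow> vnorm (h t) \<le> H t"
  shows "vnorm (g T) \<le> c * (\<Sum>s<T. \<rho> ^ (T - Suc s) * H s)"
proof -
  have dim: "dim_vec (g t) = n" if "t \<le> T" for t
    using that g0 rec h_dim by (cases t) simp_all
  \<comment> \<open>Bounding step by step would multiply a factor \<open>c\<close>, possibly above
    1, at every time. Letting \<open>j\<close> further steps act on \<open>g t\<close> keeps each
    product whole, so \<open>c\<close> occurs once per input.\<close>
  have "vnorm (trans X t j *\<^sub>v g t) \<le> c * (\<Sum>s<t. \<rho> ^ (t + j - Suc s) * H s)" if "t \<le> T" for t j
    using that
  proof (induction t arbitrary: j)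
    case 0
    then show ?case using X by (simp add: g0 mult_mat_zero_vec)
  next
    case (Suc t)
    have cv: "cov (prior X t)" using prior_cov[OF X] .
    have d: "dim_vec (g t) = n" "dim_vec (h t) = n" using dim[of t] h_dim[of t] Suc.prems by simp_all
    have "trans X (Suc t) j *\<^sub>v g (Suc t) = trans X t (Suc j) *\<^sub>v g t + trans X (Suc t) j *\<^sub>v h t"
      unfolding trans_Suc_left[OF X] using rec[of t] Suc.prems X cv d
      by (simp add: mult_mat_vec_add_dim mult_mat_vec_assoc_dim)
    then have "vnorm (trans X (Suc t) j *\<^sub>v g (Suc t)) \<le> vnorm (trans X t (Suc j) *\<^sub>v g t) + vnorm (trans X (Suc t) j *\<^sub>v h t)"
      using X cv by (simp add: vnorm_triangle del: trans.simps)
    moreover have "vnorm (trans X t (Suc j) *\<^sub>v g t) \<le> c * (\<Sum>s<t. \<rho> ^ (t + Suc j - Suc s) * H s)"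
      using Suc.prems by (intro Suc.IH) simp
    moreover have "vnorm (trans X (Suc t) j *\<^sub>v h t) \<le> c * (\<rho> ^ j * H t)"
    proof -
      have "vnorm (trans X (Suc t) j *\<^sub>v h t) \<le> c * \<rho> ^ j * vnorm (h t)"
        using X d by (intro op_boundD[OF bound]) simp
      also have "\<dots> \<le> c * \<rho> ^ j * H t" using h[of t] Suc.prems c \<rho> by (intro mult_left_mono) simp_all
      finally show ?thesis by (simp add: mult.assoc)
    qed
    ultimately show ?case by (simp add: distrib_left)
  qed
  from this[of T 0] dim[of T] show ?thesis by (simp add: one_mult_mat_vec_dim)
qed

text \<open>Here \<open>T\<close> is the initial horizon. The difference of the two predictors obeys
  the closed loop of \<open>X\<close>, driven by the gain mismatch applied to the innovation of the
  \<open>Y\<close> predictor. The dimension clauses let the coefficients, known only through a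
  description, be multiplied and subtracted later.\<close>

lemma forgetting:
  assumes obs: "observable n A C" and stab: "stabilizable A (mat_sqrt Q)"
    and X: "cov X" and Y: "cov Y" and B: "dim_row B = n" "dim_col B = m"
  shows "\<exists>\<rho> K. 0 < \<rho> \<and> \<rho> < 1 \<and>
    (\<forall>T. op_bound (kf_theta n m p A B C Q R X T - kf_theta n m p A B C Q R Y T) (K * \<rho> ^ T) \<and>
      op_bound (kf_psi n m p A B C Q R Y T) (K * \<rho> ^ T) \<and>
      op_bound (prior X T - prior Y T) (K * \<rho> ^ T) \<and>
      dim_row (kf_theta n m p A B C Q R X T) = n \<and>
      dim_row (kf_theta n m p A B C Q R Y T) = n \<and>
      dim_col (kf_theta n m p A B C Q R X T) = dim_col (kf_theta n m p A B C Q R Y T) \<and>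
      dim_row (kf_psi n m p A B C Q R Y T) = n)"
proof -
  obtain c1 \<rho>1 where 1: "0 \<le> c1" "0 < \<rho>1" "\<rho>1 < 1" and b1: "\<And>s k. op_bound (trans X s k) (c1 * \<rho>1 ^ k)"
    using trans_exponentially_stable[OF obs stab X] by blast
  obtain c2 \<rho>2 where 2: "0 \<le> c2" "0 < \<rho>2" "\<rho>2 < 1" and b2: "\<And>s k. op_bound (trans Y s k) (c2 * \<rho>2 ^ k)"
    using trans_exponentially_stable[OF obs stab Y] by blast
  define c \<rho> where "c = max c1 c2" and "\<rho> = max \<rho>1 \<rho>2"
  have c: "0 \<le> c" and \<rho>: "0 < \<rho>" "\<rho> < 1" using 1 2 by (auto simp: c_def \<rho>_def)
  have tX: "op_bound (trans X s k) (c * \<rho> ^ k)" for s k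
    by (rule op_bound_mono[OF b1]) (use 1 c in \<open>auto simp: c_def \<rho>_def intro!: mult_mono power_mono\<close>)
  have tY: "op_bound (trans Y s k) (c * \<rho> ^ k)" for s k
    by (rule op_bound_mono[OF b2]) (use 2 c in \<open>auto simp: c_def \<rho>_def intro!: mult_mono power_mono\<close>)
  have cX: "cov (prior X t)" and cY: "cov (prior Y t)" for t using prior_cov X Y by simp_all
  obtain mY where mY: "\<And>t. op_bound (prior Y t) mY" using prior_bounded[OF obs Y] by blast
  obtain w where w: "\<And>Z. cov Z \<Longrightarrow> op_bound (mat_inv (innov Z)) w" using innov_inv_bound by blast
  obtain cA cB cC cD where cA: "op_bound A cA" and cB: "op_bound B cB" and cC: "op_bound C cC"
    and cD: "op_bound (X - Y) cD" using op_bound_exists by metis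
  note cCT = op_bound_transpose[OF cC]
  have nn: "0 \<le> cA" "0 \<le> cB" "0 \<le> cC" "0 \<le> cD" using cA cB cC cD op_bound_nonneg by blast+
  \<comment> \<open>One factor of the rate comes from each side, the transition matrix of
    \<open>X\<close> and that of \<open>Y\<close>.\<close>
  have prior_b: "op_bound (prior X t - prior Y t) (c * c * cD * \<rho> ^ t * \<rho> ^ t)" for t
    using op_bound_mult[OF op_bound_mult[OF tX[of 0 t] cD] op_bound_transpose[OF tY[of 0 t]]] X Y
    by (simp add: prior_diff[OF X Y] mult_ac)
  define k where "k = mY * cC * w"
  have gainY: "op_bound (gain (prior Y t)) k" for t
    using op_bound_mult[OF op_bound_mult[OF mY[of t] cCT] w[OF cY]] cY[of t] by (simp add: gain_eq k_def)
  have k: "0 \<le> k" using op_bound_nonneg[OF gainY] .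
  have corrY: "op_bound (corr (prior Y t)) (1 + k * cC)" for t
    unfolding corr_def using op_bound_diff[OF op_bound_one[of n] op_bound_mult[OF gainY[of t] cC]] cY[of t] by simp
  define E where "E = cA * ((1 + k * cC) * (c * c * cD * (cC * w)))"
  have gain_b: "op_bound (A * (gain (prior X t) - gain (prior Y t))) (E * (\<rho> ^ t * \<rho> ^ t))" for t
  proof -
    have "op_bound ((prior X t - prior Y t) * (C\<^sup>T * mat_inv (innov (prior X t)))) (c * c * cD * \<rho> ^ t * \<rho> ^ t * (cC * w))"
      using cX[of t] cY[of t] by (intro op_bound_mult[OF prior_b] op_bound_mult[OF cCT] w) simp_all
    then have "op_bound (gain (prior X t) - gain (prior Y t)) ((1 + k * cC) * (c * c * cD * \<rho> ^ t * \<rho> ^ t * (cC * w)))"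
      unfolding gain_diff[OF cX cY] using cX[of t] cY[of t] by (intro op_bound_mult[OF corrY]) simp_all
    then have "op_bound (A * (gain (prior X t) - gain (prior Y t))) (cA * ((1 + k * cC) * (c * c * cD * \<rho> ^ t * \<rho> ^ t * (cC * w))))"
      using cX[of t] cY[of t] by (intro op_bound_mult[OF cA]) simp_all
    then show ?thesis by (simp add: E_def mult_ac)
  qed
  have E: "0 \<le> E" using op_bound_nonneg[OF gain_b[of 0]] by simp
  define G where "G = 1 / (1 - \<rho>)"
  have G: "0 < G" using \<rho> by (simp add: G_def)
  \<comment> \<open>Bound of the \<open>Y\<close> predictor per unit of data norm: one datum
    contributes at most \<open>cA * k + cB\<close>, and the decay sums to \<open>G\<close>,
    independently of the horizon.\<close>
  define xb where "xb = c * ((cA * k + cB) * G)"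
  have xb: "0 \<le> xb" using c nn k G by (simp add: xb_def)
  define K1 where "K1 = c * (E * (1 + cC * xb)) * G / \<rho>"
  have theta: "op_bound (kf_theta n m p A B C Q R X T - kf_theta n m p A B C Q R Y T) (K1 * \<rho> ^ T)"
    and theta_dim: "dim_row (kf_theta n m p A B C Q R X T) = n" "dim_row (kf_theta n m p A B C Q R Y T) = n"
      "dim_col (kf_theta n m p A B C Q R X T) = dim_col (kf_theta n m p A B C Q R Y T)"
    and psi: "kf_psi n m p A B C Q R Y T = trans Y 0 T" for T
  proof -
    obtain Th1 where Th1: "dim_row Th1 = n" "dim_col Th1 = T * m + T * p"
      "kf_coeffs n m p A B C Q R X T = (Th1, trans X 0 T)"
      "\<And>d. dim_vec d = T * m + T * p \<Longrightarrow> Th1 *\<^sub>v d = xpred B X (0\<^sub>v n) (u_block m d) (y_block m p T d) T"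
      using kf_coeffs_characterization[OF X B, of T] by blast
    obtain Th2 where Th2: "dim_row Th2 = n" "dim_col Th2 = T * m + T * p"
      "kf_coeffs n m p A B C Q R Y T = (Th2, trans Y 0 T)"
      "\<And>d. dim_vec d = T * m + T * p \<Longrightarrow> Th2 *\<^sub>v d = xpred B Y (0\<^sub>v n) (u_block m d) (y_block m p T d) T"
      using kf_coeffs_characterization[OF Y B, of T] by blast
    have th: "kf_theta n m p A B C Q R X T = Th1" "kf_theta n m p A B C Q R Y T = Th2"
      using Th1 Th2 by (simp_all add: kf_theta_def)
    show "kf_psi n m p A B C Q R Y T = trans Y 0 T" using Th2 by (simp add: kf_psi_def)
    show "dim_row (kf_theta n m p A B C Q R X T) = n" "dim_row (kf_theta n m p A B C Q R Y T) = n"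
      "dim_col (kf_theta n m p A B C Q R X T) = dim_col (kf_theta n m p A B C Q R Y T)"
      using Th1 Th2 th by simp_all
    show "op_bound (kf_theta n m p A B C Q R X T - kf_theta n m p A B C Q R Y T) (K1 * \<rho> ^ T)"
      unfolding th
    proof (rule op_boundI)
      show "0 \<le> K1 * \<rho> ^ T" using c E nn xb G \<rho> by (simp add: K1_def)
      fix d :: "real vec" assume "dim_vec d = dim_col (Th1 - Th2)"
      then have d: "dim_vec d = T * m + T * p" using Th2 by simp
      define u y where "u = u_block m d" and "y = y_block m p T d"
      have uy [simp]: "dim_vec (u t) = m" "dim_vec (y t) = p" for t by (simp_all add: u_def y_def)
      \<comment> \<open>Each block is dominated by the whole data vector, so no constant depends on
        the number \<open>T\<close> of blocks.\<close>
      have uy_le: "vnorm (u t) \<le> vnorm d" "vnorm (y t) \<le> vnorm d" if "t < T" for t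
        using block_vnorm_le[OF d that] by (simp_all add: u_def y_def)
      define x where "x t = xpred B X (0\<^sub>v n) u y t" for t
      define x' where "x' t = xpred B Y (0\<^sub>v n) u y t" for t
      have xd [simp]: "dim_vec (x t) = n" "dim_vec (x' t) = n" for t using B by (simp_all add: x_def x'_def)
      have x_rec: "x (Suc t) = closed (prior X t) *\<^sub>v x t + (A *\<^sub>v (gain (prior X t) *\<^sub>v y t) + B *\<^sub>v u t)" for t
        unfolding x_def using B by (intro xpred_Suc[OF X]) simp_all
      have x'_rec: "x' (Suc t) = closed (prior Y t) *\<^sub>v x' t + (A *\<^sub>v (gain (prior Y t) *\<^sub>v y t) + B *\<^sub>v u t)" for t
        unfolding x'_def using B by (intro xpred_Suc[OF Y]) simp_all
      have x'_le: "vnorm (x' t) \<le> xb * vnorm d" if "t \<le> T" for t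
      proof -
        have "vnorm (x' t) \<le> c * (\<Sum>s<t. \<rho> ^ (t - Suc s) * ((cA * k + cB) * vnorm d))"
        proof (rule driven_bound[OF Y c \<rho>(1) tY _ _ x'_rec])
          show "x' 0 = 0\<^sub>v n" by (simp add: x'_def)
          show "dim_vec (A *\<^sub>v (gain (prior Y s) *\<^sub>v y s) + B *\<^sub>v u s) = n" for s using B by simp
          fix s assume "s < t"
          then have s: "s < T" using that by simp
          have "vnorm (A *\<^sub>v (gain (prior Y s) *\<^sub>v y s)) \<le> cA * vnorm (gain (prior Y s) *\<^sub>v y s)"
            using cY[of s] by (intro op_boundD[OF cA]) simp
          also have "\<dots> \<le> cA * (k * vnorm (y s))"
            using cY[of s] nn by (intro mult_left_mono op_boundD[OF gainY]) simp_all
          also have "\<dots> \<le> cA * (k * vnorm d)" using uy_le[OF s] nn k by (intro mult_left_mono) simp_all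
          finally have 1: "vnorm (A *\<^sub>v (gain (prior Y s) *\<^sub>v y s)) \<le> cA * (k * vnorm d)" .
          have "vnorm (B *\<^sub>v u s) \<le> cB * vnorm (u s)" using B by (intro op_boundD[OF cB]) simp
          also have "\<dots> \<le> cB * vnorm d" using uy_le[OF s] nn by (intro mult_left_mono) simp_all
          finally have 2: "vnorm (B *\<^sub>v u s) \<le> cB * vnorm d" .
          have "vnorm (A *\<^sub>v (gain (prior Y s) *\<^sub>v y s) + B *\<^sub>v u s) \<le>
              vnorm (A *\<^sub>v (gain (prior Y s) *\<^sub>v y s)) + vnorm (B *\<^sub>v u s)"
            using B by (intro vnorm_triangle) simp
          then show "vnorm (A *\<^sub>v (gain (prior Y s) *\<^sub>v y s) + B *\<^sub>v u s) \<le> (cA * k + cB) * vnorm d"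
            using 1 2 by (simp add: algebra_simps)
        qed
        also have "(\<Sum>s<t. \<rho> ^ (t - Suc s) * ((cA * k + cB) * vnorm d)) = (\<Sum>s<t. \<rho> ^ s) * ((cA * k + cB) * vnorm d)"
          by (simp add: sum.nat_diff_reindex[of "\<lambda>i. \<rho> ^ i"] flip: sum_distrib_right)
        also have "c * \<dots> \<le> c * (G * ((cA * k + cB) * vnorm d))"
          unfolding G_def using c nn k \<rho> geometric_partial_sum_le[OF \<rho>] by (intro mult_left_mono mult_right_mono) simp_all
        finally show ?thesis by (simp add: xb_def mult_ac)
      qed
      define e where "e t = x t - x' t" for t
      \<comment> \<open>Rewriting \<open>X\<close>'s recursion around \<open>x'\<close> leaves only
        the gain mismatch acting on the innovation.\<close>
      define h where "h t = (A * (gain (prior X t) - gain (prior Y t))) *\<^sub>v (y t - C *\<^sub>v x' t)" for t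
      have e_rec: "e (Suc t) = closed (prior X t) *\<^sub>v e t + h t" for t
      proof -
        have cl: "closed (prior Z t) *\<^sub>v v = A *\<^sub>v v - A *\<^sub>v (gain (prior Z t) *\<^sub>v (C *\<^sub>v v))"
          if "cov (prior Z t)" "dim_vec v = n" for Z v
          using that by (simp add: closed_def corr_def mat_vec_simps)
        show ?thesis
          unfolding e_def h_def x_rec x'_rec using cX[of t] cY[of t] B
          by (simp add: cl mult_mat_vec_diff_dim mult_mat_vec_assoc_dim minus_mat_mult_vec_dim) (intro eq_vecI, simp_all)
      qed
      have h_le: "vnorm (h t) \<le> E * (1 + cC * xb) * vnorm d * (\<rho> ^ t * \<rho> ^ t)" if "t < T" for t
      proof -
        have "vnorm (y t - C *\<^sub>v x' t) \<le> vnorm (y t) + vnorm (C *\<^sub>v x' t)" by (intro vnorm_triangle_diff) simp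
        also have "vnorm (C *\<^sub>v x' t) \<le> cC * vnorm (x' t)" by (intro op_boundD[OF cC]) simp
        also have "\<dots> \<le> cC * (xb * vnorm d)" using x'_le[of t] that nn by (intro mult_left_mono) simp_all
        finally have *: "vnorm (y t - C *\<^sub>v x' t) \<le> (1 + cC * xb) * vnorm d"
          using uy_le[OF that] by (simp add: algebra_simps)
        have "vnorm (h t) \<le> E * (\<rho> ^ t * \<rho> ^ t) * vnorm (y t - C *\<^sub>v x' t)"
          unfolding h_def using cX[of t] cY[of t] by (intro op_boundD[OF gain_b]) simp
        also have "\<dots> \<le> E * (\<rho> ^ t * \<rho> ^ t) * ((1 + cC * xb) * vnorm d)"
          using * E \<rho> by (intro mult_left_mono) simp_all
        finally show ?thesis by (simp add: mult_ac)
      qed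
      let ?q = "E * (1 + cC * xb) * vnorm d"
      have q: "0 \<le> ?q" using E nn xb by simp
      have "vnorm (e T) \<le> c * (\<Sum>s<T. \<rho> ^ (T - Suc s) * (?q * (\<rho> ^ s * \<rho> ^ s)))"
      proof (rule driven_bound[OF X c \<rho>(1) tX _ _ e_rec h_le])
        show "e 0 = 0\<^sub>v n" unfolding e_def by (intro eq_vecI) (simp_all add: x_def x'_def)
        show "dim_vec (h t) = n" for t by (simp add: h_def)
      qed
      \<comment> \<open>One of the two factors \<open>\<rho> ^ s\<close> completes the exponent to
        \<open>T - 1\<close>, whence the division by \<open>\<rho>\<close>; the other keeps the sum
        below \<open>G\<close> for every \<open>T\<close>.\<close>
      also have "(\<Sum>s<T. \<rho> ^ (T - Suc s) * (?q * (\<rho> ^ s * \<rho> ^ s))) = ?q / \<rho> * \<rho> ^ T * (\<Sum>s<T. \<rho> ^ s)"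
        unfolding sum_distrib_left
      proof (rule sum.cong)
        fix s assume "s \<in> {..<T}"
        then have "\<rho> ^ T = \<rho> ^ (T - Suc s) * \<rho> ^ Suc s"
          using power_add[of \<rho> "T - Suc s" "Suc s"] by simp
        then show "\<rho> ^ (T - Suc s) * (?q * (\<rho> ^ s * \<rho> ^ s)) = ?q / \<rho> * \<rho> ^ T * \<rho> ^ s"
          using \<rho> by (simp add: field_simps)
      qed simp
      also have "c * \<dots> \<le> c * (?q / \<rho> * \<rho> ^ T * G)"
        using c q \<rho> geometric_partial_sum_le[OF \<rho>] unfolding G_def
        by (intro mult_left_mono) simp_all
      finally have "vnorm (e T) \<le> K1 * \<rho> ^ T * vnorm d" by (simp add: K1_def mult_ac)
      moreover have "(Th1 - Th2) *\<^sub>v d = e T"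
        using Th1 Th2 d by (simp add: minus_mat_mult_vec_dim e_def x_def x'_def u_def y_def)
      ultimately show "vnorm ((Th1 - Th2) *\<^sub>v d) \<le> K1 * \<rho> ^ T * vnorm d" by simp
    qed
  qed
  define K where "K = max K1 (max c (c * c * cD))"
  have le: "a * \<rho> ^ T \<le> K * \<rho> ^ T" if "a \<le> K" for a T using that \<rho> by (intro mult_right_mono) simp_all
  have "op_bound (prior X T - prior Y T) (K * \<rho> ^ T)" for T
  proof (rule op_bound_mono[OF prior_b])
    have "c * c * cD * \<rho> ^ T * \<rho> ^ T \<le> c * c * cD * \<rho> ^ T * 1"
      using c nn \<rho> by (intro mult_left_mono power_le_one) simp_all
    also have "\<dots> \<le> K * \<rho> ^ T" using le[of "c * c * cD" T] by (simp add: K_def)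
    finally show "c * c * cD * \<rho> ^ T * \<rho> ^ T \<le> K * \<rho> ^ T" .
  qed
  moreover have "op_bound (kf_psi n m p A B C Q R Y T) (K * \<rho> ^ T)" for T
    unfolding psi by (rule op_bound_mono[OF tY]) (rule le, simp add: K_def)
  moreover have "op_bound (kf_theta n m p A B C Q R X T - kf_theta n m p A B C Q R Y T) (K * \<rho> ^ T)" for T
    by (rule op_bound_mono[OF theta]) (rule le, simp add: K_def)
  ultimately show ?thesis using \<rho> theta_dim psi trans_dim(1)[OF Y] by (intro exI[of _ \<rho>] exI[of _ K]) simp
qed

end

text \<open>The common block \<open>H\<close> cancels, so only the leading slice of the vector is
  seen, and a slice has no larger norm.\<close>

lemma op_bound_hcat_diff:
  assumes M: "op_bound (M - M') c" and d: "dim_row M = dim_row H" "dim_row M' = dim_row H" "dim_col M = dim_col M'"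
  shows "op_bound (hcat M H - hcat M' H) c"
proof (rule op_boundI)
  show "0 \<le> c" using op_bound_nonneg[OF M] .
  let ?k = "dim_col M'" and ?l = "dim_col H"
  fix v :: "real vec" assume "dim_vec v = dim_col (hcat M H - hcat M' H)"
  then have v: "dim_vec v = ?k + ?l" by (simp add: hcat_def)
  define w where "w = vec ?k (\<lambda>i. v $ (0 + i))"
  have "(hcat M H - hcat M' H) *\<^sub>v v = (M - M') *\<^sub>v w"
  proof (rule eq_vecI)
    fix i assume "i < dim_vec ((M - M') *\<^sub>v w)"
    then have i: "i < dim_row H" using d by simp
    have "((hcat M H - hcat M' H) *\<^sub>v v) $ i = (\<Sum>j = 0..<?k + ?l. (hcat M H - hcat M' H) $$ (i, j) * v $ j)"
      using i d v by (simp add: hcat_def scalar_prod_def)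
    also have "\<dots> = (\<Sum>j = 0..<?k. (hcat M H - hcat M' H) $$ (i, j) * v $ j)
        + (\<Sum>j = ?k..<?k + ?l. (hcat M H - hcat M' H) $$ (i, j) * v $ j)"
      by (rule sum.atLeastLessThan_concat[symmetric]) simp_all
    also have "(\<Sum>j = ?k..<?k + ?l. (hcat M H - hcat M' H) $$ (i, j) * v $ j) = 0"
      using i d by (intro sum.neutral) (auto simp: hcat_def)
    also have "(\<Sum>j = 0..<?k. (hcat M H - hcat M' H) $$ (i, j) * v $ j) = ((M - M') *\<^sub>v w) $ i"
      using i d by (simp add: hcat_def scalar_prod_def w_def)
    finally show "((hcat M H - hcat M' H) *\<^sub>v v) $ i = ((M - M') *\<^sub>v w) $ i" by simp
  qed (use d in \<open>simp add: hcat_def\<close>)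
  then have "vnorm ((hcat M H - hcat M' H) *\<^sub>v v) \<le> c * vnorm w"
    using op_boundD[OF M, of w] by (simp add: w_def)
  also have "\<dots> \<le> c * vnorm v"
    unfolding w_def using op_bound_nonneg[OF M] v by (intro mult_left_mono vnorm_slice) simp_all
  finally show "vnorm ((hcat M H - hcat M' H) *\<^sub>v v) \<le> c * vnorm v" .
qed

section \<open>Passage to the three limits\<close>

lemma mult_minus_distrib_mat_dim:
  "dim_col D = dim_row M \<Longrightarrow> dim_row M = dim_row N \<Longrightarrow> dim_col M = dim_col N \<Longrightarrow> D * (M - N) = D * M - D * N"
  for D M N :: "real mat"
  by (rule mult_minus_distrib_mat[of _ "dim_row D" "dim_row N" _ "dim_col N"]) (auto intro: carrier_matI)

lemma minus_mult_distrib_mat_dim: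
  "dim_col M = dim_row D \<Longrightarrow> dim_row M = dim_row N \<Longrightarrow> dim_col M = dim_col N \<Longrightarrow> (M - N) * D = M * D - N * D"
  for D M N :: "real mat"
  by (rule minus_mult_distrib_mat[of _ "dim_row N" "dim_col N" _ _ "dim_col D"]) (auto intro: carrier_matI)

text \<open>At the rate \<open>r\<close> itself the quotient is merely bounded; any slower rate
  \<open>\<rho>\<close> leaves the vanishing factor \<open>(r / \<rho>) ^ T\<close>.\<close>

lemma mnorm_tendsto_zero:
  assumes b: "\<And>T. op_bound (M T) (K * r ^ T)" and r: "0 < r" "r < \<rho>"
  shows "(\<lambda>T. mnorm (M T) / \<rho> ^ T) \<longlonglongrightarrow> 0"
proof (rule tendsto_sandwich[of "\<lambda>_. 0" _ _ "\<lambda>T. K * (r / \<rho>) ^ T"])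
  have "mnorm (M T) / \<rho> ^ T \<le> K * (r / \<rho>) ^ T" for T
    using mnorm_le[OF b[of T]] r by (simp add: power_divide divide_right_mono)
  then show "\<forall>\<^sub>F T in sequentially. mnorm (M T) / \<rho> ^ T \<le> K * (r / \<rho>) ^ T" by simp
  show "\<forall>\<^sub>F T in sequentially. 0 \<le> mnorm (M T) / \<rho> ^ T" using r by (simp add: mnorm_nonneg)
  have "(\<lambda>T. (r / \<rho>) ^ T) \<longlonglongrightarrow> 0" using r by (intro LIMSEQ_power_zero) simp
  then show "(\<lambda>T. K * (r / \<rho>) ^ T) \<longlonglongrightarrow> 0" by (rule tendsto_mult_right_zero)
qed simp

theorem theorem2:
  fixes n m p T :: nat
    and A B C Q R Sigma P :: "real mat"
  assumes "A \<in> carrier_mat n n" and "B \<in> carrier_mat n m" and "C \<in> carrier_mat p n"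
    and "Q \<in> carrier_mat n n" and "R \<in> carrier_mat p p"
    and "minimal_realization n A B C"
    and "psd_mat Q" and "pd_mat R"
    and "T \<ge> 1"
    and "stabilizable A (mat_sqrt Q)"
    and "Sigma \<in> carrier_mat n n" and "pd_mat Sigma"
    and "P \<in> carrier_mat n n" and "pd_mat P"
  shows "\<exists>\<rho>::real. 0 < \<rho> \<and> \<rho> < 1 \<and>
    (\<lambda>Tini. mnorm (eta_f n m p T A B C Q R Tini Sigma - eta_f n m p T A B C Q R Tini P) / \<rho> ^ Tini)
       \<longlonglongrightarrow> 0 \<and>
    (\<lambda>Tini. mnorm (O_f n p T A C * kf_psi n m p A B C Q R P Tini) / \<rho> ^ Tini) \<longlonglongrightarrow> 0 \<and>
    (\<lambda>Tini. mnorm (Y_f n p T A C Q R Tini Sigma - Y_f n p T A C Q R Tini P) / \<rho> ^ Tini)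
       \<longlonglongrightarrow> 0"
proof -
  interpret kalman_filter n p A C Q R
    using assms(1-5,7,8) by unfold_locales auto
  have X: "cov Sigma" and Y: "cov P" using assms(11-14) pd_imp_psd by (auto simp: cov_def)
  have obs: "observable n A C" using assms(6) by (simp add: minimal_realization_def)
  have B: "dim_row B = n" "dim_col B = m" using assms(2) by auto
  obtain r K where r: "0 < r" "r < 1"
    and theta: "\<And>t. op_bound (kf_theta n m p A B C Q R Sigma t - kf_theta n m p A B C Q R P t) (K * r ^ t)"
    and psi: "\<And>t. op_bound (kf_psi n m p A B C Q R P t) (K * r ^ t)"
    and prior: "\<And>t. op_bound (prior Sigma t - prior P t) (K * r ^ t)"
    and dim: "\<And>t. dim_row (kf_theta n m p A B C Q R Sigma t) = n" "\<And>t. dim_row (kf_theta n m p A B C Q R P t) = n"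
      "\<And>t. dim_col (kf_theta n m p A B C Q R Sigma t) = dim_col (kf_theta n m p A B C Q R P t)"
      "\<And>t. dim_row (kf_psi n m p A B C Q R P t) = n"
    using forgetting[OF obs assms(10) X Y B] by blast
  \<comment> \<open>The midpoint of \<open>r\<close> and 1, strictly slower than the proven rate and
    still below 1.\<close>
  define \<rho> where "\<rho> = (1 + r) / 2"
  have \<rho>: "0 < \<rho>" "\<rho> < 1" "r < \<rho>" using r by (simp_all add: \<rho>_def)
  let ?O = "O_f n p T A C" and ?G = "G_f n p T A C"
  have O: "dim_row ?O = T * p" "dim_col ?O = n" by (simp_all add: O_f_def)
  have G: "dim_row ?G = T * p" "dim_col ?G = T * n" by (simp_all add: G_f_def)
  obtain cO where cO: "op_bound ?O cO" using op_bound_exists by blast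
  have "op_bound (eta_f n m p T A B C Q R t Sigma - eta_f n m p T A B C Q R t P) (cO * K * r ^ t)" for t
  proof -
    have "op_bound (?O * (kf_theta n m p A B C Q R Sigma t - kf_theta n m p A B C Q R P t)) (cO * (K * r ^ t))"
      using O dim by (intro op_bound_mult[OF cO theta]) simp
    then show ?thesis
      unfolding eta_f_def using O G dim B
      by (intro op_bound_hcat_diff) (simp_all add: mult_minus_distrib_mat_dim mult.assoc H_f_def)
  qed
  moreover have "op_bound (?O * kf_psi n m p A B C Q R P t) (cO * K * r ^ t)" for t
    using op_bound_mult[OF cO psi[of t]] O dim by (simp add: mult.assoc)
  moreover have "op_bound (Y_f n p T A C Q R t Sigma - Y_f n p T A C Q R t P) (cO * K * cO * r ^ t)" for t
  proof -
    have d: "dim_row (prior Z t) = n" "dim_col (prior Z t) = n" if "cov Z" for Z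
      using prior_cov[OF that] by simp_all
    have "op_bound (?O * (prior Sigma t - prior P t) * ?O\<^sup>T) (cO * (K * r ^ t) * cO)"
      using O d[OF X] d[OF Y] by (intro op_bound_mult[OF op_bound_mult[OF cO prior] op_bound_transpose[OF cO]]) simp_all
    also have "?O * (prior Sigma t - prior P t) * ?O\<^sup>T = ?O * prior Sigma t * ?O\<^sup>T - ?O * prior P t * ?O\<^sup>T"
      using O d[OF X] d[OF Y] by (simp add: mult_minus_distrib_mat_dim minus_mult_distrib_mat_dim)
    also have "\<dots> = Y_f n p T A C Q R t Sigma - Y_f n p T A C Q R t P"
      unfolding Y_f_def using O G by (intro eq_matI) (simp_all add: kron_eye_def)
    finally show ?thesis by (simp add: mult_ac)
  qed
  ultimately show ?thesis
    using \<rho> r(1) by (intro exI[of _ \<rho>] conjI mnorm_tendsto_zero[where r = r]) auto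
qed

end
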